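(* Let $H$ and $L$ be Hopf algebras over a field $\Bbbk$ and let $(H,L)$ be a quasi-abelian partial matched pair with partial action $\rightharpoonup$ and partial coaction $\rho(h)=h^0\otimes h^1$. Suppose that $$(h^0\rightharpoonup 1_L)\otimes S_L(h^1)=\varepsilon_H({1_H}^0)\,\varepsilon_L(h\rightharpoonup 1_L)\,1_L\otimes {1_H}^1$$ and $$\varepsilon_H(h^0)\,(S_H(g)\rightharpoonup h^1)=\varepsilon_L(g\rightharpoonup 1_L)\,\varepsilon_H(h)\,\varepsilon_H({1_H}^0)\,{1_H}^1$$ for all $h,g\in H$. Then the bialgebra $L\underline{\overline{\#}}H$ is a Hopf algebra with antipode given by $$S(x\underline{\overline{\#}}h)=(1_L\underline{\overline{\#}}S_H(h^0))(S_L(h^1)S_L(x)\underline{\overline{\#}}1_H)$$ for all $x\in L$, $h\in H$.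
   Context: All vector spaces are over a fixed field $\Bbbk$; $\otimes=\otimes_{\Bbbk}$. Sweedler notation $\Delta(h)=h_1\otimes h_2$ (summation omitted) is used; $S_H,\varepsilon_H$ denote antipode and counit of $H$, and similarly for $L$. Left partial $H$-module algebra: a unital algebra $A$ with a linear map $\rightharpoonup:H\otimes A\to A$ such that $1_H\rightharpoonup a=a$; $h\rightharpoonup ab=(h_1\rightharpoonup a)(h_2\rightharpoonup b)$; $h\rightharpoonup(g\rightharpoonup a)=(h_1\rightharpoonup 1_A)(h_2g\rightharpoonup a)$, for all $h,g\in H$, $a,b\in A$. Right partial $L$-comodule coalgebra: a counital coalgebra $C$ with a linear map $\rho:C\to C\otimes L$, $\rho(c)=c^0\otimes c^1$ (summation omitted), such that $(id_C\otimes\varepsilon_L)\rho(c)=c$; $(\Delta_C\otimes id_L)\rho(c)={c_1}^0\otimes{c_2}^0\otimes{c_1}^1{c_2}^1$; $(\rho\otimes id_L)\rho(c)={c_1}^0\otimes({c_1}^1)_1\otimes({c_1}^1)_2\,\varepsilon_C({c_2}^0){c_2}^1$. Here ${c_i}^0\otimes{c_i}^1=\rho(c_i)$. Partial matched pair $(H,L)$: a pair of Hopf algebras such that (i) $L$ is a left partial $H$-module algebra via $\rightharpoonup$; (ii) $H$ is a right partial $L$-comodule coalgebra via $\rho(h)=h^0\otimes h^1$; (iii) for all $h,g\in H$, $x\in L$, in $H\otimes L\otimes L$, $(h_2g)^0\otimes(h_1\rightharpoonup x)_1\otimes(h_1\rightharpoonup x)_2(h_2g)^1={h_3}^0g^0\otimes({h_1}^0\rightharpoonup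 x_1)\otimes{h_1}^1(h_2\rightharpoonup x_2){h_3}^1(h_4\rightharpoonup g^1)$; (iv) $\varepsilon_L(h\rightharpoonup x)=\varepsilon_L(h\rightharpoonup 1_L)\varepsilon_L(x)$; (v) $\rho(1_H)=1_H\otimes\varepsilon_H({1_H}^0){1_H}^1$. It is quasi-abelian if ${h_2}^0\otimes(h_1\rightharpoonup x){h_2}^1={h_1}^0\otimes{h_1}^1(h_2\rightharpoonup x)$ for all $h\in H$, $x\in L$. The bialgebra $L\underline{\overline{\#}}H$: let $L\#H=L\otimes H$ with product $(x\#h)(y\#g)=x(h_1\rightharpoonup y)\#h_2g$. Then $L\underline{\overline{\#}}H$ is the subspace of $L\#H$ spanned by the elements $x\underline{\overline{\#}}h:=\varepsilon_L({h_1}^0\rightharpoonup 1_L)\,x{h_1}^1(h_2\rightharpoonup 1_L)\#h_3$ (for a quasi-abelian partial matched pair this equals $\varepsilon_H({h_1}^0)\,x{h_1}^1(h_2\rightharpoonup 1_L)\#h_3$), for $x\in L$, $h\in H$. It is a bialgebra with multiplication $(x\underline{\overline{\#}}h)(y\underline{\overline{\#}}g)=x(h_1\rightharpoonup y)\underline{\overline{\#}}h_2g$, unit $1_L\underline{\overline{\#}}1_H$, comultiplication $\Delta(x\underline{\overline{\#}}h)=x_1\underline{\overline{\#}}{h_1}^0\otimes x_2{h_1}^1\underline{\overline{\#}}h_2$ and counit $\varepsilon(x\underline{\overline{\#}}h)=\varepsilon_L(x)\varepsilon_L(h\rightharpoonup 1_L)$. *)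

theory Defs
  imports Complex_Main "HOL-Library.Function_Algebras"
begin

text \<open>
  A vector space over the field \<open>'k\<close> is a linear subspace \<open>carrier V\<close> of an ambient vector space
  on the type \<open>'a\<close>. The ambient space is arbitrary, and maps out of \<open>V\<close> are only constrained on
  \<open>carrier V\<close>.
\<close>

record ('k, 'a) vspace =
  carrier :: "'a set"
  scale :: "'k \<Rightarrow> 'a \<Rightarrow> 'a" (infixr "\<odot>\<index>" 75)

record ('k, 'a) bialg = "('k, 'a) vspace" +
  mult :: "'a \<Rightarrow> 'a \<Rightarrow> 'a" (infixl "\<cdot>\<index>" 70)
  one :: "'a" ("\<one>\<index>")
  comult :: "'a \<Rightarrow> ('a \<Rightarrow> 'a \<Rightarrow> 'k) \<Rightarrow> 'k"
  counit :: "'a \<Rightarrow> 'k"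

locale vspace =
  fixes V :: "('k::field, 'a::ab_group_add, 'm) vspace_scheme" (structure)
  assumes vector_space: "vector_space (scale V)"
    and subspace: "module.subspace (scale V) (carrier V)"

definition base_field :: "('k::field, 'k) vspace" where
  "base_field = \<lparr>carrier = UNIV, scale = (*)\<rparr>"

definition linear_on ::
  "('k, 'a::plus, 'm) vspace_scheme \<Rightarrow> ('k, 'b::plus, 'n) vspace_scheme \<Rightarrow> ('a \<Rightarrow> 'b) \<Rightarrow> bool" where
  "linear_on V W f \<longleftrightarrow>
     (\<forall>x \<in> carrier V. f x \<in> carrier W) \<and>
     (\<forall>x \<in> carrier V. \<forall>y \<in> carrier V. f (x + y) = f x + f y) \<and>
     (\<forall>c. \<forall>x \<in> carrier V. f (c \<odot>\<^bsub>V\<^esub> x) = c \<odot>\<^bsub>W\<^esub> f x)"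

definition bilinear_on ::
  "('k, 'a::plus, 'm) vspace_scheme \<Rightarrow> ('k, 'b::plus, 'n) vspace_scheme \<Rightarrow>
   ('k, 'c::plus, 'o) vspace_scheme \<Rightarrow> ('a \<Rightarrow> 'b \<Rightarrow> 'c) \<Rightarrow> bool" where
  "bilinear_on V W U f \<longleftrightarrow>
     (\<forall>x \<in> carrier V. linear_on W U (f x)) \<and> (\<forall>y \<in> carrier W. linear_on V U (\<lambda>x. f x y))"


section \<open>Tensor products\<close>

text \<open>
  Over a field, the canonical map from \<open>V \<otimes> W\<close> to the dual of the space of bilinear forms on
  \<open>V \<times> W\<close> is injective, because the dual of \<open>V \<otimes> W\<close> is that space of forms. Hence \<open>V \<otimes> W\<close> is realised
  as the span of the evaluation functionals \<open>v \<otimes> w : \<beta> \<mapsto> \<beta> v w\<close>. Its universal property is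
  \<open>tensor_universal_property\<close> below (uniqueness holds because the pure tensors span).
\<close>

definition tensor ::
  "('k::field, 'a::plus, 'm) vspace_scheme \<Rightarrow> ('k, 'b::plus, 'n) vspace_scheme \<Rightarrow>
   'a \<Rightarrow> 'b \<Rightarrow> ('a \<Rightarrow> 'b \<Rightarrow> 'k) \<Rightarrow> 'k" where
  "tensor V W v w = (\<lambda>\<beta>. if bilinear_on V W base_field \<beta> then \<beta> v w else 0)"

definition pointwise_scale :: "'k::field \<Rightarrow> ('x \<Rightarrow> 'k) \<Rightarrow> 'x \<Rightarrow> 'k" where
  "pointwise_scale c f = (\<lambda>x. c * f x)"

definition tensor_space ::
  "('k::field, 'a::plus, 'm) vspace_scheme \<Rightarrow> ('k, 'b::plus, 'n) vspace_scheme \<Rightarrow>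
   ('k, ('a \<Rightarrow> 'b \<Rightarrow> 'k) \<Rightarrow> 'k) vspace" where
  "tensor_space V W =
     \<lparr>carrier = module.span pointwise_scale {tensor V W v w | v w. v \<in> carrier V \<and> w \<in> carrier W},
      scale = pointwise_scale\<rparr>"

text \<open>\<open>tensor3 U V W u v w\<close> is \<open>u \<otimes> v \<otimes> w\<close>, with \<open>U \<otimes> V \<otimes> W\<close> bracketed to the right.\<close>

definition tensor3 where
  "tensor3 U V W u v w = tensor U (tensor_space V W) u (tensor V W v w)"

text \<open>
  Sweedler notation: \<open>tensor_sum V W t (\<lambda>v w. f v w)\<close> is the value at \<open>t \<in> V \<otimes> W\<close> of the linear map
  induced by the bilinear map \<open>f\<close>, that is, the sum of \<open>f v w\<close> over the summands of any
  representation of \<open>t\<close> as a sum of pure tensors \<open>v \<otimes> w\<close>.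
\<close>

definition tensor_sum ::
  "('k::field, 'a::plus, 'm) vspace_scheme \<Rightarrow> ('k, 'b::plus, 'n) vspace_scheme \<Rightarrow>
   (('a \<Rightarrow> 'b \<Rightarrow> 'k) \<Rightarrow> 'k) \<Rightarrow> ('a \<Rightarrow> 'b \<Rightarrow> 'c::monoid_add) \<Rightarrow> 'c" where
  "tensor_sum V W t f =
     (let r = (SOME r. set r \<subseteq> carrier V \<times> carrier W \<and> (\<Sum>(v, w)\<leftarrow>r. tensor V W v w) = t)
      in \<Sum>(v, w)\<leftarrow>r. f v w)"

definition sweedler ::
  "('k::field, 'a::plus, 'm) bialg_scheme \<Rightarrow> 'a \<Rightarrow> ('a \<Rightarrow> 'a \<Rightarrow> 'c::monoid_add) \<Rightarrow> 'c" where
  "sweedler C c f = tensor_sum C C (comult C c) f"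

definition sweedler3 ::
  "('k::field, 'a::plus, 'm) bialg_scheme \<Rightarrow> 'a \<Rightarrow> ('a \<Rightarrow> 'a \<Rightarrow> 'a \<Rightarrow> 'c::monoid_add) \<Rightarrow> 'c" where
  "sweedler3 C c f = sweedler C c (\<lambda>c1 r. sweedler C r (\<lambda>c2 c3. f c1 c2 c3))"

definition sweedler4 ::
  "('k::field, 'a::plus, 'm) bialg_scheme \<Rightarrow> 'a \<Rightarrow> ('a \<Rightarrow> 'a \<Rightarrow> 'a \<Rightarrow> 'a \<Rightarrow> 'c::monoid_add) \<Rightarrow> 'c" where
  "sweedler4 C c f = sweedler C c (\<lambda>c1 r. sweedler3 C r (\<lambda>c2 c3 c4. f c1 c2 c3 c4))"


subsection \<open>Universal property\<close>

lemma vector_space_pointwise_scale: "vector_space pointwise_scale"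
  by unfold_locales (auto simp: pointwise_scale_def fun_eq_iff algebra_simps)

lemma (in vspace) carrier_closed:
  shows "0 \<in> carrier V"
    and "x \<in> carrier V \<Longrightarrow> y \<in> carrier V \<Longrightarrow> x + y \<in> carrier V"
    and "x \<in> carrier V \<Longrightarrow> c \<odot> x \<in> carrier V"
proof -
  interpret vector_space "scale V" by (rule vector_space)
  show "0 \<in> carrier V"
    and "x \<in> carrier V \<Longrightarrow> y \<in> carrier V \<Longrightarrow> x + y \<in> carrier V"
    and "x \<in> carrier V \<Longrightarrow> c \<odot> x \<in> carrier V"
    using subspace by (auto simp: subspace_def)
qed

lemma (in vspace) separating_functional:
  assumes "x \<noteq> 0"
  obtains \<phi> where "linear_on V base_field \<phi>" "\<phi> x \<noteq> 0"
proof -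
  interpret vector_space_pair "scale V" "(*)"
    using vector_space
    by (auto simp: vector_space_pair_def vector_space_def algebra_simps)
  have "vs1.independent {x}" using assms by simp
  then obtain \<phi> where \<phi>: "Vector_Spaces.linear (scale V) (*) \<phi>" "\<forall>y\<in>{x}. \<phi> y = 1"
    using linear_independent_extend[of "{x}" "\<lambda>_. 1"] by blast
  interpret \<phi>: Vector_Spaces.linear "scale V" "(*)" \<phi> by fact
  show ?thesis
    by (rule that[of \<phi>]) (use \<phi>(2) \<phi>.add \<phi>.scale in \<open>auto simp: linear_on_def base_field_def\<close>)
qed

lemma sum_list_in_carrier:
  assumes "vspace V" "\<And>x. x \<in> set xs \<Longrightarrow> g x \<in> carrier V"
  shows "(\<Sum>x\<leftarrow>xs. g x) \<in> carrier V"
  using assms(2) by (induction xs) (auto intro: vspace.carrier_closed[OF assms(1)])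

lemma linear_on_sum_list:
  assumes "vspace V" "vspace W" "linear_on V W f" "\<And>x. x \<in> set xs \<Longrightarrow> g x \<in> carrier V"
  shows "f (\<Sum>x\<leftarrow>xs. g x) = (\<Sum>x\<leftarrow>xs. f (g x))"
  using assms(4)
proof (induction xs)
  case Nil
  have "f (0 + 0) = f 0 + f 0"
    using assms vspace.carrier_closed(1)[OF assms(1)] unfolding linear_on_def by blast
  then show ?case by simp
next
  case (Cons x xs)
  then show ?case
    using assms(3) sum_list_in_carrier[OF assms(1), of xs g] by (simp add: linear_on_def)
qed

lemma vspace_base_field: "vspace base_field"
  by (auto simp: vspace_def base_field_def vector_space_def module.subspace_def module_def
      algebra_simps)

lemma bilinear_on_tensor:
  assumes "vspace V" "vspace W"
  shows "bilinear_on V W (tensor_space V W) (tensor V W)"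
proof -
  interpret T: vector_space pointwise_scale by (rule vector_space_pointwise_scale)
  have "tensor V W v w \<in> carrier (tensor_space V W)" if "v \<in> carrier V" "w \<in> carrier W" for v w
    using that by (auto simp: tensor_space_def intro!: T.span_base)
  then show ?thesis
    using vspace.carrier_closed[OF assms(1)] vspace.carrier_closed[OF assms(2)]
    unfolding bilinear_on_def linear_on_def
    by (auto simp: tensor_def tensor_space_def pointwise_scale_def fun_eq_iff
        bilinear_on_def linear_on_def base_field_def)
qed

lemma vspace_tensor_space:
  fixes V :: "('k::field, 'a::plus, 'm) vspace_scheme"
    and W :: "('k, 'b::plus, 'n) vspace_scheme"
  shows "vspace (tensor_space V W)"
proof -
  interpret T: vector_space "pointwise_scale :: 'k \<Rightarrow> (('a \<Rightarrow> 'b \<Rightarrow> 'k) \<Rightarrow> 'k) \<Rightarrow> _"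
    by (rule vector_space_pointwise_scale)
  show ?thesis
    by unfold_locales (auto simp: tensor_space_def algebra_simps)
qed

lemma tensor_space_representation:
  assumes V: "vspace V" and W: "vspace W" and t: "t \<in> carrier (tensor_space V W)"
  obtains r where "set r \<subseteq> carrier V \<times> carrier W" "(\<Sum>(v, w)\<leftarrow>r. tensor V W v w) = t"
proof -
  interpret T: vector_space pointwise_scale by (rule vector_space_pointwise_scale)
  have "t \<in> T.span {tensor V W v w | v w. v \<in> carrier V \<and> w \<in> carrier W}"
    using t by (simp add: tensor_space_def)
  then have "\<exists>r. set r \<subseteq> carrier V \<times> carrier W \<and> (\<Sum>(v, w)\<leftarrow>r. tensor V W v w) = t"
  proof (induction rule: T.span_induct_alt)
    case base
    show ?case by (intro exI[of _ "[]"]) simp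
  next
    case (step c p q)
    then obtain v w r where vw: "v \<in> carrier V" "w \<in> carrier W" "p = tensor V W v w"
      and r: "set r \<subseteq> carrier V \<times> carrier W" "(\<Sum>(v, w)\<leftarrow>r. tensor V W v w) = q"
      by blast
    have "tensor V W (c \<odot>\<^bsub>V\<^esub> v) w = pointwise_scale c p"
      using bilinear_on_tensor[OF V W] vw
      by (simp add: bilinear_on_def linear_on_def tensor_space_def)
    then show ?case
      using vw(1,2) r vspace.carrier_closed(3)[OF V]
      by (intro exI[of _ "(c \<odot>\<^bsub>V\<^esub> v, w) # r"]) auto
  qed
  then show ?thesis using that by blast
qed

lemma tensor_sum_list_apply:
  "(\<Sum>(v, w)\<leftarrow>r. tensor V W v w) \<beta> =
     (if bilinear_on V W base_field \<beta> then \<Sum>(v, w)\<leftarrow>r. \<beta> v w else 0)"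
  by (induction r) (auto simp: tensor_def)

lemma tensor_sum_eq_sum_list:
  assumes V: "vspace V" and W: "vspace W" and U: "vspace U" and f: "bilinear_on V W U f"
    and r: "set r \<subseteq> carrier V \<times> carrier W" and t: "(\<Sum>(v, w)\<leftarrow>r. tensor V W v w) = t"
  shows "tensor_sum V W t f = (\<Sum>(v, w)\<leftarrow>r. f v w)"
proof -
  define r' where
    "r' = (SOME r. set r \<subseteq> carrier V \<times> carrier W \<and> (\<Sum>(v, w)\<leftarrow>r. tensor V W v w) = t)"
  have r': "set r' \<subseteq> carrier V \<times> carrier W" "(\<Sum>(v, w)\<leftarrow>r'. tensor V W v w) = t"
    using someI[of "\<lambda>r. set r \<subseteq> carrier V \<times> carrier W \<and> (\<Sum>(v, w)\<leftarrow>r. tensor V W v w) = t" r] r t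
    unfolding r'_def by auto
  let ?s = "\<lambda>r. \<Sum>(v, w)\<leftarrow>r. f v w"
  have mem: "?s q \<in> carrier U" if "set q \<subseteq> carrier V \<times> carrier W" for q
    using that f by (intro sum_list_in_carrier[OF U]) (auto simp: bilinear_on_def linear_on_def)
  have "?s r' = ?s r"
  proof (rule ccontr)
    assume "?s r' \<noteq> ?s r"
    then have "?s r' - ?s r \<noteq> 0" by simp
    with vspace.separating_functional[OF U] obtain \<phi>
      where \<phi>: "linear_on U base_field \<phi>" "\<phi> (?s r' - ?s r) \<noteq> 0" by blast
    have d: "?s r' - ?s r \<in> carrier U"
    proof -
      interpret vector_space "scale U" by (rule vspace.vector_space[OF U])
      show ?thesis
        using mem[OF r'(1)] mem[OF r] vspace.subspace[OF U] subspace_diff by blast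
    qed
    have "\<phi> (?s r + (?s r' - ?s r)) = \<phi> (?s r) + \<phi> (?s r' - ?s r)"
      using \<phi>(1) mem[OF r] d unfolding linear_on_def by blast
    with \<phi>(2) have ne: "\<phi> (?s r') \<noteq> \<phi> (?s r)" by simp
    have b: "bilinear_on V W base_field (\<lambda>v w. \<phi> (f v w))"
      using f \<phi>(1) by (auto simp: bilinear_on_def linear_on_def)
    have "\<phi> (?s q) = (\<Sum>(v, w)\<leftarrow>q. tensor V W v w) (\<lambda>v w. \<phi> (f v w))"
      if q: "set q \<subseteq> carrier V \<times> carrier W" for q
    proof -
      have "\<phi> (?s q) = (\<Sum>p\<leftarrow>q. \<phi> (case p of (v, w) \<Rightarrow> f v w))"
        using q f by (intro linear_on_sum_list[OF U vspace_base_field \<phi>(1)])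
          (auto simp: bilinear_on_def linear_on_def)
      also have "\<dots> = (\<Sum>(v, w)\<leftarrow>q. \<phi> (f v w))"
        by (intro arg_cong[where f = sum_list] map_cong) auto
      finally show ?thesis using b by (simp add: tensor_sum_list_apply)
    qed
    from this[OF r'(1)] this[OF r] ne r'(2) t show False by simp
  qed
  then show ?thesis by (simp add: tensor_sum_def r'_def[symmetric] Let_def)
qed

lemma tensor_universal_property:
  assumes V: "vspace V" and W: "vspace W" and U: "vspace U" and f: "bilinear_on V W U f"
  shows "linear_on (tensor_space V W) U (\<lambda>t. tensor_sum V W t f)"
    and "\<And>v w. v \<in> carrier V \<Longrightarrow> w \<in> carrier W \<Longrightarrow> tensor_sum V W (tensor V W v w) f = f v w"
proof -
  note eq = tensor_sum_eq_sum_list[OF V W U f]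
  show "tensor_sum V W (tensor V W v w) f = f v w" if "v \<in> carrier V" "w \<in> carrier W" for v w
    using that eq[of "[(v, w)]"] by simp
  have mem: "tensor_sum V W t f \<in> carrier U" if t: "t \<in> carrier (tensor_space V W)" for t
  proof -
    from tensor_space_representation[OF V W t] obtain r
      where r: "set r \<subseteq> carrier V \<times> carrier W" "(\<Sum>(v, w)\<leftarrow>r. tensor V W v w) = t" by blast
    have "(\<Sum>(v, w)\<leftarrow>r. f v w) \<in> carrier U"
      using r(1) f by (intro sum_list_in_carrier[OF U]) (auto simp: bilinear_on_def linear_on_def)
    then show ?thesis using eq[OF r] by simp
  qed
  have add: "tensor_sum V W (s + t) f = tensor_sum V W s f + tensor_sum V W t f"
    if s: "s \<in> carrier (tensor_space V W)" and t: "t \<in> carrier (tensor_space V W)" for s t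
  proof -
    from tensor_space_representation[OF V W s] obtain q
      where q: "set q \<subseteq> carrier V \<times> carrier W" "(\<Sum>(v, w)\<leftarrow>q. tensor V W v w) = s" by blast
    from tensor_space_representation[OF V W t] obtain r
      where r: "set r \<subseteq> carrier V \<times> carrier W" "(\<Sum>(v, w)\<leftarrow>r. tensor V W v w) = t" by blast
    show ?thesis
      using eq[of "q @ r" "s + t"] eq[OF q] eq[OF r] q r by simp
  qed
  have scale: "tensor_sum V W (c \<odot>\<^bsub>tensor_space V W\<^esub> t) f = c \<odot>\<^bsub>U\<^esub> tensor_sum V W t f"
    if t: "t \<in> carrier (tensor_space V W)" for c t
  proof -
    from tensor_space_representation[OF V W t] obtain r
      where r: "set r \<subseteq> carrier V \<times> carrier W" "(\<Sum>(v, w)\<leftarrow>r. tensor V W v w) = t" by blast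
    let ?r = "map (\<lambda>(v, w). (c \<odot>\<^bsub>V\<^esub> v, w)) r"
    interpret U: vector_space "scale U" by (rule vspace.vector_space[OF U])
    interpret T: vector_space pointwise_scale by (rule vector_space_pointwise_scale)
    have sub: "set ?r \<subseteq> carrier V \<times> carrier W"
      using r(1) vspace.carrier_closed(3)[OF V] by auto
    have "(\<Sum>(v, w)\<leftarrow>map (\<lambda>(v, w). (c \<odot>\<^bsub>V\<^esub> v, w)) q. tensor V W v w) =
        pointwise_scale c (\<Sum>(v, w)\<leftarrow>q. tensor V W v w)" if "set q \<subseteq> carrier V \<times> carrier W" for q
      using that bilinear_on_tensor[OF V W]
      by (induction q)
        (auto simp: bilinear_on_def linear_on_def tensor_space_def T.scale_right_distrib)
    then have *: "(\<Sum>(v, w)\<leftarrow>?r. tensor V W v w) = c \<odot>\<^bsub>tensor_space V W\<^esub> t"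
      using r by (simp add: tensor_space_def)
    have "(\<Sum>(v, w)\<leftarrow>map (\<lambda>(v, w). (c \<odot>\<^bsub>V\<^esub> v, w)) q. f v w) =
        c \<odot>\<^bsub>U\<^esub> (\<Sum>(v, w)\<leftarrow>q. f v w)" if "set q \<subseteq> carrier V \<times> carrier W" for q
      using that f
      by (induction q) (auto simp: bilinear_on_def linear_on_def U.scale_right_distrib)
    then show ?thesis using eq[OF sub *] eq[OF r] r(1) by simp
  qed
  show "linear_on (tensor_space V W) U (\<lambda>t. tensor_sum V W t f)"
    using mem add scale by (simp add: linear_on_def)
qed


section \<open>Hopf algebras\<close>

locale algebra = vspace A
  for A :: "('k::field, 'a::ab_group_add, 'm) bialg_scheme" (structure) +
  assumes mult_bilinear: "bilinear_on A A A (mult A)"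
    and one_closed: "\<one> \<in> carrier A"
    and mult_assoc:
      "x \<in> carrier A \<Longrightarrow> y \<in> carrier A \<Longrightarrow> z \<in> carrier A \<Longrightarrow> (x \<cdot> y) \<cdot> z = x \<cdot> (y \<cdot> z)"
    and mult_one: "x \<in> carrier A \<Longrightarrow> x \<cdot> \<one> = x"
    and one_mult: "x \<in> carrier A \<Longrightarrow> \<one> \<cdot> x = x"

locale coalgebra = vspace C
  for C :: "('k::field, 'a::ab_group_add, 'm) bialg_scheme" (structure) +
  assumes comult_linear: "linear_on C (tensor_space C C) (comult C)"
    and counit_linear: "linear_on C base_field (counit C)"
    and coassoc:
      "c \<in> carrier C \<Longrightarrow>
         sweedler C c (\<lambda>a b. sweedler C a (\<lambda>a1 a2. tensor3 C C C a1 a2 b)) =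
         sweedler C c (\<lambda>a b. sweedler C b (\<lambda>b1 b2. tensor3 C C C a b1 b2))"
    and counit_left: "c \<in> carrier C \<Longrightarrow> sweedler C c (\<lambda>c1 c2. counit C c1 \<odot> c2) = c"
    and counit_right: "c \<in> carrier C \<Longrightarrow> sweedler C c (\<lambda>c1 c2. counit C c2 \<odot> c1) = c"

locale bialgebra = algebra B + coalgebra B
  for B :: "('k::field, 'a::ab_group_add, 'm) bialg_scheme" (structure) +
  assumes comult_mult:
      "x \<in> carrier B \<Longrightarrow> y \<in> carrier B \<Longrightarrow>
         comult B (x \<cdot> y) =
         sweedler B x (\<lambda>x1 x2. sweedler B y (\<lambda>y1 y2. tensor B B (x1 \<cdot> y1) (x2 \<cdot> y2)))"
    and comult_one: "comult B \<one> = tensor B B \<one> \<one>"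
    and counit_mult:
      "x \<in> carrier B \<Longrightarrow> y \<in> carrier B \<Longrightarrow> counit B (x \<cdot> y) = counit B x * counit B y"
    and counit_one: "counit B \<one> = 1"

locale hopf_algebra = bialgebra B
  for B :: "('k::field, 'a::ab_group_add, 'm) bialg_scheme" (structure) +
  fixes S :: "'a \<Rightarrow> 'a"
  assumes antipode_linear: "linear_on B B S"
    and antipode_left: "x \<in> carrier B \<Longrightarrow> sweedler B x (\<lambda>x1 x2. S x1 \<cdot> x2) = counit B x \<odot> \<one>"
    and antipode_right: "x \<in> carrier B \<Longrightarrow> sweedler B x (\<lambda>x1 x2. x1 \<cdot> S x2) = counit B x \<odot> \<one>"


section \<open>Partial matched pairs\<close>

text \<open>Linear maps out of \<open>H \<otimes> A\<close> are given as bilinear maps on \<open>H \<times> A\<close>.\<close>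

locale partial_module_algebra = H: bialgebra H + A: algebra A
  for H :: "('k::field, 'h::ab_group_add, 'm) bialg_scheme"
    and A :: "('k, 'a::ab_group_add, 'n) bialg_scheme" +
  fixes act :: "'h \<Rightarrow> 'a \<Rightarrow> 'a" (infixr "\<rightharpoonup>" 80)
  assumes act_bilinear: "bilinear_on H A A (\<rightharpoonup>)"
    and one_act: "a \<in> carrier A \<Longrightarrow> \<one>\<^bsub>H\<^esub> \<rightharpoonup> a = a"
    and act_mult:
      "h \<in> carrier H \<Longrightarrow> a \<in> carrier A \<Longrightarrow> b \<in> carrier A \<Longrightarrow>
         h \<rightharpoonup> (a \<cdot>\<^bsub>A\<^esub> b) = sweedler H h (\<lambda>h1 h2. (h1 \<rightharpoonup> a) \<cdot>\<^bsub>A\<^esub> (h2 \<rightharpoonup> b))"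
    and act_act:
      "h \<in> carrier H \<Longrightarrow> g \<in> carrier H \<Longrightarrow> a \<in> carrier A \<Longrightarrow>
         h \<rightharpoonup> g \<rightharpoonup> a = sweedler H h (\<lambda>h1 h2. (h1 \<rightharpoonup> \<one>\<^bsub>A\<^esub>) \<cdot>\<^bsub>A\<^esub> ((h2 \<cdot>\<^bsub>H\<^esub> g) \<rightharpoonup> a))"

text \<open>The Sweedler notation \<open>\<rho>(c) = c\<^sup>0 \<otimes> c\<^sup>1\<close> for a coaction is \<open>tensor_sum C L (\<rho> c) (\<lambda>c0 c1. \<dots>)\<close>.\<close>

locale partial_comodule_coalgebra = L: bialgebra L + C: coalgebra C
  for L :: "('k::field, 'l::ab_group_add, 'm) bialg_scheme"
    and C :: "('k, 'c::ab_group_add, 'n) bialg_scheme" +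
  fixes \<rho> :: "'c \<Rightarrow> ('c \<Rightarrow> 'l \<Rightarrow> 'k) \<Rightarrow> 'k"
  assumes coact_linear: "linear_on C (tensor_space C L) \<rho>"
    and coact_counit:
      "c \<in> carrier C \<Longrightarrow> tensor_sum C L (\<rho> c) (\<lambda>c0 c1. counit L c1 \<odot>\<^bsub>C\<^esub> c0) = c"
    and coact_comult:
      "c \<in> carrier C \<Longrightarrow>
         tensor_sum C L (\<rho> c) (\<lambda>c0 c1. sweedler C c0 (\<lambda>u v. tensor3 C C L u v c1)) =
         sweedler C c (\<lambda>c1 c2.
           tensor_sum C L (\<rho> c1) (\<lambda>c10 c11. tensor_sum C L (\<rho> c2) (\<lambda>c20 c21.
             tensor3 C C L c10 c20 (c11 \<cdot>\<^bsub>L\<^esub> c21))))"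
    and coact_coact:
      "c \<in> carrier C \<Longrightarrow>
         tensor_sum C L (\<rho> c) (\<lambda>c0 c1. tensor_sum C L (\<rho> c0) (\<lambda>c00 c01. tensor3 C L L c00 c01 c1)) =
         sweedler C c (\<lambda>c1 c2.
           tensor_sum C L (\<rho> c1) (\<lambda>c10 c11. tensor_sum C L (\<rho> c2) (\<lambda>c20 c21.
             sweedler L c11 (\<lambda>u v. tensor3 C L L c10 u (v \<cdot>\<^bsub>L\<^esub> (counit C c20 \<odot>\<^bsub>L\<^esub> c21))))))"

locale partial_matched_pair =
  H: hopf_algebra H SH + L: hopf_algebra L SL +
  partial_module_algebra H L act + partial_comodule_coalgebra L H \<rho>
  for H :: "('k::field, 'h::ab_group_add, 'm) bialg_scheme" and SH :: "'h \<Rightarrow> 'h"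
    and L :: "('k, 'l::ab_group_add, 'n) bialg_scheme" and SL :: "'l \<Rightarrow> 'l"
    and act :: "'h \<Rightarrow> 'l \<Rightarrow> 'l" (infixr "\<rightharpoonup>" 80)
    and \<rho> :: "'h \<Rightarrow> ('h \<Rightarrow> 'l \<Rightarrow> 'k) \<Rightarrow> 'k" +
  assumes compatibility:
      "h \<in> carrier H \<Longrightarrow> g \<in> carrier H \<Longrightarrow> x \<in> carrier L \<Longrightarrow>
         sweedler H h (\<lambda>h1 h2.
           tensor_sum H L (\<rho> (h2 \<cdot>\<^bsub>H\<^esub> g)) (\<lambda>k0 k1. sweedler L (h1 \<rightharpoonup> x) (\<lambda>u v.
             tensor3 H L L k0 u (v \<cdot>\<^bsub>L\<^esub> k1)))) =
         sweedler4 H h (\<lambda>h1 h2 h3 h4. sweedler L x (\<lambda>x1 x2.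
           tensor_sum H L (\<rho> h1) (\<lambda>h10 h11. tensor_sum H L (\<rho> h3) (\<lambda>h30 h31.
             tensor_sum H L (\<rho> g) (\<lambda>g0 g1.
               tensor3 H L L (h30 \<cdot>\<^bsub>H\<^esub> g0) (h10 \<rightharpoonup> x1)
                 (h11 \<cdot>\<^bsub>L\<^esub> (h2 \<rightharpoonup> x2) \<cdot>\<^bsub>L\<^esub> h31 \<cdot>\<^bsub>L\<^esub> (h4 \<rightharpoonup> g1)))))))"
    and counit_act:
      "h \<in> carrier H \<Longrightarrow> x \<in> carrier L \<Longrightarrow>
         counit L (h \<rightharpoonup> x) = counit L (h \<rightharpoonup> \<one>\<^bsub>L\<^esub>) * counit L x"
    and coact_one:
      "\<rho> \<one>\<^bsub>H\<^esub> =
         tensor H L \<one>\<^bsub>H\<^esub> (tensor_sum H L (\<rho> \<one>\<^bsub>H\<^esub>) (\<lambda>u l. counit H u \<odot>\<^bsub>L\<^esub> l))"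

locale quasi_abelian_partial_matched_pair = partial_matched_pair +
  assumes quasi_abelian:
    "h \<in> carrier H \<Longrightarrow> x \<in> carrier L \<Longrightarrow>
       sweedler H h (\<lambda>h1 h2. tensor_sum H L (\<rho> h2) (\<lambda>h20 h21.
         tensor H L h20 ((h1 \<rightharpoonup> x) \<cdot>\<^bsub>L\<^esub> h21))) =
       sweedler H h (\<lambda>h1 h2. tensor_sum H L (\<rho> h1) (\<lambda>h10 h11.
         tensor H L h10 (h11 \<cdot>\<^bsub>L\<^esub> (h2 \<rightharpoonup> x))))"


section \<open>The bialgebra attached to a partial matched pair\<close>

definition partial_smash ::
  "('k::field, 'h::ab_group_add, 'm) bialg_scheme \<Rightarrow> ('k, 'l::ab_group_add, 'n) bialg_scheme \<Rightarrow>
   ('h \<Rightarrow> 'l \<Rightarrow> 'l) \<Rightarrow> ('h \<Rightarrow> ('h \<Rightarrow> 'l \<Rightarrow> 'k) \<Rightarrow> 'k) \<Rightarrow> 'l \<Rightarrow> 'h \<Rightarrow> ('l \<Rightarrow> 'h \<Rightarrow> 'k) \<Rightarrow> 'k" where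
  "partial_smash H L act \<rho> x h =
     sweedler3 H h (\<lambda>h1 h2 h3. tensor_sum H L (\<rho> h1) (\<lambda>h10 h11.
       counit L (act h10 \<one>\<^bsub>L\<^esub>) \<odot>\<^bsub>tensor_space L H\<^esub>
         tensor L H (x \<cdot>\<^bsub>L\<^esub> h11 \<cdot>\<^bsub>L\<^esub> act h2 \<one>\<^bsub>L\<^esub>) h3))"

text \<open>
  The elements \<open>partial_smash H L act \<rho> x h\<close> span the carrier, so the equations below determine
  the (bi)linear operations of \<open>B\<close>.
\<close>

locale partial_smash_bialgebra =
  fixes H :: "('k::field, 'h::ab_group_add, 'm) bialg_scheme"
    and L :: "('k, 'l::ab_group_add, 'n) bialg_scheme"
    and act :: "'h \<Rightarrow> 'l \<Rightarrow> 'l" (infixr "\<rightharpoonup>" 80)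
    and \<rho> :: "'h \<Rightarrow> ('h \<Rightarrow> 'l \<Rightarrow> 'k) \<Rightarrow> 'k"
    and B :: "('k, ('l \<Rightarrow> 'h \<Rightarrow> 'k) \<Rightarrow> 'k) bialg"
    and ps :: "'l \<Rightarrow> 'h \<Rightarrow> ('l \<Rightarrow> 'h \<Rightarrow> 'k) \<Rightarrow> 'k" (infix "\<sharp>" 65)
  defines "ps \<equiv> partial_smash H L (\<rightharpoonup>) \<rho>"
  assumes smash_bialgebra: "bialgebra B"
    and smash_carrier:
      "carrier B = module.span (scale (tensor_space L H)) {x \<sharp> h | x h. x \<in> carrier L \<and> h \<in> carrier H}"
    and smash_scale: "scale B = scale (tensor_space L H)"
    and smash_mult:
      "x \<in> carrier L \<Longrightarrow> h \<in> carrier H \<Longrightarrow> y \<in> carrier L \<Longrightarrow> g \<in> carrier H \<Longrightarrow>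
         (x \<sharp> h) \<cdot>\<^bsub>B\<^esub> (y \<sharp> g) =
         sweedler H h (\<lambda>h1 h2. (x \<cdot>\<^bsub>L\<^esub> (h1 \<rightharpoonup> y)) \<sharp> (h2 \<cdot>\<^bsub>H\<^esub> g))"
    and smash_one: "\<one>\<^bsub>B\<^esub> = \<one>\<^bsub>L\<^esub> \<sharp> \<one>\<^bsub>H\<^esub>"
    and smash_comult:
      "x \<in> carrier L \<Longrightarrow> h \<in> carrier H \<Longrightarrow>
         comult B (x \<sharp> h) =
         sweedler L x (\<lambda>x1 x2. sweedler H h (\<lambda>h1 h2. tensor_sum H L (\<rho> h1) (\<lambda>h10 h11.
           tensor B B (x1 \<sharp> h10) ((x2 \<cdot>\<^bsub>L\<^esub> h11) \<sharp> h2))))"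
    and smash_counit:
      "x \<in> carrier L \<Longrightarrow> h \<in> carrier H \<Longrightarrow>
         counit B (x \<sharp> h) = counit L x * counit L (h \<rightharpoonup> \<one>\<^bsub>L\<^esub>)"

end

theory Submission
  imports Defs
begin

text \<open>
  Write \<open>\<lambda>(h) = \<epsilon>\<^sub>L(h \<rightharpoonup> 1)\<close> and \<open>\<l> = \<epsilon>\<^sub>H(1\<^sup>0) 1\<^sup>1\<close>. The two conditions on the antipodes force the partial
  action and the partial coaction to be almost global. The first one, with the counit of \<open>L\<close> on its
  second leg, gives \<open>h \<rightharpoonup> 1 = \<lambda>(h) 1\<close> (\<open>act_unit\<close>), and then \<open>\<lambda>(h\<^sup>0) S(h\<^sup>1) = \<lambda>(h) \<l>\<close> (\<open>ro_ant\<close>). The second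
  one gives \<open>\<epsilon>(h\<^sup>0) h\<^sup>1 = \<epsilon>(h) \<l>\<close> (\<open>ro_eps\<close>) and \<open>\<lambda> \<circ> S = \<lambda>\<close> (\<open>lam_ant\<close>). The axioms of a quasi-abelian
  partial matched pair now say that \<open>\<l>\<close> is a central idempotent of \<open>L\<close> with
  \<open>\<Delta>(\<l>) (1 \<otimes> \<l>) = \<l> \<otimes> \<l>\<close>, that dually \<open>\<lambda>\<close> is a central idempotent of the convolution algebra of
  functionals on \<open>H\<close> with \<open>\<lambda>(h\<^sub>1) \<lambda>(h\<^sub>2 g) = \<lambda>(h) \<lambda>(g)\<close>, and that \<open>\<lambda>(h\<^sub>1\<^sup>0) h\<^sub>1\<^sup>1 \<lambda>(h\<^sub>2) = \<lambda>(h) \<l>\<close>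
  (\<open>ro_lam_lam\<close>).

  The last identity shows that the spanning element with parameters \<open>x\<close> and \<open>h\<close> is the pure tensor
  \<open>x \<l> \<otimes> \<lambda>(h\<^sub>1) h\<^sub>2\<close> (\<open>partial_smash_ps\<close>). The bialgebra is thus the image of \<open>L \<otimes> H\<close> under the tensor
  product of two idempotent maps, and linear maps on it correspond to the bilinear maps \<open>f\<close> with
  \<open>f(x \<l>, h) = f(x, h)\<close> and \<open>\<lambda>(h\<^sub>1) f(x, h\<^sub>2) = f(x, h)\<close>. Hence product, coproduct, counit and antipode
  exist as soon as the formulas that prescribe them satisfy these two equations
  (\<open>smash_mul_invariant_left\<close>, \<open>smash_mul_invariant_right\<close>, \<open>smash_cop_invariant\<close>, \<open>eps_lam_invariant\<close>,
  \<open>smash_ant_invariant\<close>). The axioms are then checked on spanning elements. There the calculations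
  are those for the bicrossed product of a global matched pair, since the additional factors \<open>\<l>\<close> and
  \<open>\<lambda>\<close> are absorbed; the substantial ones are \<open>copB_coassoc_ps\<close>, \<open>comB_mul_ps\<close>, \<open>antipode_left_ps\<close>
  and \<open>antipode_right_ps\<close>.

  All calculations are done in Sweedler notation. A tensor is represented by a list of pairs, and an
  axiom of \<open>H\<close>, of \<open>L\<close> or of the pair becomes a rule that replaces one iterated sum by another one for
  every multilinear summand.
\<close>

section \<open>Sums over representations of tensors\<close>

abbreviation lin ::
  "('k::field \<Rightarrow> 'a::ab_group_add \<Rightarrow> 'a) \<Rightarrow> ('k \<Rightarrow> 'b::ab_group_add \<Rightarrow> 'b) \<Rightarrow> ('a \<Rightarrow> 'b) \<Rightarrow> bool" where
  "lin \<equiv> Vector_Spaces.linear"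

definition bilin where
  "bilin r s t f \<longleftrightarrow> (\<forall>y. lin r t (\<lambda>x. f x y)) \<and> (\<forall>x. lin s t (f x))"

definition trilin where
  "trilin r s q t f \<longleftrightarrow> (\<forall>y z. lin r t (\<lambda>x. f x y z)) \<and> (\<forall>x z. lin s t (\<lambda>y. f x y z)) \<and>
     (\<forall>x y. lin q t (f x y))"

text \<open>
  Rules that prove a map linear by descending into a term. In a multilinear expression the variable
  occurs exactly once, so at every step one rule applies.
\<close>

named_theorems multilinear

lemma bilinI [multilinear]:
  "(\<And>y. lin r t (\<lambda>x. f x y)) \<Longrightarrow> (\<And>x. lin s t (\<lambda>y. f x y)) \<Longrightarrow> bilin r s t f"
  by (simp add: bilin_def)

lemma trilinI [multilinear]:
  "(\<And>y z. lin r t (\<lambda>x. f x y z)) \<Longrightarrow> (\<And>x z. lin s t (\<lambda>y. f x y z)) \<Longrightarrow>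
   (\<And>x y. lin q t (\<lambda>z. f x y z)) \<Longrightarrow> trilin r s q t f"
  by (simp add: trilin_def)

lemma lin_iff:
  "lin s t f \<longleftrightarrow> vector_space s \<and> vector_space t \<and>
     (\<forall>x y. f (x + y) = f x + f y) \<and> (\<forall>c x. f (s c x) = t c (f x))"
  by (rule Vector_Spaces.linear_iff)

lemma lin_zero: "lin s t f \<Longrightarrow> f 0 = 0"
  unfolding lin_iff by (metis add_cancel_right_right)

lemma lin_compose: "lin s t f \<Longrightarrow> lin r s g \<Longrightarrow> lin r t (\<lambda>x. f (g x))"
  by (simp add: lin_iff)

lemma bilin_compose:
  assumes "bilin r s t f"
  shows "lin p r g \<Longrightarrow> lin p t (\<lambda>x. f (g x) y)" and "lin p s h \<Longrightarrow> lin p t (\<lambda>x. f z (h x))"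
proof -
  have 1: "lin r t (\<lambda>x. f x y)" and 2: "lin s t (f z)" using assms unfolding bilin_def by blast+
  show "lin p r g \<Longrightarrow> lin p t (\<lambda>x. f (g x) y)" by (rule lin_compose[OF 1])
  show "lin p s h \<Longrightarrow> lin p t (\<lambda>x. f z (h x))" by (rule lin_compose[OF 2])
qed

lemma trilin_compose:
  assumes "trilin r s q t f"
  shows "lin p r g \<Longrightarrow> lin p t (\<lambda>x. f (g x) y z)"
    and "lin p s h \<Longrightarrow> lin p t (\<lambda>x. f u (h x) z)"
    and "lin p q i \<Longrightarrow> lin p t (\<lambda>x. f u y (i x))"
proof -
  have 1: "lin r t (\<lambda>x. f x y z)" and 2: "lin s t (\<lambda>y. f u y z)" and 3: "lin q t (f u y)"
    using assms unfolding trilin_def by blast+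
  show "lin p r g \<Longrightarrow> lin p t (\<lambda>x. f (g x) y z)" by (rule lin_compose[OF 1])
  show "lin p s h \<Longrightarrow> lin p t (\<lambda>x. f u (h x) z)" by (rule lin_compose[OF 2])
  show "lin p q i \<Longrightarrow> lin p t (\<lambda>x. f u y (i x))" by (rule lin_compose[OF 3])
qed

lemma vector_space_field: "vector_space ((*) :: 'k::field \<Rightarrow> 'k \<Rightarrow> 'k)"
  by (simp add: vector_space_def algebra_simps)

lemma lin_id: "vector_space s \<Longrightarrow> lin s s (\<lambda>x. x)"
  by (simp add: lin_iff)

lemma lin_scale: "lin s t f \<Longrightarrow> lin s t (\<lambda>x. t c (f x))"
  by (auto simp: lin_iff vector_space.vector_space_assms mult.commute)

lemma lin_scale_left: "vector_space t \<Longrightarrow> lin s (*) f \<Longrightarrow> lin s t (\<lambda>x. t (f x) v)"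
  by (simp add: lin_iff vector_space.vector_space_assms)

lemma lin_mult_right [multilinear]: "lin s (*) f \<Longrightarrow> lin s (*) (\<lambda>x. c * f x)"
  by (rule lin_scale)

lemma lin_mult_left [multilinear]: "lin s (*) f \<Longrightarrow> lin s (*) (\<lambda>x. f x * c)"
  by (rule lin_scale_left[OF vector_space_field])

lemma lin_pointwise_scale [multilinear]:
  "lin s pointwise_scale f \<Longrightarrow> lin s pointwise_scale (\<lambda>x. pointwise_scale c (f x))"
  "lin s (*) g \<Longrightarrow> lin s pointwise_scale (\<lambda>x. pointwise_scale (g x) v)"
  by (rule lin_scale, assumption) (rule lin_scale_left[OF vector_space_pointwise_scale])

text \<open>
  Every sum in Sweedler notation is a sum over a list of pairs that represents a tensor. Linear maps
  and other such sums commute with it for arbitrary summands; only passing from one representing list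
  to another one needs a multilinear summand.
\<close>

definition lsum :: "('a \<times> 'b) list \<Rightarrow> ('a \<Rightarrow> 'b \<Rightarrow> 'c::monoid_add) \<Rightarrow> 'c" where
  "lsum r f = (\<Sum>(v, w)\<leftarrow>r. f v w)"

lemma lsum_simps [simp]: "lsum [] f = 0" "lsum (p # r) f = f (fst p) (snd p) + lsum r f"
  by (simp_all add: lsum_def case_prod_beta)

lemma lsum_cong:
  "r = s \<Longrightarrow> (\<And>a b. (a, b) \<in> set s \<Longrightarrow> f a b = g a b) \<Longrightarrow> lsum r f = lsum s g"
  unfolding lsum_def by (intro arg_cong[where f = sum_list] map_cong) auto

lemma lsum_swap:
  fixes f :: "_ \<Rightarrow> _ \<Rightarrow> _ \<Rightarrow> _ \<Rightarrow> 'c::comm_monoid_add"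
  shows "lsum r (\<lambda>a b. lsum s (\<lambda>c d. f a b c d)) = lsum s (\<lambda>c d. lsum r (\<lambda>a b. f a b c d))"
proof (induction r)
  case Nil
  then show ?case by (induction s) auto
next
  case (Cons p r)
  have "lsum s (\<lambda>c d. g c d + h c d) = lsum s g + lsum s h" for g h :: "_ \<Rightarrow> _ \<Rightarrow> 'c"
    by (induction s) (auto simp: algebra_simps)
  then show ?case using Cons by simp
qed

lemma lin_lsum_push: "lin s t F \<Longrightarrow> F (lsum r f) = lsum r (\<lambda>a b. F (f a b))"
  by (induction r) (auto simp: lin_zero lin_iff)

lemma lin_lsum [multilinear]:
  assumes "\<And>a b. lin s t (\<lambda>x. f x a b)"
  shows "lin s t (\<lambda>x. lsum r (\<lambda>a b. f x a b))"
proof -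
  have st: "vector_space s" "vector_space t" using assms by (auto simp: lin_iff)
  interpret T: vector_space t by fact
  show ?thesis
    using assms st by (induction r) (auto simp: lin_iff T.scale_right_distrib algebra_simps)
qed

lemma scale_lsum: "vector_space t \<Longrightarrow> t c (lsum r f) = lsum r (\<lambda>a b. t c (f a b))"
  by (rule lin_lsum_push[OF lin_scale[OF lin_id]])

lemma lsum_scale_left: "vector_space t \<Longrightarrow> lsum r (\<lambda>a b. t (g a b) v) = t (lsum r g) v"
  by (rule lin_lsum_push[OF lin_scale_left[OF _ lin_id[OF vector_space_field]], symmetric])

lemma lsum_in:
  assumes "vspace V" "\<And>a b. (a, b) \<in> set r \<Longrightarrow> f a b \<in> carrier V"
  shows "lsum r f \<in> carrier V"
  unfolding lsum_def using assms by (intro sum_list_in_carrier) auto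

text \<open>
  Composing a structure map with a linear projection onto the carrier makes it multilinear on the
  whole ambient space. The identities below are therefore stated for all elements of the ambient
  spaces, and the side conditions left over are about linearity only.
\<close>

definition proj :: "('k::field, 'a::ab_group_add, 'm) vspace_scheme \<Rightarrow> 'a \<Rightarrow> 'a" where
  "proj V = (SOME p. lin (scale V) (scale V) p \<and> range p \<subseteq> carrier V \<and> (\<forall>x\<in>carrier V. p x = x))"

context vspace
begin

lemma proj_props:
  "lin (scale V) (scale V) (proj V) \<and> range (proj V) \<subseteq> carrier V \<and> (\<forall>x\<in>carrier V. proj V x = x)"
proof -
  interpret vector_space_pair "scale V" "scale V"
    using vector_space by (simp add: vector_space_pair_def)
  have "\<exists>p. lin (scale V) (scale V) p \<and> range p \<subseteq> carrier V \<and> (\<forall>x\<in>carrier V. p x = x)"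
    using linear_exists_left_inverse_on[OF vs1.linear_ident subspace] by auto
  then show ?thesis unfolding proj_def by (rule someI_ex)
qed

lemma proj_in [simp]: "proj V x \<in> carrier V"
  and proj_id: "x \<in> carrier V \<Longrightarrow> proj V x = x"
  and proj_proj [simp]: "proj V (proj V x) = proj V x"
  using proj_props by blast+

lemma lin_linear_on:
  "linear_on V W f \<Longrightarrow> vector_space (scale W) \<Longrightarrow> lin (scale V) (scale W) (\<lambda>x. f (proj V x))"
  using proj_props proj_in vector_space by (simp add: linear_on_def lin_iff)

end

text \<open>
  The list of pure tensors over which \<open>tensor_sum\<close> is evaluated.
\<close>

definition rep ::
  "('k::field, 'a::plus, 'm) vspace_scheme \<Rightarrow> ('k, 'b::plus, 'n) vspace_scheme \<Rightarrow>
   (('a \<Rightarrow> 'b \<Rightarrow> 'k) \<Rightarrow> 'k) \<Rightarrow> ('a \<times> 'b) list" where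
  "rep V W t = (SOME r. set r \<subseteq> carrier V \<times> carrier W \<and> (\<Sum>(v, w)\<leftarrow>r. tensor V W v w) = t)"

lemma tensor_sum_lsum: "tensor_sum V W t f = lsum (rep V W t) f"
  by (simp add: tensor_sum_def rep_def lsum_def Let_def)

definition full_space :: "('k \<Rightarrow> 'a \<Rightarrow> 'a) \<Rightarrow> ('k, 'a) vspace" where
  "full_space s = \<lparr>carrier = UNIV, scale = s\<rparr>"

lemma vspace_full_space: "vector_space s \<Longrightarrow> vspace (full_space s)"
  by (simp add: vspace_def full_space_def vector_space_def module.subspace_def module_def)

lemma bilin_imp_bilinear_on: "bilin (scale V) (scale W) s f \<Longrightarrow> bilinear_on V W (full_space s) f"
  by (simp add: bilin_def bilinear_on_def linear_on_def lin_iff full_space_def)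

lemma bilin_vector_space: "bilin r s t f \<Longrightarrow> vector_space t"
  by (auto simp: bilin_def lin_iff)

locale vspace2 = V: vspace V + W: vspace W
  for V :: "('k::field, 'a::ab_group_add, 'm) vspace_scheme"
    and W :: "('k, 'b::ab_group_add, 'n) vspace_scheme"
begin

lemma rep_props:
  assumes "t \<in> carrier (tensor_space V W)"
  shows "set (rep V W t) \<subseteq> carrier V \<times> carrier W" "lsum (rep V W t) (tensor V W) = t"
proof -
  have "\<exists>r. set r \<subseteq> carrier V \<times> carrier W \<and> (\<Sum>(v, w)\<leftarrow>r. tensor V W v w) = t"
    using tensor_space_representation[OF V.vspace_axioms W.vspace_axioms assms] by blast
  from someI_ex[OF this] show
    "set (rep V W t) \<subseteq> carrier V \<times> carrier W" "lsum (rep V W t) (tensor V W) = t"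
    by (auto simp: rep_def lsum_def)
qed

lemma lsum_rep_linear_on:
  assumes "vspace U" "bilinear_on V W U f"
  shows "linear_on (tensor_space V W) U (\<lambda>t. lsum (rep V W t) f)"
  using tensor_universal_property(1)[OF V.vspace_axioms W.vspace_axioms assms]
  by (simp add: tensor_sum_lsum)

lemma lsum_rep_tensor:
  assumes "bilin (scale V) (scale W) s f" "v \<in> carrier V" "w \<in> carrier W"
  shows "lsum (rep V W (tensor V W v w)) f = f v w"
  using tensor_universal_property(2)[OF V.vspace_axioms W.vspace_axioms
      vspace_full_space[OF bilin_vector_space[OF assms(1)]] bilin_imp_bilinear_on[OF assms(1)] assms(2,3)]
  by (simp add: tensor_sum_lsum)

lemma lin_rep:
  assumes f: "bilin (scale V) (scale W) s f" and G: "lin r pointwise_scale G"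
    and mem: "\<And>x. G x \<in> carrier (tensor_space V W)"
  shows "lin r s (\<lambda>x. lsum (rep V W (G x)) f)"
proof -
  note vs = bilin_vector_space[OF f]
  have l: "linear_on (tensor_space V W) (full_space s) (\<lambda>t. lsum (rep V W t) f)"
    by (rule lsum_rep_linear_on[OF vspace_full_space[OF vs] bilin_imp_bilinear_on[OF f]])
  then show ?thesis
    using G mem vs by (simp add: lin_iff linear_on_def tensor_space_def full_space_def)
qed

text \<open>
  The linear map on \<open>V \<otimes> W\<close> induced by a bilinear map, again defined on the whole ambient space.
\<close>

definition extend where "extend f t = lsum (rep V W (proj (tensor_space V W) t)) f"

lemma lin_extend:
  assumes "bilin (scale V) (scale W) s f"
  shows "lin pointwise_scale s (extend f)"
  unfolding extend_def
proof (rule lin_rep[OF assms])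
  interpret T: vspace "tensor_space V W" by (rule vspace_tensor_space)
  show "lin pointwise_scale pointwise_scale (proj (tensor_space V W))"
    using T.proj_props by (simp add: tensor_space_def)
  show "\<And>x. proj (tensor_space V W) x \<in> carrier (tensor_space V W)" by simp
qed

lemma extend_tensor:
  assumes "bilin (scale V) (scale W) s f" "v \<in> carrier V" "w \<in> carrier W"
  shows "extend f (tensor V W v w) = f v w"
proof -
  interpret T: vspace "tensor_space V W" by (rule vspace_tensor_space)
  have "tensor V W v w \<in> carrier (tensor_space V W)"
    using bilinear_on_tensor[OF V.vspace_axioms W.vspace_axioms] assms(2,3)
    by (simp add: bilinear_on_def linear_on_def)
  then show ?thesis by (simp add: extend_def T.proj_id lsum_rep_tensor[OF assms])
qed

end

text \<open>
  Applying this map to an equation between threefold tensors gives the equation between the sums of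
  any trilinear summand, which is the form in which the axioms enter the calculations.
\<close>

lemma trilin_extend:
  assumes UVW: "vspace U" "vspace V" "vspace W"
    and f: "trilin (scale U) (scale V) (scale W) s f"
  obtains T where "lin pointwise_scale s T"
    "\<And>u v w. u \<in> carrier U \<Longrightarrow> v \<in> carrier V \<Longrightarrow> w \<in> carrier W \<Longrightarrow> T (tensor3 U V W u v w) = f u v w"
proof -
  interpret VW: vspace2 V W using UVW by (simp add: vspace2_def)
  have T: "vspace (tensor_space V W)" by (rule vspace_tensor_space)
  interpret U: vspace2 U "tensor_space V W" using UVW T by (simp add: vspace2_def)
  have fu: "bilin (scale V) (scale W) s (f u)" for u
    using f by (simp add: bilin_def trilin_def)
  have vs: "vector_space s" by (rule bilin_vector_space[OF fu])
  have b: "bilin (scale U) (scale (tensor_space V W)) s (\<lambda>u. VW.extend (f u))"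
  proof (rule bilinI)
    show "lin (scale U) s (\<lambda>u. VW.extend (f u) t)" for t
      unfolding VW.extend_def using f by (intro lin_lsum) (simp add: trilin_def)
    show "lin (scale (tensor_space V W)) s (VW.extend (f u))" for u
      using VW.lin_extend[OF fu] by (simp add: tensor_space_def)
  qed
  show ?thesis
  proof (rule that[of "U.extend (\<lambda>u. VW.extend (f u))"])
    show "lin pointwise_scale s (U.extend (\<lambda>u. VW.extend (f u)))" by (rule U.lin_extend[OF b])
    fix u v w assume m: "u \<in> carrier U" "v \<in> carrier V" "w \<in> carrier W"
    have "tensor V W v w \<in> carrier (tensor_space V W)"
      using bilinear_on_tensor[OF UVW(2,3)] m by (simp add: bilinear_on_def linear_on_def)
    then show "U.extend (\<lambda>u. VW.extend (f u)) (tensor3 U V W u v w) = f u v w"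
      unfolding tensor3_def using m
      by (simp add: U.extend_tensor[OF b] VW.extend_tensor[OF fu])
  qed
qed

section \<open>Calculus in a Hopf algebra\<close>

context vspace
begin

lemma lin_scale_scale [multilinear]:
  "lin s (scale V) f \<Longrightarrow> lin s (scale V) (\<lambda>x. scale V c (f x))"
  "lin s (*) g \<Longrightarrow> lin s (scale V) (\<lambda>x. scale V (g x) v)"
  by (rule lin_scale, assumption) (rule lin_scale_left[OF vector_space])

lemma lin_ident [multilinear]: "lin (scale V) (scale V) (\<lambda>x. x)"
  by (rule lin_id[OF vector_space])

end

context algebra
begin

definition mul (infixl "\<bullet>" 70) where "x \<bullet> y = proj A x \<cdot> proj A y"

lemma mul_in [simp]: "x \<bullet> y \<in> carrier A"
  using mult_bilinear by (simp add: mul_def bilinear_on_def linear_on_def)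

lemma one_in [simp]: "\<one> \<in> carrier A"
  by (rule one_closed)

lemma mul_eq: "x \<in> carrier A \<Longrightarrow> y \<in> carrier A \<Longrightarrow> x \<cdot> y = x \<bullet> y"
  by (simp add: mul_def proj_id)

lemma mul_proj [simp]: "proj A x \<bullet> y = x \<bullet> y" "x \<bullet> proj A y = x \<bullet> y" "proj A (x \<bullet> y) = x \<bullet> y"
  by (simp_all add: proj_id) (simp_all add: mul_def)

lemma proj_one [simp]: "proj A \<one> = \<one>"
  by (simp add: proj_id)

lemma mul_assoc: "x \<bullet> y \<bullet> z = x \<bullet> (y \<bullet> z)"
proof -
  have "x \<bullet> y \<bullet> z = (x \<bullet> y) \<cdot> proj A z" by (simp add: mul_def[of "x \<bullet> y"] proj_id)
  also have "\<dots> = proj A x \<cdot> (proj A y \<cdot> proj A z)" unfolding mul_def by (rule mult_assoc) auto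
  also have "\<dots> = x \<bullet> (y \<bullet> z)" by (simp add: mul_def[of x "y \<bullet> z"] proj_id) (simp add: mul_def)
  finally show ?thesis .
qed

lemma mul_one [simp]: "x \<bullet> \<one> = proj A x" "\<one> \<bullet> x = proj A x"
  by (simp_all add: mul_def mult_one one_mult)

lemma lin_mul [multilinear]:
  assumes "lin s (scale A) f"
  shows "lin s (scale A) (\<lambda>x. f x \<bullet> y)" "lin s (scale A) (\<lambda>x. y \<bullet> f x)"
proof -
  have "lin (scale A) (scale A) (\<lambda>x. x \<bullet> y)" "lin (scale A) (scale A) (\<lambda>x. y \<bullet> x)"
    using mult_bilinear lin_linear_on[of A "\<lambda>x. x \<cdot> proj A y"]
      lin_linear_on[of A "\<lambda>x. proj A y \<cdot> x"]
    by (simp_all add: mul_def bilinear_on_def vector_space)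
  from this[THEN lin_compose, OF assms]
  show "lin s (scale A) (\<lambda>x. f x \<bullet> y)" "lin s (scale A) (\<lambda>x. y \<bullet> f x)" .
qed

lemma mul_scale: "scale A c x \<bullet> y = scale A c (x \<bullet> y)" "x \<bullet> scale A c y = scale A c (x \<bullet> y)"
  using lin_mul[OF lin_ident] by (simp_all add: lin_iff)

lemma lsum_mul: "lsum r f \<bullet> y = lsum r (\<lambda>a b. f a b \<bullet> y)" "y \<bullet> lsum r f = lsum r (\<lambda>a b. y \<bullet> f a b)"
  by (rule lin_lsum_push[OF lin_mul(1)[OF lin_ident]] lin_lsum_push[OF lin_mul(2)[OF lin_ident]])+

end

context coalgebra
begin

sublocale CC: vspace2 C C by unfold_locales

text \<open>
  \<open>cop c\<close> is a list that represents \<open>\<Delta>(c)\<close>, so \<open>lsum (cop c) (\<lambda>a b. f a b)\<close> is \<open>f(c\<^sub>1, c\<^sub>2)\<close> in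
  Sweedler notation.
\<close>

definition cop where "cop c = rep C C (comult C (proj C c))"

definition eps where "eps c = counit C (proj C c)"

lemma comult_in: "comult C (proj C c) \<in> carrier (tensor_space C C)"
  using comult_linear by (simp add: linear_on_def)

lemma cop_in:
  assumes "(a, b) \<in> set (cop c)"
  shows "a \<in> carrier C" "b \<in> carrier C"
  using CC.rep_props(1)[OF comult_in, of c] assms by (auto simp: cop_def)

lemma proj_cop:
  assumes "(a, b) \<in> set (cop c)"
  shows "proj C a = a" "proj C b = b"
  using cop_in[OF assms] by (simp_all add: proj_id)

lemma sweedler_cop: "c \<in> carrier C \<Longrightarrow> sweedler C c f = lsum (cop c) f"
  by (simp add: sweedler_def tensor_sum_lsum cop_def proj_id)

lemma cop_proj [simp]: "cop (proj C c) = cop c"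
  by (simp add: cop_def)

lemma eps_proj [simp]: "eps (proj C c) = eps c"
  by (simp add: eps_def)

lemma counit_eps: "c \<in> carrier C \<Longrightarrow> counit C c = eps c"
  by (simp add: eps_def proj_id)

lemma lin_eps [multilinear]: "lin s (scale C) f \<Longrightarrow> lin s (*) (\<lambda>x. eps (f x))"
  using lin_compose[OF lin_linear_on[OF counit_linear]] vector_space_field
  by (simp add: eps_def base_field_def)

lemma lin_comult: "lin (scale C) pointwise_scale (\<lambda>c. comult C (proj C c))"
  using lin_linear_on[OF comult_linear] vector_space_pointwise_scale
  by (simp add: tensor_space_def)

lemma lin_cop [multilinear]:
  assumes "bilin (scale C) (scale C) t f" "lin s (scale C) g"
  shows "lin s t (\<lambda>x. lsum (cop (g x)) f)"
  using lin_compose[OF CC.lin_rep[OF assms(1) lin_comult comult_in] assms(2)]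
  by (simp add: cop_def)

lemma lsum_cop_extend:
  assumes "bilin (scale C) (scale C) t f"
  shows "lsum (cop c) f = CC.extend f (comult C (proj C c))"
  using comult_in by (simp add: CC.extend_def cop_def vspace.proj_id[OF vspace_tensor_space])

lemma cop_coassoc:
  assumes "trilin (scale C) (scale C) (scale C) t f"
  shows "lsum (cop c) (\<lambda>a b. lsum (cop a) (\<lambda>a1 a2. f a1 a2 b)) =
    lsum (cop c) (\<lambda>a b. lsum (cop b) (\<lambda>b1 b2. f a b1 b2))"
proof -
  note V = vspace_axioms
  obtain T where T: "lin pointwise_scale t T"
    "\<And>u v w. u \<in> carrier C \<Longrightarrow> v \<in> carrier C \<Longrightarrow> w \<in> carrier C \<Longrightarrow> T (tensor3 C C C u v w) = f u v w"
    using trilin_extend[OF V V V assms] by blast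
  have "sweedler C (proj C c) (\<lambda>a b. sweedler C a (\<lambda>a1 a2. tensor3 C C C a1 a2 b)) =
    lsum (cop c) (\<lambda>a b. lsum (cop a) (\<lambda>a1 a2. tensor3 C C C a1 a2 b))"
    by (simp add: sweedler_cop cop_in cong: lsum_cong)
  moreover have "sweedler C (proj C c) (\<lambda>a b. sweedler C b (\<lambda>b1 b2. tensor3 C C C a b1 b2)) =
    lsum (cop c) (\<lambda>a b. lsum (cop b) (\<lambda>b1 b2. tensor3 C C C a b1 b2))"
    by (simp add: sweedler_cop cop_in cong: lsum_cong)
  ultimately have "T (lsum (cop c) (\<lambda>a b. lsum (cop a) (\<lambda>a1 a2. tensor3 C C C a1 a2 b))) =
    T (lsum (cop c) (\<lambda>a b. lsum (cop b) (\<lambda>b1 b2. tensor3 C C C a b1 b2)))"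
    using coassoc[OF proj_in] by simp
  then show ?thesis
    by (simp add: lin_lsum_push[OF T(1)] T(2) cop_in cong: lsum_cong)
qed

lemma cop_counit:
  assumes "lin (scale C) t f"
  shows "lsum (cop c) (\<lambda>a b. t (eps a) (f b)) = f (proj C c)"
    and "lsum (cop c) (\<lambda>a b. t (eps b) (f a)) = f (proj C c)"
proof -
  have sc: "f (scale C k x) = t k (f x)" for k x using assms by (simp add: lin_iff)
  have "f (lsum (cop c) (\<lambda>a b. scale C (counit C a) b)) = f (proj C c)"
    using counit_left[of "proj C c"] by (simp add: sweedler_cop)
  then show "lsum (cop c) (\<lambda>a b. t (eps a) (f b)) = f (proj C c)"
    by (simp add: lin_lsum_push[OF assms] sc counit_eps cop_in cong: lsum_cong)
  have "f (lsum (cop c) (\<lambda>a b. scale C (counit C b) a)) = f (proj C c)"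
    using counit_right[of "proj C c"] by (simp add: sweedler_cop)
  then show "lsum (cop c) (\<lambda>a b. t (eps b) (f a)) = f (proj C c)"
    by (simp add: lin_lsum_push[OF assms] sc counit_eps cop_in cong: lsum_cong)
qed

end

context bialgebra
begin

notation mul (infixl "\<bullet>" 70)

lemma cop_mul:
  assumes f: "bilin (scale B) (scale B) t f"
  shows "lsum (cop (x \<bullet> y)) f =
    lsum (cop x) (\<lambda>x1 x2. lsum (cop y) (\<lambda>y1 y2. f (x1 \<bullet> y1) (x2 \<bullet> y2)))"
proof -
  have "comult B (proj B (x \<bullet> y)) =
    lsum (cop x) (\<lambda>x1 x2. lsum (cop y) (\<lambda>y1 y2. tensor B B (x1 \<bullet> y1) (x2 \<bullet> y2)))"
    unfolding mul_proj using comult_mult[of "proj B x" "proj B y"]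
    by (simp add: sweedler_cop mul_eq cop_in cong: lsum_cong)
  then show ?thesis
    unfolding lsum_cop_extend[OF f]
    by (simp add: lin_lsum_push[OF CC.lin_extend[OF f]] CC.extend_tensor[OF f])
qed

lemma cop_one:
  assumes f: "bilin (scale B) (scale B) t f"
  shows "lsum (cop \<one>) f = f \<one> \<one>"
  unfolding lsum_cop_extend[OF f] by (simp add: comult_one CC.extend_tensor[OF f])

lemma eps_mul [simp]: "eps (x \<bullet> y) = eps x * eps y"
  using counit_mult[of "proj B x" "proj B y"] by (simp add: eps_def) (simp add: mul_def)

lemma eps_one [simp]: "eps \<one> = 1"
  by (simp add: eps_def counit_one)

end

context hopf_algebra
begin

notation mul (infixl "\<bullet>" 70)

definition ant where "ant x = S (proj B x)"

lemma ant_in [simp]: "ant x \<in> carrier B"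
  using antipode_linear by (simp add: ant_def linear_on_def)

lemma ant_proj [simp]: "ant (proj B x) = ant x" "proj B (ant x) = ant x"
  by (simp_all add: proj_id) (simp add: ant_def)

lemma ant_eq: "x \<in> carrier B \<Longrightarrow> S x = ant x"
  by (simp add: ant_def proj_id)

lemma lin_ant [multilinear]: "lin s (scale B) f \<Longrightarrow> lin s (scale B) (\<lambda>x. ant (f x))"
  using lin_compose[OF lin_linear_on[OF antipode_linear]] vector_space by (simp add: ant_def)

lemma cop_ant:
  assumes f: "lin (scale B) t f"
  shows "lsum (cop x) (\<lambda>a b. f (ant a \<bullet> b)) = t (eps x) (f \<one>)"
    and "lsum (cop x) (\<lambda>a b. f (a \<bullet> ant b)) = t (eps x) (f \<one>)"
proof -
  have sc: "f (scale B k x) = t k (f x)" for k x using f by (simp add: lin_iff)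
  have "f (lsum (cop x) (\<lambda>a b. S a \<cdot> b)) = f (counit B (proj B x) \<odot> \<one>)"
    using antipode_left[of "proj B x"] by (simp add: sweedler_cop)
  then show "lsum (cop x) (\<lambda>a b. f (ant a \<bullet> b)) = t (eps x) (f \<one>)"
    by (simp add: sc lin_lsum_push[OF f] ant_eq mul_eq cop_in counit_eps cong: lsum_cong)
  have "f (lsum (cop x) (\<lambda>a b. a \<cdot> S b)) = f (counit B (proj B x) \<odot> \<one>)"
    using antipode_right[of "proj B x"] by (simp add: sweedler_cop)
  then show "lsum (cop x) (\<lambda>a b. f (a \<bullet> ant b)) = t (eps x) (f \<one>)"
    by (simp add: sc lin_lsum_push[OF f] ant_eq mul_eq cop_in counit_eps cong: lsum_cong)
qed

lemma ant_one [simp]: "ant \<one> = \<one>"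
proof -
  have "ant \<one> \<bullet> \<one> = lsum (cop \<one>) (\<lambda>a b. ant a \<bullet> b)"
    by (rule cop_one[where t = "scale B", symmetric]) (intro multilinear)
  also have "\<dots> = \<one>"
    by (subst cop_ant(1)[where t = "scale B"])
      (simp_all add: lin_ident vector_space.vector_space_assms(4)[OF vector_space])
  finally show ?thesis by simp
qed

lemma eps_ant [simp]: "eps (ant x) = eps x"
proof -
  have "eps x = lsum (cop x) (\<lambda>a b. eps b * eps (ant a))"
    using cop_ant(1)[OF lin_eps[OF lin_ident], of x] by (simp add: mult.commute)
  also have "\<dots> = eps (ant x)"
    by (subst cop_counit(2)[where t = "(*)"]) (intro multilinear | simp)+
  finally show ?thesis by simp
qed

lemma cop_ant_mul:
  "lsum (cop x) (\<lambda>a b. u \<bullet> (a \<bullet> (ant b \<bullet> v))) = eps x \<odot> (u \<bullet> v)"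
  using cop_ant(2)[of "scale B" "\<lambda>z. u \<bullet> (z \<bullet> v)" x] by (simp add: mul_assoc multilinear)

text \<open>
  On \<open>B \<otimes> B\<close> both sides are convolution inverses of the multiplication:
  \<open>S(y) S(x) = S(x\<^sub>1 y\<^sub>1) x\<^sub>2 y\<^sub>2 S(y\<^sub>3) S(x\<^sub>3) = S(x y)\<close>.
\<close>

lemma ant_mul: "ant (x \<bullet> y) = ant y \<bullet> ant x"
proof -
  have "ant y \<bullet> ant x = lsum (cop x) (\<lambda>x1 x2. eps x1 \<odot> (ant y \<bullet> ant x2))"
    by (subst cop_counit(1)[where t = "scale B"]) (intro multilinear | simp)+
  also have "\<dots> = lsum (cop x) (\<lambda>x1 x2. eps x1 \<odot> lsum (cop y) (\<lambda>y1 y2. eps y1 \<odot> (ant y2 \<bullet> ant x2)))"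
    by (subst cop_counit(1)[where t = "scale B"]) (intro multilinear | simp)+
  also have "\<dots> = lsum (cop x) (\<lambda>x1 x2. lsum (cop y) (\<lambda>y1 y2.
      eps (x1 \<bullet> y1) \<odot> (\<one> \<bullet> (ant y2 \<bullet> ant x2))))"
    using vector_space by (simp add: scale_lsum[OF vector_space] vector_space.vector_space_assms)
  also have "\<dots> = lsum (cop x) (\<lambda>x1 x2. lsum (cop y) (\<lambda>y1 y2.
      lsum (cop (x1 \<bullet> y1)) (\<lambda>a b. ant a \<bullet> b \<bullet> (ant y2 \<bullet> ant x2))))"
    by (subst cop_ant(1)[where t = "scale B"]) (intro multilinear | simp)+
  also have "\<dots> = lsum (cop x) (\<lambda>x1 x2. lsum (cop y) (\<lambda>y1 y2.
      lsum (cop x1) (\<lambda>p q. lsum (cop y1) (\<lambda>u v.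
        ant (p \<bullet> u) \<bullet> (q \<bullet> v) \<bullet> (ant y2 \<bullet> ant x2)))))"
    by (subst cop_mul[where t = "scale B"]) (intro multilinear | simp)+
  also have "\<dots> = lsum (cop x) (\<lambda>x1 x2. lsum (cop x1) (\<lambda>p q. lsum (cop y) (\<lambda>y1 y2.
      lsum (cop y1) (\<lambda>u v. ant (p \<bullet> u) \<bullet> q \<bullet> (v \<bullet> (ant y2 \<bullet> ant x2))))))"
    by (subst lsum_swap) (simp add: mul_assoc)
  also have "\<dots> = lsum (cop x) (\<lambda>x1 x2. lsum (cop x1) (\<lambda>p q. lsum (cop y) (\<lambda>u y'.
      lsum (cop y') (\<lambda>v y2. ant (p \<bullet> u) \<bullet> q \<bullet> (v \<bullet> (ant y2 \<bullet> ant x2))))))"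
    by (subst cop_coassoc[where t = "scale B"]) (intro multilinear | simp)+
  also have "\<dots> = lsum (cop x) (\<lambda>x1 x2. lsum (cop x1) (\<lambda>p q. lsum (cop y) (\<lambda>u y'.
      eps y' \<odot> (ant (p \<bullet> u) \<bullet> q \<bullet> ant x2))))"
    by (simp add: cop_ant_mul)
  also have "\<dots> = lsum (cop x) (\<lambda>x1 x2. lsum (cop x1) (\<lambda>p q. ant (p \<bullet> y) \<bullet> (q \<bullet> (ant x2 \<bullet> \<one>))))"
    by (subst cop_counit(2)[where t = "scale B"]) (intro multilinear | simp add: mul_assoc)+
  also have "\<dots> = lsum (cop x) (\<lambda>p x'. lsum (cop x') (\<lambda>q x2. ant (p \<bullet> y) \<bullet> (q \<bullet> (ant x2 \<bullet> \<one>))))"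
    by (subst cop_coassoc[where t = "scale B"]) (intro multilinear | simp)+
  also have "\<dots> = lsum (cop x) (\<lambda>p x'. eps x' \<odot> ant (p \<bullet> y))"
    by (simp only: cop_ant_mul) simp
  also have "\<dots> = ant (x \<bullet> y)"
    by (subst cop_counit(2)[where t = "scale B"]) (intro multilinear | simp)+
  finally show ?thesis by simp
qed

text \<open>
  Both sides are convolution inverses of \<open>\<Delta>\<close>: the product \<open>\<Delta>(S(h\<^sub>1)) \<Delta>(h\<^sub>2) (S(h\<^sub>4) \<otimes> S(h\<^sub>3))\<close> reduces
  to \<open>S(h\<^sub>2) \<otimes> S(h\<^sub>1)\<close> from the left and to \<open>\<Delta>(S(h))\<close> from the right.
\<close>

lemma ant_cop:
  assumes f: "bilin (scale B) (scale B) t f"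
  shows "lsum (cop (ant h)) f = lsum (cop h) (\<lambda>a b. f (ant b) (ant a))"
proof -
  note ml = multilinear bilin_compose[OF f]
  have vs: "vector_space t" by (rule bilin_vector_space[OF f])
  \<comment> \<open>\<open>\<Delta>(g\<^sub>1) (S(g\<^sub>3) \<otimes> S(g\<^sub>2)) = \<epsilon>(g) 1 \<otimes> 1\<close>, multiplied from the left by \<open>s1 \<otimes> s2\<close>\<close>
  have cancel: "lsum (cop g) (\<lambda>q h'. lsum (cop h') (\<lambda>a b. lsum (cop q) (\<lambda>q1 q2.
      f (s1 \<bullet> (q1 \<bullet> ant b)) (s2 \<bullet> (q2 \<bullet> ant a))))) = t (eps g) (f (proj B s1) (proj B s2))"
    for g s1 s2
  proof -
    have "lsum (cop g) (\<lambda>q h'. lsum (cop h') (\<lambda>a b. lsum (cop q) (\<lambda>q1 q2.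
        f (s1 \<bullet> (q1 \<bullet> ant b)) (s2 \<bullet> (q2 \<bullet> ant a))))) =
      lsum (cop g) (\<lambda>q h'. lsum (cop q) (\<lambda>q1 q2. lsum (cop h') (\<lambda>a b.
        f (s1 \<bullet> (q1 \<bullet> ant b)) (s2 \<bullet> (q2 \<bullet> ant a)))))"
      by (subst lsum_swap) simp
    also have "\<dots> = lsum (cop g) (\<lambda>q1 g'. lsum (cop g') (\<lambda>q2 h'. lsum (cop h') (\<lambda>a b.
        f (s1 \<bullet> (q1 \<bullet> ant b)) (s2 \<bullet> (q2 \<bullet> ant a)))))"
      by (subst cop_coassoc[where t = "t"]) (intro ml | simp)+
    also have "\<dots> = lsum (cop g) (\<lambda>q1 g'. lsum (cop g') (\<lambda>r b. lsum (cop r) (\<lambda>q2 a.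
        f (s1 \<bullet> (q1 \<bullet> ant b)) (s2 \<bullet> (q2 \<bullet> ant a)))))"
      by (subst cop_coassoc[where t = "t", symmetric]) (intro ml | simp)+
    also have "\<dots> = lsum (cop g) (\<lambda>q1 g'. lsum (cop g') (\<lambda>r b.
        t (eps r) (f (s1 \<bullet> (q1 \<bullet> ant b)) (proj B s2))))"
      by (subst cop_ant(2)[where t = "t"]) (intro ml | simp)+
    also have "\<dots> = lsum (cop g) (\<lambda>q1 g'. f (s1 \<bullet> (q1 \<bullet> ant g')) (proj B s2))"
      by (subst cop_counit(1)[where t = "t"]) (intro ml | simp)+
    also have "\<dots> = t (eps g) (f (proj B s1) (proj B s2))"
      by (subst cop_ant(2)[where t = "t"]) (intro ml | simp)+
    finally show ?thesis .
  qed
  have "lsum (cop h) (\<lambda>a b. f (ant b) (ant a)) =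
    lsum (cop h) (\<lambda>k h'. t (eps k) (lsum (cop h') (\<lambda>a b. f (ant b) (ant a))))"
    by (subst cop_counit(1)[where t = "t"]) (intro ml | simp)+
  also have "\<dots> = lsum (cop h) (\<lambda>k h'. t (eps k) (lsum (cop \<one>) (\<lambda>z1 z2.
      lsum (cop h') (\<lambda>a b. f (z1 \<bullet> ant b) (z2 \<bullet> ant a)))))"
    by (subst cop_one[where t = "t"]) (intro ml | simp)+
  also have "\<dots> = lsum (cop h) (\<lambda>k h'. lsum (cop k) (\<lambda>p q. lsum (cop (ant p \<bullet> q)) (\<lambda>z1 z2.
      lsum (cop h') (\<lambda>a b. f (z1 \<bullet> ant b) (z2 \<bullet> ant a)))))"
    by (subst cop_ant(1)[where t = "t"]) (intro ml | simp)+
  also have "\<dots> = lsum (cop h) (\<lambda>k h'. lsum (cop k) (\<lambda>p q. lsum (cop (ant p)) (\<lambda>s1 s2.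
      lsum (cop q) (\<lambda>q1 q2. lsum (cop h') (\<lambda>a b.
        f (s1 \<bullet> (q1 \<bullet> ant b)) (s2 \<bullet> (q2 \<bullet> ant a)))))))"
    by (subst cop_mul[where t = "t"]) (intro ml | simp add: mul_assoc)+
  also have "\<dots> = lsum (cop h) (\<lambda>p g. lsum (cop g) (\<lambda>q h'. lsum (cop (ant p)) (\<lambda>s1 s2.
      lsum (cop q) (\<lambda>q1 q2. lsum (cop h') (\<lambda>a b.
        f (s1 \<bullet> (q1 \<bullet> ant b)) (s2 \<bullet> (q2 \<bullet> ant a)))))))"
    by (subst cop_coassoc[where t = "t"]) (intro ml | simp)+
  also have "\<dots> = lsum (cop h) (\<lambda>p g. lsum (cop (ant p)) (\<lambda>s1 s2. lsum (cop g) (\<lambda>q h'.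
      lsum (cop h') (\<lambda>a b. lsum (cop q) (\<lambda>q1 q2. 
        f (s1 \<bullet> (q1 \<bullet> ant b)) (s2 \<bullet> (q2 \<bullet> ant a)))))))"
    by (subst lsum_swap, subst (2) lsum_swap) simp
  also have "\<dots> = lsum (cop h) (\<lambda>p g. lsum (cop (ant p)) (\<lambda>s1 s2. t (eps g) (f s1 s2)))"
    by (simp add: cancel proj_cop cong: lsum_cong)
  also have "\<dots> = lsum (cop h) (\<lambda>p g. t (eps g) (lsum (cop (ant p)) f))"
    by (simp add: scale_lsum[OF vs])
  also have "\<dots> = lsum (cop (ant h)) f"
    by (subst cop_counit(2)[where t = "t"]) (intro ml f | simp)+
  finally show ?thesis by simp
qed

end

section \<open>Calculus in a partial matched pair\<close>

context partial_matched_pair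
begin

sublocale HL: vspace2 H L by unfold_locales

notation H.mul (infixl "\<bullet>" 70)
notation L.mul (infixl "\<star>" 70)

definition act' (infixr "\<rhd>" 80) where "h \<rhd> x = proj H h \<rightharpoonup> proj L x"

text \<open>
  \<open>ro h\<close> is a list that represents \<open>\<rho>(h) = h\<^sup>0 \<otimes> h\<^sup>1\<close>.
\<close>

definition ro where "ro h = rep H L (\<rho> (proj H h))"

lemma act_in [simp]: "h \<rhd> x \<in> carrier L"
  using act_bilinear by (simp add: act'_def bilinear_on_def linear_on_def)

lemma act_eq: "h \<in> carrier H \<Longrightarrow> x \<in> carrier L \<Longrightarrow> h \<rightharpoonup> x = h \<rhd> x"
  by (simp add: act'_def H.proj_id L.proj_id)

lemma act_proj [simp]:
  "proj H h \<rhd> x = h \<rhd> x" "h \<rhd> proj L x = h \<rhd> x" "proj L (h \<rhd> x) = h \<rhd> x"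
  by (simp_all add: L.proj_id) (simp_all add: act'_def)

lemma lin_act [multilinear]:
  shows "lin s (scale H) f \<Longrightarrow> lin s (scale L) (\<lambda>x. f x \<rhd> y)"
    and "lin s (scale L) g \<Longrightarrow> lin s (scale L) (\<lambda>x. h \<rhd> g x)"
proof -
  have 1: "lin (scale H) (scale L) (\<lambda>h. h \<rhd> y)" and 2: "lin (scale L) (scale L) (\<lambda>x. h \<rhd> x)"
    using act_bilinear H.lin_linear_on[of L "\<lambda>h. h \<rightharpoonup> proj L y"]
      L.lin_linear_on[of L "\<lambda>x. proj H h \<rightharpoonup> x"]
    by (simp_all add: act'_def bilinear_on_def L.vector_space)
  show "lin s (scale H) f \<Longrightarrow> lin s (scale L) (\<lambda>x. f x \<rhd> y)" by (rule lin_compose[OF 1])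
  show "lin s (scale L) g \<Longrightarrow> lin s (scale L) (\<lambda>x. h \<rhd> g x)" by (rule lin_compose[OF 2])
qed

lemma coact_in: "\<rho> (proj H h) \<in> carrier (tensor_space H L)"
  using coact_linear by (simp add: linear_on_def)

lemma ro_in:
  assumes "(p, r) \<in> set (ro h)"
  shows "p \<in> carrier H" "r \<in> carrier L"
  using HL.rep_props(1)[OF coact_in, of h] assms by (auto simp: ro_def)

lemma proj_ro:
  assumes "(p, r) \<in> set (ro h)"
  shows "proj H p = p" "proj L r = r"
  using ro_in[OF assms] by (simp_all add: H.proj_id L.proj_id)

lemma ro_proj [simp]: "ro (proj H h) = ro h"
  by (simp add: ro_def)

lemma tensor_sum_ro: "h \<in> carrier H \<Longrightarrow> tensor_sum H L (\<rho> h) f = lsum (ro h) f"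
  by (simp add: tensor_sum_lsum ro_def H.proj_id)

lemma lin_ro [multilinear]:
  assumes "bilin (scale H) (scale L) t f" "lin s (scale H) g"
  shows "lin s t (\<lambda>x. lsum (ro (g x)) f)"
proof -
  have "lin (scale H) pointwise_scale (\<lambda>h. \<rho> (proj H h))"
    using H.lin_linear_on[OF coact_linear] vector_space_pointwise_scale
    by (simp add: tensor_space_def)
  from lin_compose[OF HL.lin_rep[OF assms(1) this coact_in] assms(2)]
  show ?thesis by (simp add: ro_def)
qed

lemma lsum_ro_extend:
  assumes "bilin (scale H) (scale L) t f"
  shows "lsum (ro h) f = HL.extend f (\<rho> (proj H h))"
  using coact_in by (simp add: HL.extend_def ro_def vspace.proj_id[OF vspace_tensor_space])

lemmas to_total = H.sweedler_cop L.sweedler_cop tensor_sum_ro H.mul_eq L.mul_eq act_eq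
  H.cop_in L.cop_in ro_in H.ant_eq L.ant_eq H.counit_eps L.counit_eps

lemma one_act' [simp]: "\<one>\<^bsub>H\<^esub> \<rhd> x = proj L x"
  using one_act[of "proj L x"] by (simp add: act_eq)

lemma act_mul: "h \<rhd> (x \<star> y) = lsum (H.cop h) (\<lambda>a b. (a \<rhd> x) \<star> (b \<rhd> y))"
  using act_mult[of "proj H h" "proj L x" "proj L y"] by (simp add: to_total cong: lsum_cong)

lemma act_act': "h \<rhd> g \<rhd> x = lsum (H.cop h) (\<lambda>a b. (a \<rhd> \<one>\<^bsub>L\<^esub>) \<star> ((b \<bullet> g) \<rhd> x))"
  using act_act[of "proj H h" "proj H g" "proj L x"] by (simp add: to_total cong: lsum_cong)

lemma ro_counit:
  assumes f: "lin (scale H) t f"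
  shows "lsum (ro h) (\<lambda>p r. t (L.eps r) (f p)) = f (proj H h)"
proof -
  have sc: "f (scale H k x) = t k (f x)" for k x using f by (simp add: lin_iff)
  have "f (lsum (ro h) (\<lambda>p r. scale H (L.eps r) p)) = f (proj H h)"
    using coact_counit[of "proj H h"] by (simp add: to_total cong: lsum_cong)
  then show ?thesis by (simp add: lin_lsum_push[OF f] sc)
qed

lemma ro_cop:
  assumes f: "trilin (scale H) (scale H) (scale L) t f"
  shows "lsum (ro h) (\<lambda>p r. lsum (H.cop p) (\<lambda>u v. f u v r)) =
    lsum (H.cop h) (\<lambda>a b. lsum (ro a) (\<lambda>p r. lsum (ro b) (\<lambda>q s. f p q (r \<star> s))))"
proof -
  obtain T where T: "lin pointwise_scale t T"
    "\<And>u v w. u \<in> carrier H \<Longrightarrow> v \<in> carrier H \<Longrightarrow> w \<in> carrier L \<Longrightarrow> T (tensor3 H H L u v w) = f u v w"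
    using trilin_extend[OF H.vspace_axioms H.vspace_axioms L.vspace_axioms f] by blast
  have "T (lsum (ro h) (\<lambda>p r. lsum (H.cop p) (\<lambda>u v. tensor3 H H L u v r))) =
    T (lsum (H.cop h) (\<lambda>a b. lsum (ro a) (\<lambda>p r. lsum (ro b) (\<lambda>q s. tensor3 H H L p q (r \<star> s)))))"
    using coact_comult[of "proj H h"] by (simp add: to_total cong: lsum_cong)
  then show ?thesis
    by (simp add: lin_lsum_push[OF T(1)] T(2) to_total cong: lsum_cong)
qed

lemma ro_ro:
  assumes f: "trilin (scale H) (scale L) (scale L) t f"
  shows "lsum (ro h) (\<lambda>p r. lsum (ro p) (\<lambda>q s. f q s r)) =
    lsum (H.cop h) (\<lambda>a b. lsum (ro a) (\<lambda>p r. lsum (ro b) (\<lambda>q s. lsum (L.cop r) (\<lambda>u v.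
      t (H.eps q) (f p u (v \<star> s))))))"
proof -
  have sc: "f x y (scale L k z) = t k (f x y z)" for k x y z
    using f by (simp add: trilin_def lin_iff)
  obtain T where T: "lin pointwise_scale t T"
    "\<And>u v w. u \<in> carrier H \<Longrightarrow> v \<in> carrier L \<Longrightarrow> w \<in> carrier L \<Longrightarrow> T (tensor3 H L L u v w) = f u v w"
    using trilin_extend[OF H.vspace_axioms L.vspace_axioms L.vspace_axioms f] by blast
  have "T (lsum (ro h) (\<lambda>p r. lsum (ro p) (\<lambda>q s. tensor3 H L L q s r))) =
    T (lsum (H.cop h) (\<lambda>a b. lsum (ro a) (\<lambda>p r. lsum (ro b) (\<lambda>q s. lsum (L.cop r) (\<lambda>u v.
      tensor3 H L L p u (v \<star> scale L (H.eps q) s))))))"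
    using coact_coact[of "proj H h"]
    by (simp add: to_total L.carrier_closed cong: lsum_cong)
  then show ?thesis
    by (simp add: lin_lsum_push[OF T(1)] T(2) to_total L.carrier_closed L.mul_scale sc
        cong: lsum_cong)
qed

lemma compatibility_lsum:
  assumes f: "trilin (scale H) (scale L) (scale L) t f"
  shows "lsum (H.cop h) (\<lambda>h1 h2. lsum (ro (h2 \<bullet> g)) (\<lambda>k0 k1. lsum (L.cop (h1 \<rhd> x)) (\<lambda>u v.
      f k0 u (v \<star> k1)))) =
    lsum (H.cop h) (\<lambda>h1 s. lsum (H.cop s) (\<lambda>h2 s'. lsum (H.cop s') (\<lambda>h3 h4.
      lsum (L.cop x) (\<lambda>x1 x2. lsum (ro h1) (\<lambda>p r. lsum (ro h3) (\<lambda>p3 r3. lsum (ro g) (\<lambda>g0 g1.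
        f (p3 \<bullet> g0) (p \<rhd> x1) (r \<star> (h2 \<rhd> x2) \<star> r3 \<star> (h4 \<rhd> g1)))))))))"
proof -
  obtain T where T: "lin pointwise_scale t T"
    "\<And>u v w. u \<in> carrier H \<Longrightarrow> v \<in> carrier L \<Longrightarrow> w \<in> carrier L \<Longrightarrow> T (tensor3 H L L u v w) = f u v w"
    using trilin_extend[OF H.vspace_axioms L.vspace_axioms L.vspace_axioms f] by blast
  have "T (lsum (H.cop h) (\<lambda>h1 h2. lsum (ro (h2 \<bullet> g)) (\<lambda>k0 k1. lsum (L.cop (h1 \<rhd> x)) (\<lambda>u v.
      tensor3 H L L k0 u (v \<star> k1))))) =
    T (lsum (H.cop h) (\<lambda>h1 s. lsum (H.cop s) (\<lambda>h2 s'. lsum (H.cop s') (\<lambda>h3 h4.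
      lsum (L.cop x) (\<lambda>x1 x2. lsum (ro h1) (\<lambda>p r. lsum (ro h3) (\<lambda>p3 r3. lsum (ro g) (\<lambda>g0 g1.
        tensor3 H L L (p3 \<bullet> g0) (p \<rhd> x1) (r \<star> (h2 \<rhd> x2) \<star> r3 \<star> (h4 \<rhd> g1))))))))))"
    using compatibility[of "proj H h" "proj H g" "proj L x"]
    by (simp add: sweedler4_def sweedler3_def to_total cong: lsum_cong)
  then show ?thesis
    by (simp add: lin_lsum_push[OF T(1)] T(2) to_total cong: lsum_cong)
qed

text \<open>
  The functional \<open>\<lambda>(h) = \<epsilon>(h \<rightharpoonup> 1)\<close>; it is the counit of \<open>H\<close> if the action is global.
\<close>

definition lam where "lam h = L.eps (h \<rhd> \<one>\<^bsub>L\<^esub>)"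

lemma lin_lam [multilinear]: "lin s (scale H) f \<Longrightarrow> lin s (*) (\<lambda>x. lam (f x))"
  unfolding lam_def by (intro multilinear)

lemma lam_proj [simp]: "lam (proj H h) = lam h"
  by (simp add: lam_def)

lemma lam_one [simp]: "lam \<one>\<^bsub>H\<^esub> = 1"
  by (simp add: lam_def)

lemma eps_act: "L.eps (h \<rhd> x) = lam h * L.eps x"
  using counit_act[of "proj H h" "proj L x"] by (simp add: to_total lam_def)

text \<open>
  The element \<open>\<epsilon>(1\<^sup>0) 1\<^sup>1\<close>; it is the unit of \<open>L\<close> if the coaction is global.
\<close>

definition \<l> where "\<l> = lsum (ro \<one>\<^bsub>H\<^esub>) (\<lambda>u l. scale L (H.eps u) l)"

lemma \<l>_in [simp]: "\<l> \<in> carrier L"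
proof -
  have "lsum (ro \<one>\<^bsub>H\<^esub>) (\<lambda>u l. scale L (H.eps u) (proj L l)) \<in> carrier L"
    unfolding lsum_def
    by (rule sum_list_in_carrier[OF L.vspace_axioms]) (auto intro!: L.carrier_closed)
  then show ?thesis unfolding \<l>_def by (simp add: proj_ro cong: lsum_cong)
qed

lemma proj_\<l> [simp]: "proj L \<l> = \<l>"
  by (simp add: L.proj_id)

text \<open>
  The axiom \<open>\<rho>(1) = 1 \<otimes> \<epsilon>(1\<^sup>0) 1\<^sup>1\<close>.
\<close>

lemma ro_one:
  assumes "bilin (scale H) (scale L) t f"
  shows "lsum (ro \<one>\<^bsub>H\<^esub>) f = f \<one>\<^bsub>H\<^esub> \<l>"
proof -
  have "\<rho> \<one>\<^bsub>H\<^esub> = tensor H L \<one>\<^bsub>H\<^esub> \<l>"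
    by (subst coact_one) (simp add: \<l>_def to_total cong: lsum_cong)
  then show ?thesis
    unfolding lsum_ro_extend[OF assms] by (simp add: HL.extend_tensor[OF assms])
qed

lemma eps_\<l> [simp]: "L.eps \<l> = 1"
proof -
  have "L.eps \<l> * H.eps \<one>\<^bsub>H\<^esub> = lsum (ro \<one>\<^bsub>H\<^esub>) (\<lambda>p r. L.eps r * H.eps p)"
    by (subst ro_one[where t = "(*)"]) (intro multilinear | simp)+
  also have "\<dots> = 1"
    by (subst ro_counit[where t = "(*)"]) (intro multilinear | simp)+
  finally show ?thesis by simp
qed

end

context quasi_abelian_partial_matched_pair
begin

notation H.mul (infixl "\<bullet>" 70)
notation L.mul (infixl "\<star>" 70)
notation act' (infixr "\<rhd>" 80)

lemma quasi_abelian_lsum: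
  assumes f: "bilin (scale H) (scale L) t f"
  shows "lsum (H.cop h) (\<lambda>a b. lsum (ro b) (\<lambda>p r. f p ((a \<rhd> x) \<star> r))) =
    lsum (H.cop h) (\<lambda>a b. lsum (ro a) (\<lambda>p r. f p (r \<star> (b \<rhd> x))))"
proof -
  have "HL.extend f (lsum (H.cop h) (\<lambda>a b. lsum (ro b) (\<lambda>p r. tensor H L p ((a \<rhd> x) \<star> r)))) =
    HL.extend f (lsum (H.cop h) (\<lambda>a b. lsum (ro a) (\<lambda>p r. tensor H L p (r \<star> (b \<rhd> x)))))"
    using quasi_abelian[of "proj H h" "proj L x"] by (simp add: to_total cong: lsum_cong)
  then show ?thesis
    by (simp add: lin_lsum_push[OF HL.lin_extend[OF f]] HL.extend_tensor[OF f] ro_in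
      cong: lsum_cong)
qed

end

section \<open>Consequences of the antipode conditions\<close>

locale antipode_matched_pair = quasi_abelian_partial_matched_pair H SH L SL act \<rho>
  for H :: "('k::field, 'h::ab_group_add, 'm) bialg_scheme" and SH :: "'h \<Rightarrow> 'h"
    and L :: "('k, 'l::ab_group_add, 'n) bialg_scheme" and SL :: "'l \<Rightarrow> 'l"
    and act :: "'h \<Rightarrow> 'l \<Rightarrow> 'l" (infixr "\<rightharpoonup>" 80)
    and \<rho> :: "'h \<Rightarrow> ('h \<Rightarrow> 'l \<Rightarrow> 'k) \<Rightarrow> 'k" +
  assumes coact_antipode: "h \<in> carrier H \<Longrightarrow>
      tensor_sum H L (\<rho> h) (\<lambda>h0 h1. tensor L L (h0 \<rightharpoonup> \<one>\<^bsub>L\<^esub>) (SL h1)) =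
      tensor_sum H L (\<rho> \<one>\<^bsub>H\<^esub>) (\<lambda>u l.
        (counit H u * counit L (h \<rightharpoonup> \<one>\<^bsub>L\<^esub>)) \<odot>\<^bsub>tensor_space L L\<^esub> tensor L L \<one>\<^bsub>L\<^esub> l)"
    and antipode_act: "h \<in> carrier H \<Longrightarrow> g \<in> carrier H \<Longrightarrow>
      tensor_sum H L (\<rho> h) (\<lambda>h0 h1. counit H h0 \<odot>\<^bsub>L\<^esub> (SH g \<rightharpoonup> h1)) =
      tensor_sum H L (\<rho> \<one>\<^bsub>H\<^esub>) (\<lambda>u l.
        (counit L (g \<rightharpoonup> \<one>\<^bsub>L\<^esub>) * counit H h * counit H u) \<odot>\<^bsub>L\<^esub> l)"
begin

notation H.mul (infixl "\<bullet>" 70)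
notation L.mul (infixl "\<star>" 70)
notation act' (infixr "\<rhd>" 80)

lemma ro_act_ant:
  assumes f: "bilin (scale L) (scale L) t f"
  shows "lsum (ro h) (\<lambda>p r. f (p \<rhd> \<one>\<^bsub>L\<^esub>) (L.ant r)) = t (lam h) (f \<one>\<^bsub>L\<^esub> \<l>)"
proof -
  note ml = multilinear bilin_compose[OF f] and vs = bilin_vector_space[OF f]
  have "L.CC.extend f (lsum (ro h) (\<lambda>p r. tensor L L (p \<rhd> \<one>\<^bsub>L\<^esub>) (L.ant r))) =
    L.CC.extend f (lsum (ro \<one>\<^bsub>H\<^esub>) (\<lambda>u l. pointwise_scale (H.eps u * lam h) (tensor L L \<one>\<^bsub>L\<^esub> l)))"
    using coact_antipode[of "proj H h"]
    by (simp add: to_total lam_def tensor_space_def cong: lsum_cong)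
  moreover have "L.CC.extend f (pointwise_scale c x) = t c (L.CC.extend f x)" for c x
    using L.CC.lin_extend[OF f] by (simp add: lin_iff)
  ultimately have "lsum (ro h) (\<lambda>p r. f (p \<rhd> \<one>\<^bsub>L\<^esub>) (L.ant r)) =
      lsum (ro \<one>\<^bsub>H\<^esub>) (\<lambda>u l. t (H.eps u * lam h) (f \<one>\<^bsub>L\<^esub> l))"
    by (simp add: lin_lsum_push[OF L.CC.lin_extend[OF f]] L.CC.extend_tensor[OF f] ro_in
        cong: lsum_cong)
  also have "\<dots> = t (lam h) (f \<one>\<^bsub>L\<^esub> \<l>)"
    by (subst ro_one[where t = t])
      (intro ml lin_scale[where t = t] lin_scale_left[where t = t] vs | simp)+
  finally show ?thesis .
qed

text \<open>
  The counit on the second leg of the first antipode condition turns \<open>h\<^sup>0 \<otimes> S(h\<^sup>1)\<close> back into \<open>h\<close>. From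
  here on the partial action on the unit is multiplication by a scalar.
\<close>

lemma act_unit: "h \<rhd> \<one>\<^bsub>L\<^esub> = scale L (lam h) \<one>\<^bsub>L\<^esub>"
proof -
  have "h \<rhd> \<one>\<^bsub>L\<^esub> = lsum (ro h) (\<lambda>p r. scale L (L.eps r) (p \<rhd> \<one>\<^bsub>L\<^esub>))"
    by (subst ro_counit[where t = "scale L"]) (intro multilinear | simp)+
  also have "\<dots> = lsum (ro h) (\<lambda>p r. scale L (L.eps (L.ant r)) (p \<rhd> \<one>\<^bsub>L\<^esub>))"
    by simp
  also have "\<dots> = scale L (lam h) (scale L (L.eps \<l>) \<one>\<^bsub>L\<^esub>)"
    by (rule ro_act_ant[where t = "scale L"]) (intro multilinear)
  finally show ?thesis by (simp add: vector_space.vector_space_assms[OF L.vector_space])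
qed

text \<open>
  The counit on the first leg of the first antipode condition: \<open>\<lambda>(h\<^sup>0) S(h\<^sup>1) = \<lambda>(h) \<l>\<close>.
\<close>

lemma ro_ant:
  assumes f: "lin (scale L) t f"
  shows "lsum (ro h) (\<lambda>p r. t (lam p) (f (L.ant r))) = t (lam h) (f \<l>)"
proof -
  have vs: "vector_space t" using f by (simp add: lin_iff)
  have "lsum (ro h) (\<lambda>p r. t (L.eps (p \<rhd> \<one>\<^bsub>L\<^esub>)) (f (L.ant r))) = t (lam h) (t (L.eps \<one>\<^bsub>L\<^esub>) (f \<l>))"
    by (rule ro_act_ant[where t = t])
      (intro multilinear lin_scale[where t = t] lin_scale_left[where t = t] lin_compose[OF f] vs)
  then show ?thesis by (simp add: lam_def vector_space.vector_space_assms[OF vs])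
qed

lemma ant_\<l>: "L.ant \<l> = \<l>"
proof -
  have "scale L (lam \<one>\<^bsub>H\<^esub>) (L.ant \<l>) = lsum (ro \<one>\<^bsub>H\<^esub>) (\<lambda>p r. scale L (lam p) (L.ant r))"
    by (subst ro_one[where t = "scale L"]) (intro multilinear | simp)+
  also have "\<dots> = scale L (lam \<one>\<^bsub>H\<^esub>) \<l>"
    by (rule ro_ant[OF L.lin_ident])
  finally show ?thesis by (simp add: vector_space.vector_space_assms[OF L.vector_space])
qed

lemma ro_ant_act:
  "lsum (ro h) (\<lambda>p r. scale L (H.eps p) (H.ant g \<rhd> r)) = scale L (lam g * H.eps h) \<l>"
proof -
  have "lsum (ro h) (\<lambda>p r. scale L (H.eps p) (H.ant g \<rhd> r)) =
      lsum (ro \<one>\<^bsub>H\<^esub>) (\<lambda>u l. scale L (lam g * H.eps h * H.eps u) l)"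
    using antipode_act[of "proj H h" "proj H g"] by (simp add: to_total lam_def cong: lsum_cong)
  also have "\<dots> = scale L (lam g * H.eps h) \<l>"
    by (subst ro_one[where t = "scale L"]) (intro multilinear | simp)+
  finally show ?thesis .
qed

text \<open>
  The second antipode condition for \<open>g = 1\<close>: \<open>\<epsilon>(h\<^sup>0) h\<^sup>1 = \<epsilon>(h) \<l>\<close>.
\<close>

lemma ro_eps:
  assumes f: "lin (scale L) t f"
  shows "lsum (ro h) (\<lambda>p r. t (H.eps p) (f r)) = t (H.eps h) (f \<l>)"
proof -
  have sc: "f (scale L k x) = t k (f x)" for k x using f by (simp add: lin_iff)
  have "lsum (ro h) (\<lambda>p r. scale L (H.eps p) r) = scale L (H.eps h) \<l>"
    using ro_ant_act[of h "\<one>\<^bsub>H\<^esub>"] by (simp add: proj_ro cong: lsum_cong)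
  from arg_cong[where f = f, OF this] show ?thesis by (simp add: lin_lsum_push[OF f] sc)
qed

text \<open>
  The second antipode condition for \<open>h = 1\<close> says \<open>S(g) \<rightharpoonup> \<l> = \<lambda>(g) \<l>\<close>; the counit of \<open>L\<close> gives the claim.
\<close>

lemma lam_ant: "lam (H.ant g) = lam g"
proof -
  have "scale L (lam g) \<l> = lsum (ro \<one>\<^bsub>H\<^esub>) (\<lambda>p r. scale L (H.eps p) (H.ant g \<rhd> r))"
    by (simp add: ro_ant_act)
  also have "\<dots> = H.ant g \<rhd> \<l>"
    by (subst ro_one[where t = "scale L"])
      (intro multilinear | simp add: vector_space.vector_space_assms[OF L.vector_space])+
  finally have "L.eps (scale L (lam g) \<l>) = lam (H.ant g) * L.eps \<l>"
    by (simp add: eps_act)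
  then show ?thesis using L.lin_eps[OF L.lin_ident] by (simp add: lin_iff)
qed

text \<open>
  The counit on the second leg of \<open>(\<Delta> \<otimes> id) \<rho>(h)\<close> returns \<open>\<rho>(h)\<close>, whereas on the other side of the
  comodule coalgebra axiom it produces the factor \<open>\<epsilon>(h\<^sub>2\<^sup>0) h\<^sub>2\<^sup>1 = \<epsilon>(h\<^sub>2) \<l>\<close>.
\<close>

lemma ro_\<l>:
  assumes f: "bilin (scale H) (scale L) t f"
  shows "lsum (ro h) (\<lambda>p r. f p (r \<star> \<l>)) = lsum (ro h) f"
proof -
  have vs: "vector_space t" by (rule bilin_vector_space[OF f])
  note ml = multilinear bilin_compose[OF f] lin_scale[where t = t] lin_scale_left[where t = t, OF vs]
  have "lsum (ro h) f = lsum (ro h) (\<lambda>p r. lsum (H.cop p) (\<lambda>u v. t (H.eps v) (f u r)))"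
    by (subst H.cop_counit(2)[where t = t]) (intro ml | simp add: proj_ro cong: lsum_cong)+
  also have "\<dots> = lsum (H.cop h) (\<lambda>a b. lsum (ro a) (\<lambda>p r. lsum (ro b) (\<lambda>q s.
      t (H.eps q) (f p (r \<star> s)))))"
    by (rule ro_cop[where t = t]) (intro ml)
  also have "\<dots> = lsum (H.cop h) (\<lambda>a b. lsum (ro a) (\<lambda>p r. t (H.eps b) (f p (r \<star> \<l>))))"
    by (subst ro_eps[where t = t]) (intro ml | simp)+
  also have "\<dots> = lsum (H.cop h) (\<lambda>a b. t (H.eps b) (lsum (ro a) (\<lambda>p r. f p (r \<star> \<l>))))"
    by (simp add: scale_lsum[OF vs])
  also have "\<dots> = lsum (ro h) (\<lambda>p r. f p (r \<star> \<l>))"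
    by (subst H.cop_counit(2)[where t = t]) (intro ml | simp)+
  finally show ?thesis by simp
qed

lemma \<l>_mul_\<l> [simp]: "\<l> \<star> \<l> = \<l>"
proof -
  have "\<l> \<star> \<l> = lsum (ro \<one>\<^bsub>H\<^esub>) (\<lambda>p r. scale L (H.eps p) (r \<star> \<l>))"
    by (subst ro_one[where t = "scale L"])
      (intro multilinear | simp add: vector_space.vector_space_assms[OF L.vector_space])+
  also have "\<dots> = lsum (ro \<one>\<^bsub>H\<^esub>) (\<lambda>p r. scale L (H.eps p) r)"
    by (rule ro_\<l>[where t = "scale L"]) (intro multilinear)
  also have "\<dots> = \<l>" by (simp add: \<l>_def)
  finally show ?thesis .
qed

lemma \<l>_mul_\<l>_mul [simp]: "\<l> \<star> (\<l> \<star> x) = \<l> \<star> x"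
  by (simp add: L.mul_assoc[symmetric])

text \<open>
  The quasi-abelian condition with the counit on its first leg, where \<open>\<epsilon>(h\<^sup>0) h\<^sup>1\<close> becomes \<open>\<l>\<close> on both
  sides. For \<open>h = 1\<close> it says that \<open>\<l>\<close> is central.
\<close>

lemma act_mul_\<l>: "(h \<rhd> x) \<star> \<l> = \<l> \<star> (h \<rhd> x)"
proof -
  let ?t = "scale L"
  have "(h \<rhd> x) \<star> \<l> = lsum (H.cop h) (\<lambda>a b. ?t (H.eps b) ((a \<rhd> x) \<star> \<l>))"
    by (subst H.cop_counit(2)[where t = ?t]) (intro multilinear | simp)+
  also have "\<dots> = lsum (H.cop h) (\<lambda>a b. lsum (ro b) (\<lambda>p r. ?t (H.eps p) ((a \<rhd> x) \<star> r)))"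
    by (subst ro_eps[where t = ?t]) (intro multilinear | simp)+
  also have "\<dots> = lsum (H.cop h) (\<lambda>a b. lsum (ro a) (\<lambda>p r. ?t (H.eps p) (r \<star> (b \<rhd> x))))"
    by (rule quasi_abelian_lsum[where t = ?t]) (intro multilinear)
  also have "\<dots> = lsum (H.cop h) (\<lambda>a b. ?t (H.eps a) (\<l> \<star> (b \<rhd> x)))"
    by (subst ro_eps[where t = ?t]) (intro multilinear | simp)+
  also have "\<dots> = \<l> \<star> (h \<rhd> x)"
    by (subst H.cop_counit(1)[where t = ?t]) (intro multilinear | simp)+
  finally show ?thesis .
qed

lemma mul_\<l>: "x \<star> \<l> = \<l> \<star> x"
  using act_mul_\<l>[of "\<one>\<^bsub>H\<^esub>" x] by simp

lemma mul_\<l>_mul: "x \<star> (\<l> \<star> y) = \<l> \<star> (x \<star> y)"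
  by (metis mul_\<l> L.mul_assoc)

text \<open>
  The action of \<open>h\<close> on \<open>1 x\<close> and on \<open>x 1\<close>.
\<close>

lemma act_lam:
  assumes f: "lin (scale L) t f"
  shows "lsum (H.cop h) (\<lambda>a b. t (lam a) (f (b \<rhd> x))) = f (h \<rhd> x)"
    and "lsum (H.cop h) (\<lambda>a b. t (lam b) (f (a \<rhd> x))) = f (h \<rhd> x)"
proof -
  have sc: "f (scale L k x) = t k (f x)" for k x using f by (simp add: lin_iff)
  show "lsum (H.cop h) (\<lambda>a b. t (lam a) (f (b \<rhd> x))) = f (h \<rhd> x)"
    using arg_cong[where f = f, OF act_mul[of h "\<one>\<^bsub>L\<^esub>" x]]
    by (simp add: lin_lsum_push[OF f] act_unit L.mul_scale sc)
  show "lsum (H.cop h) (\<lambda>a b. t (lam b) (f (a \<rhd> x))) = f (h \<rhd> x)"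
    using arg_cong[where f = f, OF act_mul[of h x "\<one>\<^bsub>L\<^esub>"]]
    by (simp add: lin_lsum_push[OF f] act_unit L.mul_scale sc)
qed

lemma lam_lam: "lsum (H.cop h) (\<lambda>a b. lam a * lam b) = lam h"
  using act_lam(1)[of "(*)" L.eps h "\<one>\<^bsub>L\<^esub>"] L.lin_eps[OF L.lin_ident] by (simp add: lam_def)

lemma act_act_lam:
  assumes f: "lin (scale L) t f"
  shows "lsum (H.cop h) (\<lambda>a b. t (lam a) (f ((b \<bullet> g) \<rhd> x))) = f (h \<rhd> g \<rhd> x)"
proof -
  have sc: "f (scale L k x) = t k (f x)" for k x using f by (simp add: lin_iff)
  show ?thesis
    using arg_cong[where f = f, OF act_act'[of h g x]]
    by (simp add: lin_lsum_push[OF f] act_unit L.mul_scale sc)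
qed

lemma lam_mul: "lsum (H.cop h) (\<lambda>a b. lam a * lam (b \<bullet> g)) = lam h * lam g"
  using act_act_lam[of "(*)" L.eps h g "\<one>\<^bsub>L\<^esub>"] L.lin_eps[OF L.lin_ident]
  by (simp add: eps_act)

text \<open>
  The partial action of a product differs from the composite action by a factor \<open>\<lambda>\<close>, which the
  neighbouring factor \<open>a \<rightharpoonup> y\<close> absorbs.
\<close>

lemma act_mul_act:
  assumes f: "bilin (scale L) (scale L) t f"
  shows "lsum (H.cop h) (\<lambda>a b. f (a \<rhd> y) (b \<rhd> g \<rhd> z)) =
    lsum (H.cop h) (\<lambda>a b. f (a \<rhd> y) ((b \<bullet> g) \<rhd> z))"
proof -
  have vs: "vector_space t" by (rule bilin_vector_space[OF f])
  note ml = multilinear bilin_compose[OF f] lin_scale[where t = t] lin_scale_left[where t = t, OF vs]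
  have "lsum (H.cop h) (\<lambda>a b. f (a \<rhd> y) (b \<rhd> g \<rhd> z)) =
    lsum (H.cop h) (\<lambda>a b. lsum (H.cop b) (\<lambda>c d. t (lam c) (f (a \<rhd> y) ((d \<bullet> g) \<rhd> z))))"
    by (subst act_act_lam[where t = t]) (intro ml | simp)+
  also have "\<dots> = lsum (H.cop h) (\<lambda>b d. lsum (H.cop b) (\<lambda>a c. t (lam c) (f (a \<rhd> y) ((d \<bullet> g) \<rhd> z))))"
    by (rule H.cop_coassoc[where t = t, symmetric]) (intro ml)
  also have "\<dots> = lsum (H.cop h) (\<lambda>b d. f (b \<rhd> y) ((d \<bullet> g) \<rhd> z))"
    by (subst act_lam(2)[where t = t]) (intro ml | simp)+
  finally show ?thesis .
qed

text \<open>
  The quasi-abelian condition for \<open>x = 1\<close>.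
\<close>

lemma ro_lam:
  assumes f: "bilin (scale H) (scale L) t f"
  shows "lsum (H.cop h) (\<lambda>a b. t (lam a) (lsum (ro b) f)) =
    lsum (H.cop h) (\<lambda>a b. t (lam b) (lsum (ro a) f))"
proof -
  have sc: "f y (scale L k x) = t k (f y x)" for k x y
    using f by (simp add: bilin_def lin_iff)
  show ?thesis
    using quasi_abelian_lsum[OF f, of h "\<one>\<^bsub>L\<^esub>"]
    by (simp add: act_unit L.mul_scale proj_ro sc scale_lsum[OF bilin_vector_space[OF f]]
        cong: lsum_cong)
qed

lemma lam_central:
  assumes f: "lin (scale H) t f"
  shows "lsum (H.cop h) (\<lambda>a b. t (lam a) (f b)) = lsum (H.cop h) (\<lambda>a b. t (lam b) (f a))"
proof -
  have vs: "vector_space t" using f by (simp add: lin_iff)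
  have *: "bilin (scale H) (scale L) t (\<lambda>p r. t (L.eps r) (f p))"
    by (intro multilinear lin_compose[OF f] lin_scale[where t = t] lin_scale_left[where t = t, OF vs])
  show ?thesis
    using ro_lam[OF *, of h] by (simp add: ro_counit[OF f] H.proj_cop cong: lsum_cong)
qed

text \<open>
  The compatibility condition for \<open>g = 1\<close> with the counits applied to its first two legs.
\<close>

lemma compat_counit:
  assumes f: "lin (scale L) t f"
  shows "f ((h \<rhd> x) \<star> \<l>) =
    lsum (H.cop h) (\<lambda>a b. lsum (ro a) (\<lambda>p r. t (lam p) (f (r \<star> (b \<rhd> (x \<star> \<l>))))))"
proof -
  have vs: "vector_space t" using f by (simp add: lin_iff)
  note ml = multilinear lin_compose[OF f] lin_scale[where t = t] lin_scale_left[where t = t, OF vs]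
  have left: "lsum (H.cop h) (\<lambda>h1 h2. lsum (ro (h2 \<bullet> \<one>\<^bsub>H\<^esub>)) (\<lambda>k0 k1. lsum (L.cop (h1 \<rhd> x)) (\<lambda>u v.
      t (H.eps k0 * L.eps u) (f (v \<star> k1))))) = f ((h \<rhd> x) \<star> \<l>)"
  proof -
    have "lsum (L.cop (h1 \<rhd> x)) (\<lambda>u v. t (H.eps k0 * L.eps u) (f (v \<star> k1))) =
      t (H.eps k0) (f ((h1 \<rhd> x) \<star> k1))" for h1 k0 k1
    proof -
      have "lsum (L.cop (h1 \<rhd> x)) (\<lambda>u v. t (H.eps k0 * L.eps u) (f (v \<star> k1))) =
        lsum (L.cop (h1 \<rhd> x)) (\<lambda>u v. t (L.eps u) (t (H.eps k0) (f (v \<star> k1))))"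
        by (simp add: vector_space.vector_space_assms[OF vs] mult.commute)
      also have "\<dots> = t (H.eps k0) (f ((h1 \<rhd> x) \<star> k1))"
        by (subst L.cop_counit(1)[where t = t]) (intro ml | simp)+
      finally show ?thesis .
    qed
    then have "lsum (H.cop h) (\<lambda>h1 h2. lsum (ro (h2 \<bullet> \<one>\<^bsub>H\<^esub>)) (\<lambda>k0 k1. lsum (L.cop (h1 \<rhd> x)) (\<lambda>u v.
      t (H.eps k0 * L.eps u) (f (v \<star> k1))))) =
      lsum (H.cop h) (\<lambda>h1 h2. lsum (ro h2) (\<lambda>k0 k1. t (H.eps k0) (f ((h1 \<rhd> x) \<star> k1))))"
      by simp
    also have "\<dots> = lsum (H.cop h) (\<lambda>h1 h2. t (H.eps h2) (f ((h1 \<rhd> x) \<star> \<l>)))"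
      by (subst ro_eps[where t = t]) (intro ml | simp)+
    also have "\<dots> = f ((h \<rhd> x) \<star> \<l>)"
      by (subst H.cop_counit(2)[where t = t]) (intro ml | simp)+
    finally show ?thesis .
  qed
  let ?G = "\<lambda>p r y. t (lam p) (f (r \<star> y))"
  have "lsum (H.cop h) (\<lambda>h1 h2. lsum (ro (h2 \<bullet> \<one>\<^bsub>H\<^esub>)) (\<lambda>k0 k1. lsum (L.cop (h1 \<rhd> x)) (\<lambda>u v.
      t (H.eps k0 * L.eps u) (f (v \<star> k1))))) =
    lsum (H.cop h) (\<lambda>h1 s. lsum (H.cop s) (\<lambda>h2 s'. lsum (H.cop s') (\<lambda>h3 h4.
      lsum (L.cop x) (\<lambda>x1 x2. lsum (ro h1) (\<lambda>p r. lsum (ro h3) (\<lambda>p3 r3. lsum (ro \<one>\<^bsub>H\<^esub>) (\<lambda>g0 g1.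
        t (H.eps (p3 \<bullet> g0) * L.eps (p \<rhd> x1)) (f (r \<star> (h2 \<rhd> x2) \<star> r3 \<star> (h4 \<rhd> g1))))))))))"
    by (rule compatibility_lsum[where t = t]) (intro ml)
  also have "\<dots> = lsum (H.cop h) (\<lambda>h1 s. lsum (H.cop s) (\<lambda>h2 s'. lsum (H.cop s') (\<lambda>h3 h4.
      lsum (L.cop x) (\<lambda>x1 x2. lsum (ro h1) (\<lambda>p r. lsum (ro h3) (\<lambda>p3 r3.
        t (H.eps p3) (t (L.eps x1) (?G p r ((h2 \<rhd> x2) \<star> (r3 \<star> (h4 \<rhd> \<l>)))))))))))"
    by (subst ro_one[where t = t])
      (intro ml | simp add: vector_space.vector_space_assms[OF vs] eps_act L.mul_assoc ac_simps)+
  also have "\<dots> = lsum (H.cop h) (\<lambda>h1 s. lsum (H.cop s) (\<lambda>h2 s'. lsum (H.cop s') (\<lambda>h3 h4.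
      lsum (L.cop x) (\<lambda>x1 x2. lsum (ro h1) (\<lambda>p r.
        t (H.eps h3) (t (L.eps x1) (?G p r ((h2 \<rhd> x2) \<star> (\<l> \<star> (h4 \<rhd> \<l>))))))))))"
    by (subst ro_eps[where t = t]) (intro ml | simp)+
  also have "\<dots> = lsum (H.cop h) (\<lambda>h1 s. lsum (H.cop s) (\<lambda>h2 s'. lsum (H.cop s') (\<lambda>h3 h4.
      t (H.eps h3) (lsum (L.cop x) (\<lambda>x1 x2. t (L.eps x1) (lsum (ro h1) (\<lambda>p r.
        ?G p r ((h2 \<rhd> x2) \<star> (\<l> \<star> (h4 \<rhd> \<l>))))))))))"
    by (simp add: scale_lsum[OF vs])
  also have "\<dots> = lsum (H.cop h) (\<lambda>h1 s. lsum (H.cop s) (\<lambda>h2 s'.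
      lsum (L.cop x) (\<lambda>x1 x2. t (L.eps x1) (lsum (ro h1) (\<lambda>p r.
        ?G p r ((h2 \<rhd> x2) \<star> (\<l> \<star> (s' \<rhd> \<l>))))))))"
    by (subst H.cop_counit(1)[where t = t]) (intro ml | simp)+
  also have "\<dots> = lsum (H.cop h) (\<lambda>h1 s. lsum (H.cop s) (\<lambda>h2 s'.
      lsum (ro h1) (\<lambda>p r. ?G p r ((h2 \<rhd> x) \<star> (\<l> \<star> (s' \<rhd> \<l>))))))"
    by (subst L.cop_counit(1)[where t = t]) (intro ml | simp)+
  also have "\<dots> = lsum (H.cop h) (\<lambda>h1 s. lsum (ro h1) (\<lambda>p r. lsum (H.cop s) (\<lambda>h2 s'.
      ?G p (r \<star> \<l>) ((h2 \<rhd> x) \<star> (s' \<rhd> \<l>)))))"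
    by (subst lsum_swap) (simp add: mul_\<l>_mul L.mul_assoc)
  also have "\<dots> = lsum (H.cop h) (\<lambda>h1 s. lsum (ro h1) (\<lambda>p r. ?G p (r \<star> \<l>) (s \<rhd> (x \<star> \<l>))))"
  proof -
    have "lin (scale L) t (\<lambda>y. ?G p r y)" for p r by (intro ml)
    note push = lin_lsum_push[OF this]
    show ?thesis by (simp add: act_mul push)
  qed
  also have "\<dots> = lsum (H.cop h) (\<lambda>h1 s. lsum (ro h1) (\<lambda>p r. ?G p r (s \<rhd> (x \<star> \<l>))))"
    by (intro lsum_cong refl ro_\<l>[where t = t]) (intro ml)
  finally show ?thesis unfolding left .
qed

lemma lam_\<l>_unit:
  assumes f: "lin (scale L) t f"
  shows "t (lam h) (f \<l>) = lsum (H.cop h) (\<lambda>a b. lsum (ro a) (\<lambda>p r. t (lam p) (f (r \<star> (b \<rhd> \<l>)))))"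
proof -
  have sc: "f (scale L k x) = t k (f x)" for k x using f by (simp add: lin_iff)
  show ?thesis
    using compat_counit[OF f, of h "\<one>\<^bsub>L\<^esub>"] by (simp add: act_unit L.mul_scale sc)
qed

text \<open>
  \<open>compat_counit\<close> has the same right-hand side for \<open>x = \<l>\<close> as for \<open>x = 1\<close>, because \<open>\<l>\<close> is idempotent.
\<close>

lemma \<l>_mul_act_\<l>: "\<l> \<star> (h \<rhd> \<l>) = scale L (lam h) \<l>"
  using compat_counit[OF L.lin_ident, of h \<l>] lam_\<l>_unit[OF L.lin_ident, of h]
  by (simp add: act_mul_\<l>)

text \<open>
  \<open>\<lambda>(h\<^sub>1\<^sup>0) h\<^sub>1\<^sup>1 \<lambda>(h\<^sub>2) = \<lambda>(h) \<l>\<close>. This is what makes a spanning element of the bialgebra a pure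
  tensor in which \<open>x\<close> and \<open>h\<close> are modified independently. The factor \<open>\<lambda>(b)\<close> may be traded for
  \<open>b \<rightharpoonup> \<l>\<close> because \<open>h\<^sup>1\<close> absorbs \<open>\<l>\<close>.
\<close>

lemma ro_lam_lam:
  assumes f: "lin (scale L) t f"
  shows "lsum (H.cop h) (\<lambda>a b. lsum (ro a) (\<lambda>p r. t (lam p * lam b) (f r))) = t (lam h) (f \<l>)"
proof -
  have vs: "vector_space t" using f by (simp add: lin_iff)
  note ml = multilinear lin_compose[OF f] lin_scale[where t = t] lin_scale_left[where t = t, OF vs]
  have sc: "f (scale L k x) = t k (f x)" for k x using f by (simp add: lin_iff)
  have "lsum (ro a) (\<lambda>p r. t (lam p * lam b) (f r)) =
    lsum (ro a) (\<lambda>p r. t (lam p) (f (r \<star> (b \<rhd> \<l>))))" for a b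
  proof -
    have "lsum (ro a) (\<lambda>p r. t (lam p) (f (r \<star> (b \<rhd> \<l>)))) =
      lsum (ro a) (\<lambda>p r. t (lam p) (f (r \<star> \<l> \<star> (b \<rhd> \<l>))))"
      by (rule ro_\<l>[where t = t, symmetric]) (intro ml)
    also have "\<dots> = lsum (ro a) (\<lambda>p r. t (lam p * lam b) (f (r \<star> \<l>)))"
      by (simp add: L.mul_assoc \<l>_mul_act_\<l> L.mul_scale sc vector_space.vector_space_assms[OF vs])
    also have "\<dots> = lsum (ro a) (\<lambda>p r. t (lam p * lam b) (f r))"
      by (rule ro_\<l>[where t = t]) (intro ml)
    finally show ?thesis by simp
  qed
  then show ?thesis by (simp add: lam_\<l>_unit[OF f])
qed

lemma ro_ro_\<l>:
  assumes f: "trilin (scale H) (scale L) (scale L) t f"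
  shows "lsum (ro h) (\<lambda>p r. lsum (ro p) (\<lambda>q s. f q s r)) =
    lsum (ro h) (\<lambda>p r. lsum (L.cop r) (\<lambda>u v. f p u (v \<star> \<l>)))"
proof -
  have vs: "vector_space t" using f by (auto simp: trilin_def lin_iff)
  note ml = multilinear trilin_compose[OF f] lin_scale[where t = t] lin_scale_left[where t = t, OF vs]
  have "lsum (ro h) (\<lambda>p r. lsum (ro p) (\<lambda>q s. f q s r)) =
    lsum (H.cop h) (\<lambda>a b. lsum (ro a) (\<lambda>p r. lsum (ro b) (\<lambda>q s. lsum (L.cop r) (\<lambda>u v.
      t (H.eps q) (f p u (v \<star> s))))))"
    by (rule ro_ro[OF f])
  also have "\<dots> = lsum (H.cop h) (\<lambda>a b. lsum (ro a) (\<lambda>p r. lsum (L.cop r) (\<lambda>u v. lsum (ro b) (\<lambda>q s.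
      t (H.eps q) (f p u (v \<star> s))))))"
    by (subst (3) lsum_swap) simp
  also have "\<dots> = lsum (H.cop h) (\<lambda>a b. lsum (ro a) (\<lambda>p r. lsum (L.cop r) (\<lambda>u v.
      t (H.eps b) (f p u (v \<star> \<l>)))))"
    by (subst ro_eps[where t = t]) (intro ml | simp)+
  also have "\<dots> = lsum (H.cop h) (\<lambda>a b. t (H.eps b) (lsum (ro a) (\<lambda>p r. lsum (L.cop r) (\<lambda>u v.
      f p u (v \<star> \<l>)))))"
    by (simp add: scale_lsum[OF vs])
  also have "\<dots> = lsum (ro h) (\<lambda>p r. lsum (L.cop r) (\<lambda>u v. f p u (v \<star> \<l>)))"
    by (subst H.cop_counit(2)[where t = t]) (intro ml | simp)+
  finally show ?thesis .
qed

text \<open>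
  \<open>\<Delta>(\<l>) (1 \<otimes> \<l>) = \<l> \<otimes> \<l>\<close>: apply the coaction twice to \<open>1\<close>.
\<close>

lemma cop_\<l>:
  assumes f: "bilin (scale L) (scale L) t f"
  shows "lsum (L.cop \<l>) (\<lambda>u v. f u (v \<star> \<l>)) = f \<l> \<l>"
proof -
  have vs: "vector_space t" by (rule bilin_vector_space[OF f])
  note ml = multilinear bilin_compose[OF f] lin_scale[where t = t] lin_scale_left[where t = t, OF vs]
  note s1 = vector_space.vector_space_assms(4)[OF vs]
  have "lsum (L.cop \<l>) (\<lambda>u v. f u (v \<star> \<l>)) =
    lsum (ro \<one>\<^bsub>H\<^esub>) (\<lambda>p r. lsum (L.cop r) (\<lambda>u v. t (H.eps p) (f u (v \<star> \<l>))))"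
    by (subst ro_one[where t = t]) (intro ml | simp add: s1)+
  also have "\<dots> = lsum (ro \<one>\<^bsub>H\<^esub>) (\<lambda>p r. lsum (ro p) (\<lambda>q s. t (H.eps q) (f s r)))"
    by (rule ro_ro_\<l>[where t = t, symmetric]) (intro ml)
  also have "\<dots> = f \<l> \<l>"
    by (subst ro_one[where t = t], (intro ml)[1], subst ro_one[where t = t]) (intro ml | simp add: s1)+
  finally show ?thesis .
qed

section \<open>The algebra\<close>

sublocale LH: vspace2 L H by unfold_locales

abbreviation ps_scale :: "'k \<Rightarrow> (('l \<Rightarrow> 'h \<Rightarrow> 'k) \<Rightarrow> 'k) \<Rightarrow> ('l \<Rightarrow> 'h \<Rightarrow> 'k) \<Rightarrow> 'k" where
  "ps_scale \<equiv> pointwise_scale"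

text \<open>
  The pure tensor, bilinear on the whole ambient spaces.
\<close>

definition ten where "ten x h = tensor L H (proj L x) (proj H h)"

text \<open>
  The element \<open>x \<l> \<otimes> \<lambda>(h\<^sub>1) h\<^sub>2\<close>. By \<open>partial_smash_ps\<close> these are the spanning elements.
\<close>

definition ps where "ps x h = lsum (H.cop h) (\<lambda>a b. ps_scale (lam a) (ten (x \<star> \<l>) b))"

lemma lin_ten [multilinear]:
  shows "lin s (scale L) f \<Longrightarrow> lin s ps_scale (\<lambda>x. ten (f x) h)"
    and "lin s (scale H) g \<Longrightarrow> lin s ps_scale (\<lambda>x. ten y (g x))"
proof -
  have 1: "lin (scale L) ps_scale (\<lambda>x. ten x h)" and 2: "lin (scale H) ps_scale (\<lambda>h. ten y h)"
    using bilinear_on_tensor[OF L.vspace_axioms H.vspace_axioms] vector_space_pointwise_scale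
      L.lin_linear_on[of "tensor_space L H" "\<lambda>x. tensor L H x (proj H h)"]
      H.lin_linear_on[of "tensor_space L H" "\<lambda>h. tensor L H (proj L y) h"]
    by (simp_all add: ten_def bilinear_on_def tensor_space_def)
  show "lin s (scale L) f \<Longrightarrow> lin s ps_scale (\<lambda>x. ten (f x) h)" by (rule lin_compose[OF 1])
  show "lin s (scale H) g \<Longrightarrow> lin s ps_scale (\<lambda>x. ten y (g x))" by (rule lin_compose[OF 2])
qed

lemma lin_ps [multilinear]:
  shows "lin s (scale L) f \<Longrightarrow> lin s ps_scale (\<lambda>x. ps (f x) h)"
    and "lin s (scale H) g \<Longrightarrow> lin s ps_scale (\<lambda>x. ps y (g x))"
  unfolding ps_def by (intro multilinear; assumption)+

lemma scale_ps: "ps (scale L c x) h = ps_scale c (ps x h)"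
  using lin_ps(1)[OF L.lin_ident] by (simp add: lin_iff)

lemma lsum_ps: "ps (lsum r f) h = lsum r (\<lambda>a b. ps (f a b) h)"
  by (rule lin_lsum_push[OF lin_ps(1)[OF L.lin_ident]])

lemma ps_proj [simp]: "ps (proj L x) h = ps x h" "ps x (proj H h) = ps x h"
  by (simp_all add: ps_def)

lemma ps_\<l> [simp]: "ps (x \<star> \<l>) h = ps x h" "ps (\<l> \<star> x) h = ps x h"
  "ps (x \<star> (\<l> \<star> y)) h = ps (x \<star> y) h" "ps (x \<star> (y \<star> \<l>)) h = ps (x \<star> y) h"
  "ps (x \<star> \<l> \<star> y) h = ps (x \<star> y) h" "ps \<l> h = ps \<one>\<^bsub>L\<^esub> h"
  "ps (x \<star> (y \<star> (\<l> \<star> z))) h = ps (x \<star> (y \<star> z)) h"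
proof -
  show *: "ps (x \<star> \<l>) h = ps x h" for x by (simp add: ps_def L.mul_assoc)
  show 2: "ps (\<l> \<star> x) h = ps x h" for x using *[of x] by (simp add: mul_\<l>)
  show 3: "ps (x \<star> (\<l> \<star> y)) h = ps (x \<star> y) h" for x y
    unfolding mul_\<l>_mul by (rule 2)
  show "ps (x \<star> (y \<star> \<l>)) h = ps (x \<star> y) h" using *[of "x \<star> y"] by (simp add: L.mul_assoc)
  show "ps (x \<star> \<l> \<star> y) h = ps (x \<star> y) h" by (simp add: L.mul_assoc 3)
  show "ps (x \<star> (y \<star> (\<l> \<star> z))) h = ps (x \<star> (y \<star> z)) h"
    using 3[of "x \<star> y" z] by (simp add: L.mul_assoc)
  show "ps \<l> h = ps \<one>\<^bsub>L\<^esub> h" using *[of "\<one>\<^bsub>L\<^esub>"] by simp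
qed

lemma ps_lam:
  assumes f: "lin ps_scale t f"
  shows "lsum (H.cop h) (\<lambda>a b. t (lam a) (f (ps x b))) = f (ps x h)"
    and "lsum (H.cop h) (\<lambda>a b. t (lam b) (f (ps x a))) = f (ps x h)"
proof -
  have vs: "vector_space t" using f by (simp add: lin_iff)
  have sc: "f (pointwise_scale k x) = t k (f x)" for k x using f by (simp add: lin_iff)
  note ml = multilinear lin_compose[OF f] lin_scale[where t = t] lin_scale_left[where t = t, OF vs]
  have "lsum (H.cop h) (\<lambda>a b. t (lam a) (f (ps x b))) =
    lsum (H.cop h) (\<lambda>a b. lsum (H.cop b) (\<lambda>c d. t (lam a * lam c) (f (ten (x \<star> \<l>) d))))"
    by (simp add: ps_def lin_lsum_push[OF f] sc scale_lsum[OF vs] vector_space.vector_space_assms[OF vs])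
  also have "\<dots> = lsum (H.cop h) (\<lambda>b d. lsum (H.cop b) (\<lambda>a c. t (lam a * lam c) (f (ten (x \<star> \<l>) d))))"
    by (rule H.cop_coassoc[where t = t, symmetric]) (intro ml)
  also have "\<dots> = lsum (H.cop h) (\<lambda>b d. t (lam b) (f (ten (x \<star> \<l>) d)))"
  proof -
    have "lsum (H.cop b) (\<lambda>a c. t (lam a * lam c) v) = t (lam b) v" for b v
      by (simp add: lsum_scale_left[OF vs] lam_lam)
    then show ?thesis by simp
  qed
  also have "\<dots> = f (ps x h)" by (simp add: ps_def lin_lsum_push[OF f] sc)
  finally show 1: "lsum (H.cop h) (\<lambda>a b. t (lam a) (f (ps x b))) = f (ps x h)" .
  then show "lsum (H.cop h) (\<lambda>a b. t (lam b) (f (ps x a))) = f (ps x h)"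
    by (subst lam_central[where t = t, symmetric]) (intro ml | simp)+
qed

text \<open>
  The defining formula contains \<open>\<lambda>(h\<^sub>1\<^sup>0) h\<^sub>1\<^sup>1 \<lambda>(h\<^sub>2)\<close>, which \<open>ro_lam_lam\<close> evaluates.
\<close>

lemma partial_smash_ps:
  assumes "x \<in> carrier L" "h \<in> carrier H"
  shows "partial_smash H L (\<rightharpoonup>) \<rho> x h = ps x h"
proof -
  note vs = vector_space_pointwise_scale
  have "partial_smash H L (\<rightharpoonup>) \<rho> x h =
    lsum (H.cop h) (\<lambda>h1 s. lsum (H.cop s) (\<lambda>h2 h3. lsum (ro h1) (\<lambda>p r.
      ps_scale (lam p) (ten (x \<star> r \<star> (h2 \<rhd> \<one>\<^bsub>L\<^esub>)) h3))))"
    using assms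
    by (simp add: partial_smash_def sweedler3_def to_total tensor_space_def lam_def ten_def H.proj_cop
        cong: lsum_cong)
  also have "\<dots> = lsum (H.cop h) (\<lambda>h1 s. lsum (H.cop s) (\<lambda>h2 h3. lsum (ro h1) (\<lambda>p r.
      ps_scale (lam p * lam h2) (ten (x \<star> r) h3))))"
  proof -
    have "ten (scale L c y) k = ps_scale c (ten y k)" for c y k
      using lin_ten(1)[OF L.lin_ident] by (simp add: lin_iff)
    moreover have "ten (proj L y) k = ten y k" for y k by (simp add: ten_def)
    ultimately show ?thesis
      by (simp add: act_unit L.mul_scale vector_space.vector_space_assms[OF vs])
  qed
  also have "\<dots> = lsum (H.cop h) (\<lambda>s h3. lsum (H.cop s) (\<lambda>h1 h2. lsum (ro h1) (\<lambda>p r.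
      ps_scale (lam p * lam h2) (ten (x \<star> r) h3))))"
    by (rule H.cop_coassoc[where t = ps_scale, symmetric]) (intro multilinear)
  also have "\<dots> = ps x h"
    by (subst ro_lam_lam[where t = ps_scale]) (intro multilinear | simp add: ps_def)+
  finally show ?thesis .
qed

text \<open>
  The bilinear maps that factor through \<open>x \<otimes> h \<mapsto> ps x h\<close>: a linear map on the span of the elements
  \<open>ps x h\<close> is the same thing as an invariant bilinear map, by \<open>extend_ps\<close>.
\<close>

definition invariant where
  "invariant t f \<longleftrightarrow> bilin (scale L) (scale H) t f \<and> (\<forall>x h. f (x \<star> \<l>) h = f x h) \<and>
     (\<forall>x h. lsum (H.cop h) (\<lambda>a b. t (lam a) (f x b)) = f x h)"

lemma extend_ps:
  assumes "invariant t f"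
  shows "LH.extend f (ps x h) = f x h"
proof -
  have f: "bilin (scale L) (scale H) t f" using assms by (simp add: invariant_def)
  note l = LH.lin_extend[OF f]
  have sc: "LH.extend f (pointwise_scale k y) = t k (LH.extend f y)" for k y
    using l by (simp add: lin_iff)
  have "LH.extend f (ps x h) = lsum (H.cop h) (\<lambda>a b. t (lam a) (f (x \<star> \<l>) b))"
    by (simp add: ps_def lin_lsum_push[OF l] sc ten_def LH.extend_tensor[OF f] H.proj_cop H.cop_in
        cong: lsum_cong)
  then show ?thesis using assms by (simp add: invariant_def)
qed

definition smash_mul where
  "smash_mul x h y g = lsum (H.cop h) (\<lambda>a b. ps (x \<star> (a \<rhd> y)) (b \<bullet> g))"

lemma lin_smash_mul [multilinear]:
  shows "lin s (scale L) f \<Longrightarrow> lin s ps_scale (\<lambda>x. smash_mul (f x) h y g)"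
    and "lin s (scale H) f' \<Longrightarrow> lin s ps_scale (\<lambda>x. smash_mul z (f' x) y g)"
    and "lin s (scale L) f \<Longrightarrow> lin s ps_scale (\<lambda>x. smash_mul z h (f x) g)"
    and "lin s (scale H) f' \<Longrightarrow> lin s ps_scale (\<lambda>x. smash_mul z h y (f' x))"
  unfolding smash_mul_def by (intro multilinear; assumption)+

lemma smash_mul_invariant_left: "invariant ps_scale (\<lambda>x h. smash_mul x h y g)"
proof -
  have "smash_mul (x \<star> \<l>) h y g = smash_mul x h y g" for x h
    by (simp add: smash_mul_def)
  moreover have "lsum (H.cop h) (\<lambda>a b. ps_scale (lam a) (smash_mul x b y g)) = smash_mul x h y g" for x h
  proof -
    have "lsum (H.cop h) (\<lambda>a b. ps_scale (lam a) (smash_mul x b y g)) =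
      lsum (H.cop h) (\<lambda>a b. lsum (H.cop b) (\<lambda>c d. ps_scale (lam a) (ps (x \<star> (c \<rhd> y)) (d \<bullet> g))))"
      by (simp add: smash_mul_def scale_lsum[OF vector_space_pointwise_scale])
    also have "\<dots> = lsum (H.cop h) (\<lambda>b d. lsum (H.cop b) (\<lambda>a c.
        ps_scale (lam a) (ps (x \<star> (c \<rhd> y)) (d \<bullet> g))))"
      by (rule H.cop_coassoc[where t = ps_scale, symmetric]) (intro multilinear)
    also have "\<dots> = smash_mul x h y g"
      by (subst act_lam(1)[where t = ps_scale]) (intro multilinear | simp add: smash_mul_def)+
    finally show ?thesis .
  qed
  ultimately show ?thesis by (auto simp: invariant_def intro!: multilinear)
qed

text \<open>
  The factor \<open>d \<rightharpoonup> \<l>\<close> becomes the scalar \<open>\<lambda>(d)\<close> next to the \<open>\<l>\<close> that \<open>ps\<close> provides.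
\<close>

lemma ps_act_\<l>: "ps (x \<star> (a \<rhd> (y \<star> \<l>))) h = ps (x \<star> (a \<rhd> y)) h"
proof -
  have "ps (x \<star> (a \<rhd> (y \<star> \<l>))) h = lsum (H.cop a) (\<lambda>c d. ps (x \<star> ((c \<rhd> y) \<star> (d \<rhd> \<l>))) h)"
    by (simp add: act_mul L.lsum_mul lsum_ps)
  also have "\<dots> = lsum (H.cop a) (\<lambda>c d. ps (x \<star> (c \<rhd> y) \<star> (\<l> \<star> (d \<rhd> \<l>))) h)"
    by (simp only: ps_\<l>) (simp add: L.mul_assoc)
  also have "\<dots> = lsum (H.cop a) (\<lambda>c d. ps_scale (lam d) (ps (x \<star> (c \<rhd> y)) h))"
    by (simp add: \<l>_mul_act_\<l> L.mul_scale scale_ps del: ps_\<l>(3)) 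
  also have "\<dots> = ps (x \<star> (a \<rhd> y)) h"
    by (subst act_lam(2)[where t = ps_scale]) (intro multilinear | simp)+
  finally show ?thesis .
qed

text \<open>
  For invariance in \<open>g\<close>, the factor \<open>\<lambda>\<close> that \<open>ps\<close> absorbs in its second argument \<open>h\<^sub>2 g\<close> is
  \<open>\<lambda>(h\<^sub>2 g\<^sub>1)\<close>. Together with a factor \<open>\<lambda>\<close> split off from \<open>h\<^sub>1 \<rightharpoonup> y\<close> it becomes \<open>\<lambda>(h\<^sub>2) \<lambda>(g\<^sub>1)\<close> by
  \<open>lam_mul\<close>, and \<open>\<lambda>(h\<^sub>2)\<close> is absorbed again.
\<close>

lemma smash_mul_invariant_right: "invariant ps_scale (smash_mul x h)"
proof -
  note vs = vector_space_pointwise_scale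
  have 1: "smash_mul x h (y \<star> \<l>) g = smash_mul x h y g" for y g
    by (simp add: smash_mul_def ps_act_\<l>)
  have core: "lsum (H.cop h) (\<lambda>e k. lsum (H.cop k) (\<lambda>c d.
      ps_scale (lam (c \<bullet> a)) (ps (x \<star> (e \<rhd> y)) (d \<bullet> b)))) =
    ps_scale (lam a) (smash_mul x h y b)" for y a b
  proof -
    let ?Q = "\<lambda>e d. ps (x \<star> (e \<rhd> y)) (d \<bullet> b)"
    have "lsum (H.cop h) (\<lambda>e k. lsum (H.cop k) (\<lambda>c d. ps_scale (lam (c \<bullet> a)) (?Q e d))) =
      lsum (H.cop h) (\<lambda>k d. lsum (H.cop k) (\<lambda>e c. ps_scale (lam (c \<bullet> a)) (?Q e d)))"
      by (rule H.cop_coassoc[where t = ps_scale, symmetric]) (intro multilinear)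
    also have "\<dots> = lsum (H.cop h) (\<lambda>k d. lsum (H.cop k) (\<lambda>e c. lsum (H.cop e) (\<lambda>e' m.
        ps_scale (lam m) (ps_scale (lam (c \<bullet> a)) (?Q e' d)))))"
      by (subst act_lam(2)[where t = ps_scale]) (intro multilinear | simp)+
    also have "\<dots> = lsum (H.cop h) (\<lambda>k d. lsum (H.cop k) (\<lambda>e k'. lsum (H.cop k') (\<lambda>m c.
        ps_scale (lam m) (ps_scale (lam (c \<bullet> a)) (?Q e d)))))"
      by (subst H.cop_coassoc[where t = ps_scale]) (intro multilinear | simp)+
    also have "\<dots> = lsum (H.cop h) (\<lambda>k d. lsum (H.cop k) (\<lambda>e k'.
        ps_scale (lam k') (ps_scale (lam a) (?Q e d))))"
    proof -
      have "lsum (H.cop k') (\<lambda>m c. ps_scale (lam m) (ps_scale (lam (c \<bullet> a)) v)) =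
        ps_scale (lam k') (ps_scale (lam a) v)" for k' v
        by (simp add: lsum_scale_left[OF vs] lam_mul vector_space.vector_space_assms[OF vs])
      then show ?thesis by simp
    qed
    also have "\<dots> = lsum (H.cop h) (\<lambda>k d. ps_scale (lam a) (?Q k d))"
      by (subst act_lam(2)[where t = ps_scale]) (intro multilinear | simp)+
    also have "\<dots> = ps_scale (lam a) (smash_mul x h y b)"
      by (simp add: smash_mul_def scale_lsum[OF vs])
    finally show ?thesis .
  qed
  have "lsum (H.cop g) (\<lambda>a b. ps_scale (lam a) (smash_mul x h y b)) = smash_mul x h y g" for y g
  proof -
    have "smash_mul x h y g = lsum (H.cop h) (\<lambda>e k. lsum (H.cop (k \<bullet> g)) (\<lambda>u v.
        ps_scale (lam u) (ps (x \<star> (e \<rhd> y)) v)))"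
      unfolding smash_mul_def
      by (subst ps_lam(1)[where t = ps_scale and f = "\<lambda>v. v"]) (simp_all add: lin_id[OF vs])
    also have "\<dots> = lsum (H.cop h) (\<lambda>e k. lsum (H.cop k) (\<lambda>c d. lsum (H.cop g) (\<lambda>a b.
        ps_scale (lam (c \<bullet> a)) (ps (x \<star> (e \<rhd> y)) (d \<bullet> b)))))"
      by (subst H.cop_mul[where t = ps_scale]) (intro multilinear | simp)+
    also have "\<dots> = lsum (H.cop h) (\<lambda>e k. lsum (H.cop g) (\<lambda>a b. lsum (H.cop k) (\<lambda>c d. 
        ps_scale (lam (c \<bullet> a)) (ps (x \<star> (e \<rhd> y)) (d \<bullet> b)))))"
      by (subst (2) lsum_swap) (rule refl)
    also have "\<dots> = lsum (H.cop g) (\<lambda>a b. lsum (H.cop h) (\<lambda>e k. lsum (H.cop k) (\<lambda>c d. 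
        ps_scale (lam (c \<bullet> a)) (ps (x \<star> (e \<rhd> y)) (d \<bullet> b)))))"
      by (rule lsum_swap)
    also have "\<dots> = lsum (H.cop g) (\<lambda>a b. ps_scale (lam a) (smash_mul x h y b))"
      by (simp only: core)
    finally show ?thesis by simp
  qed
  with 1 show ?thesis by (auto simp: invariant_def intro!: multilinear)
qed

definition mulB (infixl "\<diamondop>" 70) where
  "s \<diamondop> t = LH.extend (\<lambda>x h. LH.extend (smash_mul x h) t) s"

lemma bilin_smash_mul:
  "bilin (scale L) (scale H) ps_scale (smash_mul x h)"
  "bilin (scale L) (scale H) ps_scale (\<lambda>x h. LH.extend (smash_mul x h) t)"
  by (intro multilinear) (unfold LH.extend_def, intro multilinear)

lemma lin_mulB [multilinear]:
  shows "lin r ps_scale f \<Longrightarrow> lin r ps_scale (\<lambda>x. f x \<diamondop> t)"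
    and "lin r ps_scale f \<Longrightarrow> lin r ps_scale (\<lambda>x. t \<diamondop> f x)"
proof -
  have 1: "lin ps_scale ps_scale (\<lambda>s. s \<diamondop> t)"
    unfolding mulB_def by (rule LH.lin_extend[OF bilin_smash_mul(2)])
  have 2: "lin ps_scale ps_scale (\<lambda>s. t \<diamondop> s)"
    unfolding mulB_def
    by (subst LH.extend_def) (rule lin_lsum, rule LH.lin_extend[OF bilin_smash_mul(1)])
  show "lin r ps_scale f \<Longrightarrow> lin r ps_scale (\<lambda>x. f x \<diamondop> t)" by (rule lin_compose[OF 1])
  show "lin r ps_scale f \<Longrightarrow> lin r ps_scale (\<lambda>x. t \<diamondop> f x)" by (rule lin_compose[OF 2])
qed

lemma ps_mulB: "ps x h \<diamondop> ps y g = lsum (H.cop h) (\<lambda>a b. ps (x \<star> (a \<rhd> y)) (b \<bullet> g))"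
  unfolding mulB_def extend_ps[OF smash_mul_invariant_right] extend_ps[OF smash_mul_invariant_left]
  by (rule smash_mul_def)

lemma ps_mul_assoc: "ps x h \<diamondop> ps y g \<diamondop> ps z k = ps x h \<diamondop> (ps y g \<diamondop> ps z k)"
proof -
  have "ps x h \<diamondop> ps y g \<diamondop> ps z k = lsum (H.cop h) (\<lambda>a b. lsum (H.cop (b \<bullet> g)) (\<lambda>c d.
      ps (x \<star> (a \<rhd> y) \<star> (c \<rhd> z)) (d \<bullet> k)))"
    by (simp add: ps_mulB lin_lsum_push[OF lin_mulB(1)[OF lin_id[OF vector_space_pointwise_scale]]])
  also have "\<dots> = lsum (H.cop h) (\<lambda>a b. lsum (H.cop b) (\<lambda>b1 b2. lsum (H.cop g) (\<lambda>g1 g2.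
      ps (x \<star> ((a \<rhd> y) \<star> ((b1 \<bullet> g1) \<rhd> z))) (b2 \<bullet> (g2 \<bullet> k)))))"
    by (subst H.cop_mul[where t = ps_scale])
      (intro multilinear | simp add: L.mul_assoc H.mul_assoc)+
  also have "\<dots> = lsum (H.cop h) (\<lambda>b b2. lsum (H.cop b) (\<lambda>a b1. lsum (H.cop g) (\<lambda>g1 g2.
      ps (x \<star> ((a \<rhd> y) \<star> ((b1 \<bullet> g1) \<rhd> z))) (b2 \<bullet> (g2 \<bullet> k)))))"
    by (rule H.cop_coassoc[where t = ps_scale, symmetric]) (intro multilinear)
  also have "\<dots> = lsum (H.cop h) (\<lambda>b b2. lsum (H.cop g) (\<lambda>g1 g2. lsum (H.cop b) (\<lambda>a b1.
      ps (x \<star> ((a \<rhd> y) \<star> ((b1 \<bullet> g1) \<rhd> z))) (b2 \<bullet> (g2 \<bullet> k)))))"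
    by (subst (2) lsum_swap) (rule refl)
  also have "\<dots> = lsum (H.cop h) (\<lambda>b b2. lsum (H.cop g) (\<lambda>g1 g2. lsum (H.cop b) (\<lambda>a b1.
      ps (x \<star> ((a \<rhd> y) \<star> (b1 \<rhd> g1 \<rhd> z))) (b2 \<bullet> (g2 \<bullet> k)))))"
    by (intro lsum_cong refl act_mul_act[where t = ps_scale, symmetric]) (intro multilinear)
  also have "\<dots> = lsum (H.cop h) (\<lambda>b b2. lsum (H.cop g) (\<lambda>g1 g2.
      ps (x \<star> (b \<rhd> (y \<star> (g1 \<rhd> z)))) (b2 \<bullet> (g2 \<bullet> k))))"
    by (simp add: act_mul L.lsum_mul lsum_ps)
  also have "\<dots> = lsum (H.cop g) (\<lambda>g1 g2. lsum (H.cop h) (\<lambda>b b2. 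
      ps (x \<star> (b \<rhd> (y \<star> (g1 \<rhd> z)))) (b2 \<bullet> (g2 \<bullet> k))))"
    by (rule lsum_swap)
  also have "\<dots> = ps x h \<diamondop> (ps y g \<diamondop> ps z k)"
    by (simp add: ps_mulB lin_lsum_push[OF lin_mulB(2)[OF lin_id[OF vector_space_pointwise_scale]]])
  finally show ?thesis .
qed

lemma ps_one_mul: "ps \<one>\<^bsub>L\<^esub> \<one>\<^bsub>H\<^esub> \<diamondop> ps y g = ps y g"
  unfolding ps_mulB by (subst H.cop_one[where t = ps_scale]) (intro multilinear | simp)+

lemma ps_mul_one: "ps x h \<diamondop> ps \<one>\<^bsub>L\<^esub> \<one>\<^bsub>H\<^esub> = ps x h"
  using ps_lam(1)[OF lin_id[OF vector_space_pointwise_scale], of h x]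
  by (simp add: ps_mulB act_unit L.mul_scale scale_ps)

section \<open>The bialgebra\<close>

definition smash_space :: "('k, ('l \<Rightarrow> 'h \<Rightarrow> 'k) \<Rightarrow> 'k) vspace" where
  "smash_space = \<lparr>carrier = module.span pointwise_scale {ps x h | x h. True}, scale = pointwise_scale\<rparr>"

lemma scale_smash_space [simp]: "scale smash_space = pointwise_scale"
  by (simp add: smash_space_def)

lemma vspace_smash_space: "vspace smash_space"
proof (rule vspace.intro)
  interpret T: vector_space ps_scale by (rule vector_space_pointwise_scale)
  show "vector_space (scale smash_space)" by (simp add: vector_space_pointwise_scale)
  show "module.subspace (scale smash_space) (carrier smash_space)" by (simp add: smash_space_def T.subspace_span)
qed

sublocale VB: vspace smash_space by (rule vspace_smash_space)

sublocale VBB: vspace2 smash_space smash_space by unfold_locales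

lemma ps_in [simp]: "ps x h \<in> carrier smash_space"
proof -
  interpret T: vector_space ps_scale by (rule vector_space_pointwise_scale)
  show ?thesis by (auto simp: smash_space_def intro!: T.span_base)
qed

lemma proj_ps [simp]: "proj smash_space (ps x h) = ps x h"
  by (simp add: VB.proj_id)

text \<open>
  All axioms are linear in each argument, so this reduces them to the spanning elements.
\<close>

lemma eq_on_smash_space:
  assumes "lin ps_scale t F" "lin ps_scale t G" "\<And>x h. F (ps x h) = G (ps x h)" "b \<in> carrier smash_space"
  shows "F b = G b"
proof -
  interpret vector_space_pair ps_scale t
    using assms(1) by (simp add: vector_space_pair_def lin_iff)
  show ?thesis
    using linear_eq_on[OF assms(1,2), of b "{ps x h | x h. True}"] assms(3,4) by (auto simp: smash_space_def)
qed

lemma extend_in: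
  assumes "vspace V" "\<And>x h. f x h \<in> carrier V"
  shows "LH.extend f t \<in> carrier V"
  unfolding LH.extend_def by (rule lsum_in[OF assms(1)]) (rule assms(2))

lemma mulB_in [simp]: "s \<diamondop> t \<in> carrier smash_space"
  unfolding mulB_def
  by (intro extend_in VB.vspace_axioms) (auto simp: smash_mul_def intro!: lsum_in VB.vspace_axioms)

text \<open>
  As for \<open>ten\<close>, the pure tensors of elements of the bialgebra are made multilinear on the ambient
  space.
\<close>

definition tenB where "tenB s t = tensor smash_space smash_space (proj smash_space s) (proj smash_space t)"

definition ten3B where
  "ten3B r s t = tensor3 smash_space smash_space smash_space (proj smash_space r) (proj smash_space s) (proj smash_space t)"

lemma bilin_tensor:
  fixes V :: "('k, 'a::ab_group_add) vspace" and W :: "('k, 'b::ab_group_add) vspace"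
  assumes "vspace V" "vspace W"
  shows "bilin (scale V) (scale W) pointwise_scale (\<lambda>s t. tensor V W (proj V s) (proj W t))"
proof -
  interpret V: vspace V by fact
  interpret W: vspace W by fact
  show ?thesis
    using bilinear_on_tensor[OF assms]
      V.lin_linear_on[of "tensor_space V W" "\<lambda>x. tensor V W x (proj W y)" for y]
      W.lin_linear_on[of "tensor_space V W" "tensor V W (proj V x)" for x]
    by (simp add: bilin_def bilinear_on_def tensor_space_def vector_space_pointwise_scale)
qed

lemma lin_tenB [multilinear]:
  shows "lin r ps_scale f \<Longrightarrow> lin r pointwise_scale (\<lambda>x. tenB (f x) t)"
    and "lin r ps_scale f \<Longrightarrow> lin r pointwise_scale (\<lambda>x. tenB t (f x))"
  using bilin_compose[OF bilin_tensor[OF VB.vspace_axioms VB.vspace_axioms], of r f]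
  by (simp_all add: tenB_def)

lemma tensor_smash_space_in: "s \<in> carrier smash_space \<Longrightarrow> t \<in> carrier smash_space \<Longrightarrow> tensor smash_space smash_space s t \<in> carrier (tensor_space smash_space smash_space)"
  using bilinear_on_tensor[OF VB.vspace_axioms VB.vspace_axioms]
  by (simp add: bilinear_on_def linear_on_def)

lemma tenB_in [simp]: "tenB s t \<in> carrier (tensor_space smash_space smash_space)"
  by (simp add: tenB_def tensor_smash_space_in)

lemma lin_ten3B [multilinear]:
  shows "lin r ps_scale f \<Longrightarrow> lin r pointwise_scale (\<lambda>x. ten3B (f x) s t)"
    and "lin r ps_scale f \<Longrightarrow> lin r pointwise_scale (\<lambda>x. ten3B s (f x) t)"
    and "lin r ps_scale f \<Longrightarrow> lin r pointwise_scale (\<lambda>x. ten3B s t (f x))"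
proof -
  interpret T: vspace "tensor_space smash_space smash_space" by (rule vspace_tensor_space)
  have eq: "ten3B r s t = tensor smash_space (tensor_space smash_space smash_space) (proj smash_space r)
      (proj (tensor_space smash_space smash_space) (tenB s t))" for r s t
    by (simp add: ten3B_def tensor3_def T.proj_id) (simp add: tenB_def)
  have sc: "scale (tensor_space smash_space smash_space) = pointwise_scale" by (simp add: tensor_space_def)
  note b = bilin_tensor[OF VB.vspace_axioms T.vspace_axioms, unfolded sc scale_smash_space]
  show "lin r ps_scale f \<Longrightarrow> lin r pointwise_scale (\<lambda>x. ten3B (f x) s t)"
    unfolding eq by (rule bilin_compose(1)[OF b])
  show "lin r ps_scale f \<Longrightarrow> lin r pointwise_scale (\<lambda>x. ten3B s (f x) t)"
    unfolding eq by (rule bilin_compose(2)[OF b]) (rule lin_tenB(1))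
  show "lin r ps_scale f \<Longrightarrow> lin r pointwise_scale (\<lambda>x. ten3B s t (f x))"
    unfolding eq by (rule bilin_compose(2)[OF b]) (rule lin_tenB(2))
qed

definition smash_cop where
  "smash_cop x h = lsum (L.cop x) (\<lambda>x1 x2. lsum (H.cop h) (\<lambda>h1 h2. lsum (ro h1) (\<lambda>p r.
     tenB (ps x1 p) (ps (x2 \<star> r) h2))))"

text \<open>
  Invariance in \<open>x\<close> is \<open>\<Delta>(\<l>) (1 \<otimes> \<l>) = \<l> \<otimes> \<l>\<close>. For invariance in \<open>h\<close>, the quasi-abelian condition moves
  \<open>\<lambda>\<close> from the left of \<open>h\<^sub>1\<close> to its right, where the second tensor factor absorbs it.
\<close>

lemma smash_cop_invariant: "invariant pointwise_scale smash_cop"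
proof -
  have "smash_cop (x \<star> \<l>) h = smash_cop x h" for x h
  proof -
    have "smash_cop (x \<star> \<l>) h = lsum (L.cop x) (\<lambda>x1 x2. lsum (L.cop \<l>) (\<lambda>u v.
        lsum (H.cop h) (\<lambda>h1 h2. lsum (ro h1) (\<lambda>p r.
          tenB (ps (x1 \<star> u) p) (ps (x2 \<star> (v \<star> \<l>) \<star> r) h2)))))"
      unfolding smash_cop_def
      by (subst L.cop_mul[where t = pointwise_scale]) (intro multilinear | simp add: L.mul_assoc)+
    also have "\<dots> = lsum (L.cop x) (\<lambda>x1 x2.
        lsum (H.cop h) (\<lambda>h1 h2. lsum (ro h1) (\<lambda>p r.
          tenB (ps (x1 \<star> \<l>) p) (ps (x2 \<star> \<l> \<star> r) h2))))"
      by (subst cop_\<l>[where t = pointwise_scale]) (intro multilinear | simp)+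
    finally show ?thesis by (simp add: smash_cop_def)
  qed
  moreover have "lsum (H.cop h) (\<lambda>a b. pointwise_scale (lam a) (smash_cop x b)) = smash_cop x h" for x h
  proof -
    let ?T = "\<lambda>x1 x2 h2 p r. tenB (ps x1 p) (ps (x2 \<star> r) h2)"
    have "lsum (H.cop h) (\<lambda>a b. pointwise_scale (lam a) (smash_cop x b)) =
      lsum (H.cop h) (\<lambda>a b. lsum (L.cop x) (\<lambda>x1 x2. lsum (H.cop b) (\<lambda>h1 h2.
        pointwise_scale (lam a) (lsum (ro h1) (?T x1 x2 h2)))))"
      by (simp add: smash_cop_def scale_lsum[OF vector_space_pointwise_scale])
    also have "\<dots> = lsum (L.cop x) (\<lambda>x1 x2. lsum (H.cop h) (\<lambda>a b. lsum (H.cop b) (\<lambda>h1 h2.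
        pointwise_scale (lam a) (lsum (ro h1) (?T x1 x2 h2)))))"
      by (rule lsum_swap)
    also have "\<dots> = lsum (L.cop x) (\<lambda>x1 x2. lsum (H.cop h) (\<lambda>c h2. lsum (H.cop c) (\<lambda>a h1.
        pointwise_scale (lam a) (lsum (ro h1) (?T x1 x2 h2)))))"
      by (subst H.cop_coassoc[where t = pointwise_scale]) (intro multilinear | simp)+
    also have "\<dots> = lsum (L.cop x) (\<lambda>x1 x2. lsum (H.cop h) (\<lambda>c h2. lsum (H.cop c) (\<lambda>h1 b.
        pointwise_scale (lam b) (lsum (ro h1) (?T x1 x2 h2)))))"
      by (intro lsum_cong refl ro_lam[where t = pointwise_scale]) (intro multilinear)
    also have "\<dots> = lsum (L.cop x) (\<lambda>x1 x2. lsum (H.cop h) (\<lambda>h1 k. lsum (H.cop k) (\<lambda>b h2.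
        pointwise_scale (lam b) (lsum (ro h1) (?T x1 x2 h2)))))"
      by (subst H.cop_coassoc[where t = pointwise_scale]) (intro multilinear | simp)+
    also have "\<dots> = smash_cop x h"
    proof -
      have l: "lin ps_scale pointwise_scale (\<lambda>z. lsum (ro h1) (\<lambda>p r. tenB (ps x1 p) z))" for h1 x1
        by (intro multilinear lin_id vector_space_pointwise_scale)
      have "lsum (H.cop k) (\<lambda>b h2. pointwise_scale (lam b) (lsum (ro h1) (?T x1 x2 h2))) =
        lsum (ro h1) (?T x1 x2 k)" for k h1 x1 x2
        apply (subst scale_lsum[OF vector_space_pointwise_scale], subst lsum_swap)
        by (intro lsum_cong refl ps_lam(1)[where t = pointwise_scale])
          (intro multilinear lin_id vector_space_pointwise_scale)
      then show ?thesis by (simp add: smash_cop_def)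
    qed
    finally show ?thesis .
  qed
  ultimately show ?thesis
    unfolding invariant_def by (auto simp: smash_cop_def[abs_def] intro!: multilinear)
qed

definition comB where "comB t = LH.extend smash_cop t"

definition copB where "copB t = rep smash_space smash_space (comB t)"

lemma comB_in: "comB t \<in> carrier (tensor_space smash_space smash_space)"
  unfolding comB_def smash_cop_def
  by (intro extend_in lsum_in vspace_tensor_space tenB_in)

lemma bilin_smash_cop: "bilin (scale L) (scale H) pointwise_scale smash_cop"
  using smash_cop_invariant by (simp add: invariant_def)

lemma lin_comB: "lin ps_scale pointwise_scale comB"
  unfolding comB_def by (rule LH.lin_extend[OF bilin_smash_cop])

lemma comB_ps: "comB (ps x h) = smash_cop x h"
  unfolding comB_def by (rule extend_ps[OF smash_cop_invariant])

lemma copB_in: "(a, b) \<in> set (copB t) \<Longrightarrow> a \<in> carrier smash_space" "(a, b) \<in> set (copB t) \<Longrightarrow> b \<in> carrier smash_space"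
  using VBB.rep_props(1)[OF comB_in, of t] by (auto simp: copB_def)

lemma lin_copB [multilinear]:
  assumes "bilin ps_scale ps_scale t f" "lin s ps_scale g"
  shows "lin s t (\<lambda>x. lsum (copB (g x)) f)"
  using lin_compose[OF VBB.lin_rep[unfolded scale_smash_space, OF assms(1) lin_comB comB_in] assms(2)]
  by (simp add: copB_def)

lemma lsum_copB:
  assumes f: "bilin ps_scale ps_scale t f"
  shows "lsum (copB (ps x h)) f = lsum (L.cop x) (\<lambda>x1 x2. lsum (H.cop h) (\<lambda>h1 h2. lsum (ro h1) (\<lambda>p r.
     f (ps x1 p) (ps (x2 \<star> r) h2))))"
proof -
  have f': "bilin (scale smash_space) (scale smash_space) t f" using f by simp
  note l = VBB.lin_extend[OF f']
  have "lsum (copB (ps x h)) f = VBB.extend f (comB (ps x h))"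
    using comB_in by (simp add: VBB.extend_def copB_def vspace.proj_id[OF vspace_tensor_space])
  then show ?thesis
    by (simp add: comB_ps smash_cop_def lin_lsum_push[OF l] tenB_def VBB.extend_tensor[OF f'])
qed

definition epsB where "epsB t = LH.extend (\<lambda>x h. L.eps x * lam h) t"

lemma eps_lam_invariant: "invariant (*) (\<lambda>x h. L.eps x * lam h)"
proof -
  have "lsum (H.cop h) (\<lambda>a b. lam a * (L.eps x * lam b)) = L.eps x * lam h" for x h
    using scale_lsum[OF vector_space_field, of "L.eps x" "H.cop h" "\<lambda>a b. lam a * lam b"]
    by (simp add: lam_lam mult.left_commute)
  then show ?thesis by (auto simp: invariant_def intro!: multilinear lin_id vector_space_field)
qed

lemma epsB_ps [simp]: "epsB (ps x h) = L.eps x * lam h"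
  unfolding epsB_def by (rule extend_ps[OF eps_lam_invariant])

lemma lin_epsB [multilinear]: "lin s ps_scale f \<Longrightarrow> lin s (*) (\<lambda>x. epsB (f x))"
  unfolding epsB_def using eps_lam_invariant
  by (intro lin_compose[OF LH.lin_extend]) (simp add: invariant_def)

text \<open>
  Both sides equal
  \<open>x\<^sub>1 # h\<^sub>1\<^sup>0 \<otimes> x\<^sub>2 (h\<^sub>1\<^sup>1)\<^sub>1 # h\<^sub>2\<^sup>0 \<otimes> x\<^sub>3 (h\<^sub>1\<^sup>1)\<^sub>2 h\<^sub>2\<^sup>1 # h\<^sub>3\<close>. The extra factor \<open>\<l>\<close> that a partial
  coaction produces in \<open>ro_ro_\<l>\<close> is absorbed by the third tensor factor.
\<close>

lemma copB_coassoc_ps: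
  "lsum (copB (ps x h)) (\<lambda>a b. lsum (copB a) (\<lambda>a1 a2. ten3B a1 a2 b)) =
   lsum (copB (ps x h)) (\<lambda>a b. lsum (copB b) (\<lambda>b1 b2. ten3B a b1 b2))"
proof -
  note id = lin_id[OF vector_space_pointwise_scale]
  note ml = multilinear id
  let ?T = "\<lambda>y1 y2 x2 q s p2 r h2. ten3B (ps y1 q) (ps (y2 \<star> s) p2) (ps (x2 \<star> r) h2)"
  \<comment> \<open>The part of the calculation that concerns \<open>h\<close> only.\<close>
  have core: "lsum (H.cop h) (\<lambda>h1 h2. lsum (ro h1) (\<lambda>p r. lsum (H.cop p) (\<lambda>p1 p2. lsum (ro p1) (\<lambda>q s.
      ?T y1 y2 x2 q s p2 r h2)))) =
    lsum (H.cop h) (\<lambda>a h'. lsum (ro a) (\<lambda>q r. lsum (L.cop r) (\<lambda>u v. lsum (H.cop h') (\<lambda>b h2.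
      lsum (ro b) (\<lambda>p2 r2. ?T y1 y2 x2 q u p2 (v \<star> r2) h2)))))" for y1 y2 x2
  proof -
    have "lsum (H.cop h) (\<lambda>h1 h2. lsum (ro h1) (\<lambda>p r. lsum (H.cop p) (\<lambda>p1 p2. lsum (ro p1) (\<lambda>q s.
        ?T y1 y2 x2 q s p2 r h2)))) =
      lsum (H.cop h) (\<lambda>h1 h2. lsum (H.cop h1) (\<lambda>a b. lsum (ro a) (\<lambda>p1 r1. lsum (ro b) (\<lambda>p2 r2.
        lsum (ro p1) (\<lambda>q s. ?T y1 y2 x2 q s p2 (r1 \<star> r2) h2)))))"
      by (subst ro_cop[where t = pointwise_scale]) (intro ml | simp)+
    also have "\<dots> = lsum (H.cop h) (\<lambda>h1 h2. lsum (H.cop h1) (\<lambda>a b. lsum (ro a) (\<lambda>p1 r1.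
        lsum (ro p1) (\<lambda>q s. lsum (ro b) (\<lambda>p2 r2. ?T y1 y2 x2 q s p2 (r1 \<star> r2) h2)))))"
      by (intro lsum_cong refl lsum_swap)
    also have "\<dots> = lsum (H.cop h) (\<lambda>h1 h2. lsum (H.cop h1) (\<lambda>a b. lsum (ro a) (\<lambda>q r.
        lsum (L.cop r) (\<lambda>u v. lsum (ro b) (\<lambda>p2 r2. ?T y1 y2 x2 q u p2 (v \<star> \<l> \<star> r2) h2)))))"
      by (subst ro_ro_\<l>[where t = pointwise_scale]) (intro ml | simp)+
    also have "\<dots> = lsum (H.cop h) (\<lambda>h1 h2. lsum (H.cop h1) (\<lambda>a b. lsum (ro a) (\<lambda>q r.
        lsum (L.cop r) (\<lambda>u v. lsum (ro b) (\<lambda>p2 r2. ?T y1 y2 x2 q u p2 (v \<star> r2) h2)))))"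
      by (simp add: L.mul_assoc mul_\<l>_mul)
    also have "\<dots> = lsum (H.cop h) (\<lambda>a h'. lsum (H.cop h') (\<lambda>b h2. lsum (ro a) (\<lambda>q r.
        lsum (L.cop r) (\<lambda>u v. lsum (ro b) (\<lambda>p2 r2. ?T y1 y2 x2 q u p2 (v \<star> r2) h2)))))"
      by (subst H.cop_coassoc[where t = pointwise_scale]) (intro ml | simp)+
    also have "\<dots> = lsum (H.cop h) (\<lambda>a h'. lsum (ro a) (\<lambda>q r. lsum (L.cop r) (\<lambda>u v.
        lsum (H.cop h') (\<lambda>b h2. lsum (ro b) (\<lambda>p2 r2. ?T y1 y2 x2 q u p2 (v \<star> r2) h2)))))"
      by (simp only: lsum_swap[of "H.cop k" "ro a" for k a] lsum_swap[of "H.cop k" "L.cop r" for k r])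
    finally show ?thesis .
  qed
  have "lsum (copB (ps x h)) (\<lambda>a b. lsum (copB a) (\<lambda>a1 a2. ten3B a1 a2 b)) =
    lsum (L.cop x) (\<lambda>x1 x2. lsum (H.cop h) (\<lambda>h1 h2. lsum (ro h1) (\<lambda>p r.
      lsum (L.cop x1) (\<lambda>y1 y2. lsum (H.cop p) (\<lambda>p1 p2. lsum (ro p1) (\<lambda>q s.
        ?T y1 y2 x2 q s p2 r h2))))))"
    apply (subst lsum_copB[where t = pointwise_scale], (intro ml)[1])
    apply (subst lsum_copB[where t = pointwise_scale], (intro ml)[1])
    by (rule refl)
  also have "\<dots> = lsum (L.cop x) (\<lambda>x1 x2. lsum (L.cop x1) (\<lambda>y1 y2. lsum (H.cop h) (\<lambda>h1 h2.
      lsum (ro h1) (\<lambda>p r. lsum (H.cop p) (\<lambda>p1 p2. lsum (ro p1) (\<lambda>q s.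
        ?T y1 y2 x2 q s p2 r h2))))))"
    by (simp only: lsum_swap[of "ro a" "L.cop z" for a z] lsum_swap[of "H.cop k" "L.cop z" for k z])
  also have "\<dots> = lsum (L.cop x) (\<lambda>y1 x'. lsum (L.cop x') (\<lambda>y2 x2. lsum (H.cop h) (\<lambda>h1 h2.
      lsum (ro h1) (\<lambda>p r. lsum (H.cop p) (\<lambda>p1 p2. lsum (ro p1) (\<lambda>q s.
        ?T y1 y2 x2 q s p2 r h2))))))"
    by (rule L.cop_coassoc[where t = pointwise_scale]) (intro ml)
  also have "\<dots> = lsum (L.cop x) (\<lambda>y1 x'. lsum (L.cop x') (\<lambda>y2 x2. lsum (H.cop h) (\<lambda>a h'.
      lsum (ro a) (\<lambda>q r. lsum (L.cop r) (\<lambda>u v. lsum (H.cop h') (\<lambda>b h2.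
        lsum (ro b) (\<lambda>p2 r2. ?T y1 y2 x2 q u p2 (v \<star> r2) h2)))))))"
    by (simp only: core)
  also have "\<dots> = lsum (L.cop x) (\<lambda>y1 x'. lsum (H.cop h) (\<lambda>a h'.
      lsum (ro a) (\<lambda>q r. lsum (L.cop x') (\<lambda>y2 x2. lsum (L.cop r) (\<lambda>u v. lsum (H.cop h') (\<lambda>b h2.
        lsum (ro b) (\<lambda>p2 r2. ?T y1 y2 x2 q u p2 (v \<star> r2) h2)))))))"
    by (simp only: lsum_swap[of "ro a" "L.cop z" for a z] lsum_swap[of "H.cop k" "L.cop z" for k z])
  also have "\<dots> = lsum (L.cop x) (\<lambda>y1 x'. lsum (H.cop h) (\<lambda>a h'.
      lsum (ro a) (\<lambda>q r. lsum (L.cop (x' \<star> r)) (\<lambda>z1 z2. lsum (H.cop h') (\<lambda>b h2.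
        lsum (ro b) (\<lambda>p2 r2. ten3B (ps y1 q) (ps z1 p2) (ps (z2 \<star> r2) h2)))))))"
    by (subst L.cop_mul[where t = pointwise_scale]) (intro ml | simp add: L.mul_assoc)+
  also have "\<dots> = lsum (copB (ps x h)) (\<lambda>a b. lsum (copB b) (\<lambda>b1 b2. ten3B a b1 b2))"
    apply (subst lsum_copB[where t = pointwise_scale], (intro ml)[1])
    apply (subst lsum_copB[where t = pointwise_scale], (intro ml)[1])
    by (rule refl)
  finally show ?thesis .
qed

lemma copB_counit_ps:
  "lsum (copB (ps x h)) (\<lambda>a b. ps_scale (epsB a) b) = ps x h"
  "lsum (copB (ps x h)) (\<lambda>a b. ps_scale (epsB b) a) = ps x h"
proof -
  note vs = vector_space_pointwise_scale
  note ml = multilinear lin_id[OF vs]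
  have "lsum (copB (ps x h)) (\<lambda>a b. ps_scale (epsB a) b) =
    lsum (L.cop x) (\<lambda>x1 x2. ps_scale (L.eps x1) (lsum (H.cop h) (\<lambda>h1 h2. lsum (ro h1) (\<lambda>p r.
      ps_scale (lam p) (ps (x2 \<star> r) h2)))))"
    by (subst lsum_copB[where t = ps_scale])
      (intro ml | simp add: scale_lsum[OF vs] vector_space.vector_space_assms[OF vs])+
  also have "\<dots> = lsum (H.cop h) (\<lambda>h1 h2. lsum (ro h1) (\<lambda>p r. ps_scale (lam p) (ps (x \<star> r) h2)))"
    by (subst L.cop_counit(1)[where t = ps_scale]) (intro ml | simp)+
  also have "\<dots> = lsum (H.cop h) (\<lambda>h1 h2. lsum (ro h1) (\<lambda>p r. lsum (H.cop h2) (\<lambda>c d.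
      ps_scale (lam c) (ps_scale (lam p) (ps (x \<star> r) d)))))"
    by (subst ps_lam(1)[where t = ps_scale and f = "\<lambda>v. ps_scale k v" for k]) (intro ml | simp)+
  also have "\<dots> = lsum (H.cop h) (\<lambda>h1 h2. lsum (H.cop h2) (\<lambda>c d. lsum (ro h1) (\<lambda>p r.
      ps_scale (lam p * lam c) (ps (x \<star> r) d))))"
    by (subst (2) lsum_swap) (simp add: vector_space.vector_space_assms[OF vs] mult.commute)
  also have "\<dots> = lsum (H.cop h) (\<lambda>k d. lsum (H.cop k) (\<lambda>h1 c. lsum (ro h1) (\<lambda>p r.
      ps_scale (lam p * lam c) (ps (x \<star> r) d))))"
    by (rule H.cop_coassoc[where t = ps_scale, symmetric]) (intro ml)
  also have "\<dots> = lsum (H.cop h) (\<lambda>k d. ps_scale (lam k) (ps (x \<star> \<l>) d))"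
    by (subst ro_lam_lam[where t = ps_scale]) (intro ml | simp)+
  also have "\<dots> = ps x h"
    using ps_lam(1)[OF lin_id[OF vs]] by simp
  finally show "lsum (copB (ps x h)) (\<lambda>a b. ps_scale (epsB a) b) = ps x h" .
  have "lsum (copB (ps x h)) (\<lambda>a b. ps_scale (epsB b) a) =
    lsum (L.cop x) (\<lambda>x1 x2. ps_scale (L.eps x2) (lsum (H.cop h) (\<lambda>h1 h2. ps_scale (lam h2)
      (lsum (ro h1) (\<lambda>p r. ps_scale (L.eps r) (ps x1 p))))))"
    by (subst lsum_copB[where t = ps_scale])
      (intro ml | simp add: scale_lsum[OF vs] vector_space.vector_space_assms[OF vs] ac_simps)+
  also have "\<dots> = lsum (L.cop x) (\<lambda>x1 x2. ps_scale (L.eps x2) (lsum (H.cop h) (\<lambda>h1 h2.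
      ps_scale (lam h2) (ps x1 h1))))"
    by (subst ro_counit[where t = ps_scale]) (intro ml | simp)+
  also have "\<dots> = lsum (H.cop h) (\<lambda>h1 h2. ps_scale (lam h2) (ps x h1))"
    by (subst L.cop_counit(2)[where t = ps_scale]) (intro ml | simp)+
  also have "\<dots> = ps x h"
    using ps_lam(2)[OF lin_id[OF vs]] by simp
  finally show "lsum (copB (ps x h)) (\<lambda>a b. ps_scale (epsB b) a) = ps x h" .
qed

text \<open>
  On the left-hand side, the compatibility condition rewrites
  \<open>(h\<^sub>2 g\<^sub>1)\<^sup>0 \<otimes> (h\<^sub>1 \<rightharpoonup> y)\<^sub>1 \<otimes> (h\<^sub>1 \<rightharpoonup> y)\<^sub>2 (h\<^sub>2 g\<^sub>1)\<^sup>1\<close>. On the right-hand side, the comodule coalgebra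
  axiom splits \<open>\<Delta>(h\<^sub>1\<^sup>0)\<close>. The results differ in the order of \<open>h\<^sub>2 \<rightharpoonup> y\<^sub>2\<close> and the coaction factor next to
  it, which the quasi-abelian condition exchanges; this is \<open>core\<close>.
\<close>

lemma comB_mul_ps:
  "comB (ps x h \<diamondop> ps y g) =
   lsum (copB (ps x h)) (\<lambda>s1 s2. lsum (copB (ps y g)) (\<lambda>t1 t2. tenB (s1 \<diamondop> t1) (s2 \<diamondop> t2)))"
proof -
  note ml = multilinear lin_id[OF vector_space_pointwise_scale]
  let ?K = "\<lambda>x1 x2 y1 g2 g0 p q w d. tenB (ps (x1 \<star> (p \<rhd> y1)) (q \<bullet> g0)) (ps (x2 \<star> w) (d \<bullet> g2))"
  have core: "lsum (H.cop h) (\<lambda>h' d. lsum (H.cop h') (\<lambda>a s. lsum (H.cop s) (\<lambda>b s'.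
      lsum (H.cop s') (\<lambda>c e. lsum (ro a) (\<lambda>p r. lsum (ro c) (\<lambda>q r'.
        ?K x1 x2 y1 g2 g0 p q (r \<star> ((b \<rhd> y2) \<star> r') \<star> (e \<rhd> \<gamma>)) d)))))) =
    lsum (H.cop h) (\<lambda>h1 h2. lsum (ro h1) (\<lambda>p r. lsum (H.cop p) (\<lambda>p1 p2. lsum (H.cop h2) (\<lambda>c d.
        ?K x1 x2 y1 g2 g0 p1 p2 (r \<star> (c \<rhd> (y2 \<star> \<gamma>))) d))))" for x1 x2 y1 y2 g2 g0 \<gamma>
  proof -
    let ?Q = "?K x1 x2 y1 g2 g0"
    have "lsum (H.cop h) (\<lambda>h' d. lsum (H.cop h') (\<lambda>a s. lsum (H.cop s) (\<lambda>b s'.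
        lsum (H.cop s') (\<lambda>c e. lsum (ro a) (\<lambda>p r. lsum (ro c) (\<lambda>q r'.
          ?Q p q (r \<star> ((b \<rhd> y2) \<star> r') \<star> (e \<rhd> \<gamma>)) d)))))) =
      lsum (H.cop h) (\<lambda>h' d. lsum (H.cop h') (\<lambda>a s. lsum (H.cop s) (\<lambda>\<sigma> e.
        lsum (H.cop \<sigma>) (\<lambda>b c. lsum (ro a) (\<lambda>p r. lsum (ro c) (\<lambda>q r'.
          ?Q p q (r \<star> ((b \<rhd> y2) \<star> r') \<star> (e \<rhd> \<gamma>)) d))))))"
      by (intro lsum_cong refl H.cop_coassoc[where t = pointwise_scale, symmetric]) (intro ml)
    also have "\<dots> = lsum (H.cop h) (\<lambda>h' d. lsum (H.cop h') (\<lambda>a s. lsum (H.cop s) (\<lambda>\<sigma> e.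
        lsum (ro a) (\<lambda>p r. lsum (H.cop \<sigma>) (\<lambda>b c. lsum (ro c) (\<lambda>q r'.
          ?Q p q (r \<star> ((b \<rhd> y2) \<star> r') \<star> (e \<rhd> \<gamma>)) d))))))"
      by (intro lsum_cong refl lsum_swap)
    also have "\<dots> = lsum (H.cop h) (\<lambda>h' d. lsum (H.cop h') (\<lambda>a s. lsum (H.cop s) (\<lambda>\<sigma> e.
        lsum (ro a) (\<lambda>p r. lsum (H.cop \<sigma>) (\<lambda>b c. lsum (ro b) (\<lambda>q r'.
          ?Q p q (r \<star> (r' \<star> (c \<rhd> y2)) \<star> (e \<rhd> \<gamma>)) d))))))"
      by (intro lsum_cong refl quasi_abelian_lsum[where t = pointwise_scale]) (intro ml)
    also have "\<dots> = lsum (H.cop h) (\<lambda>h' d. lsum (H.cop h') (\<lambda>a s. lsum (ro a) (\<lambda>p r.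
        lsum (H.cop s) (\<lambda>\<sigma> e. lsum (H.cop \<sigma>) (\<lambda>b c. lsum (ro b) (\<lambda>q r'.
          ?Q p q (r \<star> (r' \<star> (c \<rhd> y2)) \<star> (e \<rhd> \<gamma>)) d))))))"
      by (intro lsum_cong refl lsum_swap)
    also have "\<dots> = lsum (H.cop h) (\<lambda>h' d. lsum (H.cop h') (\<lambda>a s. lsum (ro a) (\<lambda>p r.
        lsum (H.cop s) (\<lambda>b s'. lsum (H.cop s') (\<lambda>c e. lsum (ro b) (\<lambda>q r'.
          ?Q p q (r \<star> (r' \<star> (c \<rhd> y2)) \<star> (e \<rhd> \<gamma>)) d))))))"
      by (intro lsum_cong refl H.cop_coassoc[where t = pointwise_scale]) (intro ml)
    also have "\<dots> = lsum (H.cop h) (\<lambda>h' d. lsum (H.cop h') (\<lambda>a s. lsum (ro a) (\<lambda>p r.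
        lsum (H.cop s) (\<lambda>b s'. lsum (ro b) (\<lambda>q r'. lsum (H.cop s') (\<lambda>c e. 
          ?Q p q (r \<star> r' \<star> ((c \<rhd> y2) \<star> (e \<rhd> \<gamma>))) d))))))"
      unfolding L.mul_assoc by (intro lsum_cong refl lsum_swap)
    also have "\<dots> = lsum (H.cop h) (\<lambda>h' d. lsum (H.cop h') (\<lambda>a s. lsum (ro a) (\<lambda>p r.
        lsum (H.cop s) (\<lambda>b c. lsum (ro b) (\<lambda>q r'.
          ?Q p q (r \<star> r' \<star> (c \<rhd> (y2 \<star> \<gamma>))) d)))))"
      by (simp only: act_mul L.lsum_mul lsum_ps
          lin_lsum_push[OF lin_tenB(2)[OF lin_id[OF vector_space_pointwise_scale]]])
    also have "\<dots> = lsum (H.cop h) (\<lambda>h' d. lsum (H.cop h') (\<lambda>a s. lsum (H.cop s) (\<lambda>b c.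
        lsum (ro a) (\<lambda>p r. lsum (ro b) (\<lambda>q r'.
          ?Q p q (r \<star> r' \<star> (c \<rhd> (y2 \<star> \<gamma>))) d)))))"
      by (intro lsum_cong refl lsum_swap)
    also have "\<dots> = lsum (H.cop h) (\<lambda>h' d. lsum (H.cop h') (\<lambda>h1 c. lsum (H.cop h1) (\<lambda>a b.
        lsum (ro a) (\<lambda>p r. lsum (ro b) (\<lambda>q r'.
          ?Q p q (r \<star> r' \<star> (c \<rhd> (y2 \<star> \<gamma>))) d)))))"
      by (intro lsum_cong refl H.cop_coassoc[where t = pointwise_scale, symmetric]) (intro ml)
    also have "\<dots> = lsum (H.cop h) (\<lambda>h' d. lsum (H.cop h') (\<lambda>h1 c. lsum (ro h1) (\<lambda>p r.
        lsum (H.cop p) (\<lambda>p1 p2. ?Q p1 p2 (r \<star> (c \<rhd> (y2 \<star> \<gamma>))) d))))"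
      by (intro lsum_cong refl ro_cop[where t = pointwise_scale, symmetric]) (intro ml)
    also have "\<dots> = lsum (H.cop h) (\<lambda>h1 h2. lsum (H.cop h2) (\<lambda>c d. lsum (ro h1) (\<lambda>p r.
        lsum (H.cop p) (\<lambda>p1 p2. ?Q p1 p2 (r \<star> (c \<rhd> (y2 \<star> \<gamma>))) d))))"
      by (rule H.cop_coassoc[where t = pointwise_scale]) (intro ml)
    also have "\<dots> = lsum (H.cop h) (\<lambda>h1 h2. lsum (ro h1) (\<lambda>p r. lsum (H.cop h2) (\<lambda>c d. 
        lsum (H.cop p) (\<lambda>p1 p2. ?Q p1 p2 (r \<star> (c \<rhd> (y2 \<star> \<gamma>))) d))))"
      by (intro lsum_cong refl lsum_swap)
    also have "\<dots> = lsum (H.cop h) (\<lambda>h1 h2. lsum (ro h1) (\<lambda>p r. lsum (H.cop p) (\<lambda>p1 p2.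
        lsum (H.cop h2) (\<lambda>c d. ?Q p1 p2 (r \<star> (c \<rhd> (y2 \<star> \<gamma>))) d))))"
      by (intro lsum_cong refl lsum_swap)
    finally show ?thesis .
  qed
  have inner: "lsum (H.cop h) (\<lambda>h' d. lsum (H.cop h') (\<lambda>a s. lsum (H.cop s) (\<lambda>b s'. lsum (H.cop s') (\<lambda>c e.
      lsum (L.cop y) (\<lambda>y1 y2. lsum (ro a) (\<lambda>p r. lsum (ro c) (\<lambda>q r'. lsum (ro g1) (\<lambda>g0 \<gamma>.
        ?K x1 x2 y1 g2 g0 p q (r \<star> (b \<rhd> y2) \<star> r' \<star> (e \<rhd> \<gamma>)) d)))))))) =
    lsum (L.cop y) (\<lambda>y1 y2. lsum (ro g1) (\<lambda>g0 \<gamma>.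
      lsum (H.cop h) (\<lambda>h' d. lsum (H.cop h') (\<lambda>a s. lsum (H.cop s) (\<lambda>b s'. lsum (H.cop s') (\<lambda>c e.
        lsum (ro a) (\<lambda>p r. lsum (ro c) (\<lambda>q r'.
          ?K x1 x2 y1 g2 g0 p q (r \<star> ((b \<rhd> y2) \<star> r') \<star> (e \<rhd> \<gamma>)) d))))))))" for x1 x2 g1 g2
    by (simp only: L.mul_assoc lsum_swap[of "H.cop k" "L.cop y" for k]
        lsum_swap[of "ro k" "ro g1" for k] lsum_swap[of "H.cop k" "ro g1" for k])
  \<comment> \<open>Exchanges of independent sums; \<open>D\<close> is \<open>H.cop h\<close> here and \<open>ro h\<^sub>1\<close> below.\<close>
  have rotate1: "lsum A (\<lambda>a b. lsum E (\<lambda>c d. lsum (C a) (\<lambda>e f. lsum D (\<lambda>p r. F a b c d e f p r)))) =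
      lsum D (\<lambda>p r. lsum A (\<lambda>a b. lsum E (\<lambda>c d. lsum (C a) (\<lambda>e f. F a b c d e f p r))))"
    for A :: "('h \<times> 'h) list" and E :: "('l \<times> 'l) list" and C :: "'h \<Rightarrow> ('h \<times> 'l) list"
      and D :: "('h \<times> 'h) list"
      and F :: "_ \<Rightarrow> _ \<Rightarrow> _ \<Rightarrow> _ \<Rightarrow> _ \<Rightarrow> _ \<Rightarrow> _ \<Rightarrow> _ \<Rightarrow>
        (_ \<Rightarrow> _ \<Rightarrow> 'k) \<Rightarrow> 'k"
    by (simp only: lsum_swap[of "C k" D for k] lsum_swap[of E D] lsum_swap[of A D])
  have rotate2: "lsum A (\<lambda>a b. lsum E (\<lambda>c d. lsum (C a) (\<lambda>e f. lsum D (\<lambda>p r. F a b c d e f p r)))) =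
      lsum D (\<lambda>p r. lsum A (\<lambda>a b. lsum E (\<lambda>c d. lsum (C a) (\<lambda>e f. F a b c d e f p r))))"
    for A :: "('h \<times> 'h) list" and E :: "('l \<times> 'l) list" and C :: "'h \<Rightarrow> ('h \<times> 'l) list"
      and D :: "('h \<times> 'l) list"
      and F :: "_ \<Rightarrow> _ \<Rightarrow> _ \<Rightarrow> _ \<Rightarrow> _ \<Rightarrow> _ \<Rightarrow> _ \<Rightarrow> _ \<Rightarrow>
        (_ \<Rightarrow> _ \<Rightarrow> 'k) \<Rightarrow> 'k"
    by (simp only: lsum_swap[of "C k" D for k] lsum_swap[of E D] lsum_swap[of A D])
  have "comB (ps x h \<diamondop> ps y g) = lsum (H.cop h) (\<lambda>h1 h2. smash_cop (x \<star> (h1 \<rhd> y)) (h2 \<bullet> g))"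
    by (simp add: ps_mulB lin_lsum_push[OF lin_comB] comB_ps)
  also have "\<dots> = lsum (H.cop h) (\<lambda>h1 h2. lsum (L.cop x) (\<lambda>x1 x2. lsum (L.cop (h1 \<rhd> y)) (\<lambda>u v.
      lsum (H.cop (h2 \<bullet> g)) (\<lambda>k k'. lsum (ro k) (\<lambda>k0 k1.
        tenB (ps (x1 \<star> u) k0) (ps (x2 \<star> (v \<star> k1)) k'))))))"
    unfolding smash_cop_def
    by (subst L.cop_mul[where t = pointwise_scale]) (intro ml | simp add: L.mul_assoc)+
  also have "\<dots> = lsum (H.cop h) (\<lambda>h1 h2. lsum (L.cop x) (\<lambda>x1 x2. lsum (L.cop (h1 \<rhd> y)) (\<lambda>u v.
      lsum (H.cop h2) (\<lambda>c d. lsum (H.cop g) (\<lambda>g1 g2. lsum (ro (c \<bullet> g1)) (\<lambda>k0 k1.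
        tenB (ps (x1 \<star> u) k0) (ps (x2 \<star> (v \<star> k1)) (d \<bullet> g2))))))))"
    by (intro lsum_cong refl H.cop_mul[where t = pointwise_scale]) (intro ml)
  also have "\<dots> = lsum (L.cop x) (\<lambda>x1 x2. lsum (H.cop h) (\<lambda>h1 h2. lsum (H.cop h2) (\<lambda>c d.
      lsum (L.cop (h1 \<rhd> y)) (\<lambda>u v. lsum (H.cop g) (\<lambda>g1 g2. lsum (ro (c \<bullet> g1)) (\<lambda>k0 k1.
        tenB (ps (x1 \<star> u) k0) (ps (x2 \<star> (v \<star> k1)) (d \<bullet> g2))))))))"
    by (subst lsum_swap) (intro lsum_cong refl lsum_swap)
  also have "\<dots> = lsum (L.cop x) (\<lambda>x1 x2. lsum (H.cop h) (\<lambda>h' d. lsum (H.cop h') (\<lambda>h1 c.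
      lsum (L.cop (h1 \<rhd> y)) (\<lambda>u v. lsum (H.cop g) (\<lambda>g1 g2. lsum (ro (c \<bullet> g1)) (\<lambda>k0 k1.
        tenB (ps (x1 \<star> u) k0) (ps (x2 \<star> (v \<star> k1)) (d \<bullet> g2))))))))"
    by (intro lsum_cong refl H.cop_coassoc[where t = pointwise_scale, symmetric]) (intro ml)
  also have "\<dots> = lsum (L.cop x) (\<lambda>x1 x2. lsum (H.cop g) (\<lambda>g1 g2. lsum (H.cop h) (\<lambda>h' d.
      lsum (H.cop h') (\<lambda>h1 c. lsum (ro (c \<bullet> g1)) (\<lambda>k0 k1. lsum (L.cop (h1 \<rhd> y)) (\<lambda>u v.
        tenB (ps (x1 \<star> u) k0) (ps (x2 \<star> (v \<star> k1)) (d \<bullet> g2))))))))"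
    by (simp only: lsum_swap[of "L.cop z" "H.cop g" for z] lsum_swap[of "H.cop k" "H.cop g" for k]
        lsum_swap[of "L.cop z" "ro k" for z k])
  also have "\<dots> = lsum (L.cop x) (\<lambda>x1 x2. lsum (H.cop g) (\<lambda>g1 g2. lsum (H.cop h) (\<lambda>h' d.
      lsum (H.cop h') (\<lambda>a s. lsum (H.cop s) (\<lambda>b s'. lsum (H.cop s') (\<lambda>c e.
        lsum (L.cop y) (\<lambda>y1 y2. lsum (ro a) (\<lambda>p r. lsum (ro c) (\<lambda>q r'. lsum (ro g1) (\<lambda>g0 \<gamma>.
          ?K x1 x2 y1 g2 g0 p q (r \<star> (b \<rhd> y2) \<star> r' \<star> (e \<rhd> \<gamma>)) d))))))))))"
    by (intro lsum_cong refl compatibility_lsum[where t = pointwise_scale]) (intro ml)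
  also have "\<dots> = lsum (L.cop x) (\<lambda>x1 x2. lsum (H.cop g) (\<lambda>g1 g2. lsum (L.cop y) (\<lambda>y1 y2.
      lsum (ro g1) (\<lambda>g0 \<gamma>. lsum (H.cop h) (\<lambda>h' d. lsum (H.cop h') (\<lambda>a s. lsum (H.cop s) (\<lambda>b s'.
        lsum (H.cop s') (\<lambda>c e. lsum (ro a) (\<lambda>p r. lsum (ro c) (\<lambda>q r'.
          ?K x1 x2 y1 g2 g0 p q (r \<star> ((b \<rhd> y2) \<star> r') \<star> (e \<rhd> \<gamma>)) d))))))))))"
    by (intro lsum_cong refl inner)
  also have "\<dots> = lsum (L.cop x) (\<lambda>x1 x2. lsum (H.cop g) (\<lambda>g1 g2. lsum (L.cop y) (\<lambda>y1 y2.
      lsum (ro g1) (\<lambda>g0 \<gamma>. lsum (H.cop h) (\<lambda>h1 h2. lsum (ro h1) (\<lambda>p r. lsum (H.cop p) (\<lambda>p1 p2.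
        lsum (H.cop h2) (\<lambda>c d. ?K x1 x2 y1 g2 g0 p1 p2 (r \<star> (c \<rhd> (y2 \<star> \<gamma>))) d))))))))"
    by (simp only: core)
  also have "\<dots> = lsum (L.cop x) (\<lambda>x1 x2. lsum (H.cop h) (\<lambda>h1 h2. lsum (H.cop g) (\<lambda>g1 g2.
      lsum (L.cop y) (\<lambda>y1 y2. lsum (ro g1) (\<lambda>g0 \<gamma>. lsum (ro h1) (\<lambda>p r.
        lsum (H.cop p) (\<lambda>p1 p2. lsum (H.cop h2) (\<lambda>c d.
          ?K x1 x2 y1 g2 g0 p1 p2 (r \<star> (c \<rhd> (y2 \<star> \<gamma>))) d))))))))"
    by (intro lsum_cong refl rotate1)
  also have "\<dots> = lsum (L.cop x) (\<lambda>x1 x2. lsum (H.cop h) (\<lambda>h1 h2. lsum (ro h1) (\<lambda>p r.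
      lsum (H.cop g) (\<lambda>g1 g2. lsum (L.cop y) (\<lambda>y1 y2. lsum (ro g1) (\<lambda>g0 \<gamma>.
        lsum (H.cop p) (\<lambda>p1 p2. lsum (H.cop h2) (\<lambda>c d.
          ?K x1 x2 y1 g2 g0 p1 p2 (r \<star> (c \<rhd> (y2 \<star> \<gamma>))) d))))))))"
    by (intro lsum_cong refl rotate2)
  also have "\<dots> = lsum (L.cop x) (\<lambda>x1 x2. lsum (H.cop h) (\<lambda>h1 h2. lsum (ro h1) (\<lambda>p r.
      lsum (L.cop y) (\<lambda>y1 y2. lsum (H.cop g) (\<lambda>g1 g2. lsum (ro g1) (\<lambda>g0 \<gamma>.
        lsum (H.cop p) (\<lambda>p1 p2. lsum (H.cop h2) (\<lambda>c d.
          ?K x1 x2 y1 g2 g0 p1 p2 (r \<star> (c \<rhd> (y2 \<star> \<gamma>))) d))))))))"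
    by (intro lsum_cong refl lsum_swap)
  also have "\<dots> = lsum (L.cop x) (\<lambda>x1 x2. lsum (H.cop h) (\<lambda>h1 h2. lsum (ro h1) (\<lambda>p r.
      lsum (L.cop y) (\<lambda>y1 y2. lsum (H.cop g) (\<lambda>g1 g2. lsum (ro g1) (\<lambda>g0 \<gamma>.
        tenB (ps x1 p \<diamondop> ps y1 g0) (ps (x2 \<star> r) h2 \<diamondop> ps (y2 \<star> \<gamma>) g2)))))))"
    by (simp only: ps_mulB lin_lsum_push[OF lin_tenB(1)[OF lin_id[OF vector_space_pointwise_scale]]])
      (simp only: lin_lsum_push[OF lin_tenB(2)[OF lin_id[OF vector_space_pointwise_scale]]] L.mul_assoc)
  also have "\<dots> = lsum (copB (ps x h)) (\<lambda>s1 s2. lsum (copB (ps y g)) (\<lambda>t1 t2. tenB (s1 \<diamondop> t1) (s2 \<diamondop> t2)))"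
    apply (subst lsum_copB[where t = pointwise_scale], (intro ml)[1])
    apply (subst lsum_copB[where t = pointwise_scale], (intro ml)[1])
    by (rule refl)
  finally show ?thesis .
qed

definition B where
  "B = \<lparr>carrier = carrier smash_space, scale = pointwise_scale, mult = (\<diamondop>), one = ps \<one>\<^bsub>L\<^esub> \<one>\<^bsub>H\<^esub>,
     comult = comB, counit = epsB\<rparr>"

lemma B_simps [simp]:
  "carrier B = carrier smash_space" "scale B = pointwise_scale" "mult B = (\<diamondop>)" "one B = ps \<one>\<^bsub>L\<^esub> \<one>\<^bsub>H\<^esub>"
  "comult B = comB" "counit B = epsB"
  by (simp_all add: B_def)

lemma tensor_B: "tensor B B = tensor smash_space smash_space" "tensor_space B B = tensor_space smash_space smash_space"
  "tensor3 B B B = tensor3 smash_space smash_space smash_space"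
proof -
  have left: "tensor B W = tensor smash_space W" for W :: "('k, 'z::plus, 'y) vspace_scheme"
    by (simp add: tensor_def[abs_def] bilinear_on_def linear_on_def)
  show 1: "tensor B B = tensor smash_space smash_space"
    by (simp add: tensor_def[abs_def] bilinear_on_def linear_on_def)
  then show 2: "tensor_space B B = tensor_space smash_space smash_space" by (simp add: tensor_space_def)
  show "tensor3 B B B = tensor3 smash_space smash_space smash_space"
    unfolding tensor3_def[abs_def] 1 2 unfolding left ..
qed

lemma sweedler_B: "sweedler B t f = lsum (copB t) f"
  by (simp add: sweedler_def tensor_sum_lsum copB_def rep_def tensor_B)

lemma tenB_eq: "s \<in> carrier smash_space \<Longrightarrow> t \<in> carrier smash_space \<Longrightarrow> tensor smash_space smash_space s t = tenB s t"
  by (simp add: tenB_def VB.proj_id)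

lemma ten3B_eq: "r \<in> carrier smash_space \<Longrightarrow> s \<in> carrier smash_space \<Longrightarrow> t \<in> carrier smash_space \<Longrightarrow>
    tensor3 smash_space smash_space smash_space r s t = ten3B r s t"
  by (simp add: ten3B_def VB.proj_id)

lemma algebra_B: "algebra B"
proof -
  note ml = multilinear lin_id[OF vector_space_pointwise_scale]
  have "vspace B"
    using VB.vspace_axioms by (simp add: vspace_def)
  moreover have "bilinear_on B B B (mult B)"
  proof -
    have "lin ps_scale ps_scale (\<lambda>s. s \<diamondop> t)" "lin ps_scale ps_scale (\<lambda>s. t \<diamondop> s)" for t
      by (intro ml)+
    then show ?thesis by (simp add: bilinear_on_def linear_on_def lin_iff)
  qed
  moreover have "r \<diamondop> s \<diamondop> t = r \<diamondop> (s \<diamondop> t)"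
    if "r \<in> carrier smash_space" "s \<in> carrier smash_space" "t \<in> carrier smash_space" for r s t
  proof -
    have "r \<diamondop> ps y g \<diamondop> ps z k = r \<diamondop> (ps y g \<diamondop> ps z k)" for y g z k
      by (rule eq_on_smash_space[OF _ _ _ that(1), where t = ps_scale]) (intro ml ps_mul_assoc)+
    then have "r \<diamondop> s \<diamondop> ps z k = r \<diamondop> (s \<diamondop> ps z k)" for z k
      by (intro eq_on_smash_space[OF _ _ _ that(2), where t = ps_scale and F = "\<lambda>s. r \<diamondop> s \<diamondop> ps z k"]) (intro ml | simp)+
    then show ?thesis
      by (intro eq_on_smash_space[OF _ _ _ that(3), where t = ps_scale and F = "\<lambda>t. r \<diamondop> s \<diamondop> t"]) (intro ml | simp)+
  qed
  moreover have "t \<diamondop> ps \<one>\<^bsub>L\<^esub> \<one>\<^bsub>H\<^esub> = t" "ps \<one>\<^bsub>L\<^esub> \<one>\<^bsub>H\<^esub> \<diamondop> t = t" if "t \<in> carrier smash_space" for t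
    by (rule eq_on_smash_space[OF _ _ _ that, where t = ps_scale]; (intro ml ps_mul_one ps_one_mul)?)+
  ultimately show ?thesis by (simp add: algebra_def algebra_axioms_def)
qed

lemma coalgebra_B: "coalgebra B"
proof -
  note vs = vector_space_pointwise_scale
  note ml = multilinear lin_id[OF vs]
  have "vspace B"
    using VB.vspace_axioms by (simp add: vspace_def)
  moreover have "linear_on B (tensor_space B B) (comult B)"
    using lin_comB comB_in by (simp add: linear_on_def lin_iff tensor_B) (simp add: tensor_space_def)
  moreover have "linear_on B base_field (counit B)"
  proof -
    have "lin ps_scale (*) epsB" using lin_epsB[OF lin_id[OF vs]] .
    then show ?thesis by (simp add: linear_on_def lin_iff base_field_def)
  qed
  moreover have "sweedler B c (\<lambda>a b. sweedler B a (\<lambda>a1 a2. tensor3 B B B a1 a2 b)) =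
      sweedler B c (\<lambda>a b. sweedler B b (\<lambda>b1 b2. tensor3 B B B a b1 b2))" if "c \<in> carrier smash_space" for c
  proof -
    have "lsum (copB c) (\<lambda>a b. lsum (copB a) (\<lambda>a1 a2. ten3B a1 a2 b)) =
      lsum (copB c) (\<lambda>a b. lsum (copB b) (\<lambda>b1 b2. ten3B a b1 b2))"
      by (rule eq_on_smash_space[OF _ _ _ that, where t = pointwise_scale
            and F = "\<lambda>c. lsum (copB c) (\<lambda>a b. lsum (copB a) (\<lambda>a1 a2. ten3B a1 a2 b))"
            and G = "\<lambda>c. lsum (copB c) (\<lambda>a b. lsum (copB b) (\<lambda>b1 b2. ten3B a b1 b2))"])
        (intro ml copB_coassoc_ps)+
    then show ?thesis
      by (simp add: sweedler_B tensor_B ten3B_eq copB_in cong: lsum_cong)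
  qed
  moreover have "sweedler B c (\<lambda>a b. epsB a \<odot>\<^bsub>B\<^esub> b) = c" if "c \<in> carrier smash_space" for c
    unfolding sweedler_B B_simps
    by (rule eq_on_smash_space[OF _ _ _ that, where t = ps_scale and F = "\<lambda>c. lsum (copB c) (\<lambda>a b. ps_scale (epsB a) b)" and G = "\<lambda>c. c"])
      (intro ml copB_counit_ps)+
  moreover have "sweedler B c (\<lambda>a b. epsB b \<odot>\<^bsub>B\<^esub> a) = c" if "c \<in> carrier smash_space" for c
    unfolding sweedler_B B_simps
    by (rule eq_on_smash_space[OF _ _ _ that, where t = ps_scale and F = "\<lambda>c. lsum (copB c) (\<lambda>a b. ps_scale (epsB b) a)" and G = "\<lambda>c. c"])
      (intro ml copB_counit_ps)+
  ultimately show ?thesis by (simp add: coalgebra_def coalgebra_axioms_def)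
qed

lemma bialgebra_B: "bialgebra B"
proof -
  note vs = vector_space_pointwise_scale
  note ml = multilinear lin_id[OF vs]
  have lin_com: "lin s ps_scale f \<Longrightarrow> lin s pointwise_scale (\<lambda>x. comB (f x))" for s f
    by (rule lin_compose[OF lin_comB])
  have "comB (s \<diamondop> t) = sweedler B s (\<lambda>s1 s2. sweedler B t (\<lambda>t1 t2. tensor B B (s1 \<diamondop> t1) (s2 \<diamondop> t2)))"
    if "s \<in> carrier smash_space" "t \<in> carrier smash_space" for s t
  proof -
    have "comB (s \<diamondop> ps y g) =
      lsum (copB s) (\<lambda>s1 s2. lsum (copB (ps y g)) (\<lambda>t1 t2. tenB (s1 \<diamondop> t1) (s2 \<diamondop> t2)))" for y g
      by (rule eq_on_smash_space[OF _ _ _ that(1), where t = pointwise_scale and F = "\<lambda>s. comB (s \<diamondop> ps y g)"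
            and G = "\<lambda>s. lsum (copB s) (\<lambda>s1 s2. lsum (copB (ps y g)) (\<lambda>t1 t2. tenB (s1 \<diamondop> t1) (s2 \<diamondop> t2)))"])
        (intro ml lin_com comB_mul_ps)+
    then have "comB (s \<diamondop> t) =
      lsum (copB s) (\<lambda>s1 s2. lsum (copB t) (\<lambda>t1 t2. tenB (s1 \<diamondop> t1) (s2 \<diamondop> t2)))"
      by (intro eq_on_smash_space[OF _ _ _ that(2), where t = pointwise_scale and F = "\<lambda>t. comB (s \<diamondop> t)"
            and G = "\<lambda>t. lsum (copB s) (\<lambda>s1 s2. lsum (copB t) (\<lambda>t1 t2. tenB (s1 \<diamondop> t1) (s2 \<diamondop> t2)))"])
        (intro ml lin_com | simp)+
    then show ?thesis by (simp add: sweedler_B tensor_B tenB_eq)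
  qed
  moreover have "comB (ps \<one>\<^bsub>L\<^esub> \<one>\<^bsub>H\<^esub>) = tensor B B (ps \<one>\<^bsub>L\<^esub> \<one>\<^bsub>H\<^esub>) (ps \<one>\<^bsub>L\<^esub> \<one>\<^bsub>H\<^esub>)"
  proof -
    have "comB (ps \<one>\<^bsub>L\<^esub> \<one>\<^bsub>H\<^esub>) = lsum (H.cop \<one>\<^bsub>H\<^esub>) (\<lambda>h1 h2. lsum (ro h1) (\<lambda>p r.
        tenB (ps \<one>\<^bsub>L\<^esub> p) (ps (\<one>\<^bsub>L\<^esub> \<star> r) h2)))"
      unfolding comB_ps smash_cop_def
      by (subst L.cop_one[where t = pointwise_scale]) (intro ml refl)+
    also have "\<dots> = lsum (ro \<one>\<^bsub>H\<^esub>) (\<lambda>p r. tenB (ps \<one>\<^bsub>L\<^esub> p) (ps (\<one>\<^bsub>L\<^esub> \<star> r) \<one>\<^bsub>H\<^esub>))"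
      by (rule H.cop_one[where t = pointwise_scale]) (intro ml)
    also have "\<dots> = tenB (ps \<one>\<^bsub>L\<^esub> \<one>\<^bsub>H\<^esub>) (ps (\<one>\<^bsub>L\<^esub> \<star> \<l>) \<one>\<^bsub>H\<^esub>)"
      by (rule ro_one[where t = pointwise_scale]) (intro ml)
    finally show ?thesis by (simp add: tensor_B tenB_eq)
  qed
  moreover have "epsB (s \<diamondop> t) = epsB s * epsB t" if "s \<in> carrier smash_space" "t \<in> carrier smash_space" for s t
  proof -
    have "epsB (ps x h \<diamondop> ps y g) = epsB (ps x h) * epsB (ps y g)" for x h y g
    proof -
      have "epsB (ps x h \<diamondop> ps y g) = lsum (H.cop h) (\<lambda>a b. (L.eps x * L.eps y) * (lam a * lam (b \<bullet> g)))"
        by (simp add: ps_mulB lin_lsum_push[OF lin_epsB[OF lin_id[OF vs]]] eps_act ac_simps)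
      also have "\<dots> = (L.eps x * L.eps y) * (lam h * lam g)"
        by (simp only: scale_lsum[OF vector_space_field, symmetric] lam_mul)
      finally show ?thesis by simp
    qed
    then have "epsB (s \<diamondop> ps y g) = epsB s * epsB (ps y g)" for y g
      by (intro eq_on_smash_space[OF _ _ _ that(1), where t = "(*)" and F = "\<lambda>s. epsB (s \<diamondop> ps y g)"]) (intro ml | simp only:)+
    then show ?thesis
      by (intro eq_on_smash_space[OF _ _ _ that(2), where t = "(*)" and F = "\<lambda>t. epsB (s \<diamondop> t)"]) (intro ml | simp only:)+
  qed
  ultimately show ?thesis
    using algebra_B coalgebra_B by (simp add: bialgebra_def bialgebra_axioms_def)
qed

section \<open>The antipode\<close>

definition smash_ant where
  "smash_ant x h = lsum (ro h) (\<lambda>p r. ps \<one>\<^bsub>L\<^esub> (H.ant p) \<diamondop> ps (L.ant r \<star> L.ant x) \<one>\<^bsub>H\<^esub>)"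

text \<open>
  For invariance in \<open>h\<close>, insert \<open>\<lambda>\<close> before \<open>S(h\<^sup>0)\<close>. Since \<open>\<lambda> \<circ> S = \<lambda>\<close> and \<open>S\<close> reverses the coproduct, it
  appears as \<open>\<lambda>((h\<^sup>0)\<^sub>1)\<close>. The comodule coalgebra axiom turns it into \<open>\<lambda>(h\<^sub>1\<^sup>0)\<close> next to
  \<open>S(h\<^sub>1\<^sup>1 h\<^sub>2\<^sup>1) = S(h\<^sub>2\<^sup>1) S(h\<^sub>1\<^sup>1)\<close>, and \<open>ro_ant\<close> gives \<open>\<lambda>(h\<^sub>1) \<l>\<close>.
\<close>

lemma smash_ant_invariant: "invariant ps_scale smash_ant"
proof -
  note vs = vector_space_pointwise_scale
  note ml = multilinear lin_id[OF vs]
  have "smash_ant (x \<star> \<l>) h = smash_ant x h" for x h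
    by (simp add: smash_ant_def L.ant_mul ant_\<l>)
  moreover have "lsum (H.cop h) (\<lambda>a b. ps_scale (lam a) (smash_ant x b)) = smash_ant x h" for x h
  proof -
    let ?M = "\<lambda>q z. ps \<one>\<^bsub>L\<^esub> (H.ant q) \<diamondop> ps (z \<star> L.ant x) \<one>\<^bsub>H\<^esub>"
    have "smash_ant x h = lsum (ro h) (\<lambda>p r. lsum (H.cop (H.ant p)) (\<lambda>u v.
        ps_scale (lam v) (ps \<one>\<^bsub>L\<^esub> u \<diamondop> ps (L.ant r \<star> L.ant x) \<one>\<^bsub>H\<^esub>)))"
      unfolding smash_ant_def
      by (intro lsum_cong refl ps_lam(2)[where t = ps_scale, symmetric]) (intro ml)
    also have "\<dots> = lsum (ro h) (\<lambda>p r. lsum (H.cop p) (\<lambda>c d. ps_scale (lam c) (?M d (L.ant r))))"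
      by (subst H.ant_cop[where t = ps_scale]) (intro ml | simp add: lam_ant)+
    also have "\<dots> = lsum (H.cop h) (\<lambda>a b. lsum (ro a) (\<lambda>p r. lsum (ro b) (\<lambda>q s.
        ps_scale (lam p) (?M q (L.ant (r \<star> s))))))"
      by (rule ro_cop[where t = ps_scale]) (intro ml)
    also have "\<dots> = lsum (H.cop h) (\<lambda>a b. lsum (ro b) (\<lambda>q s. lsum (ro a) (\<lambda>p r.
        ps_scale (lam p) (?M q (L.ant s \<star> L.ant r)))))"
      by (subst (2) lsum_swap) (simp add: L.ant_mul)
    also have "\<dots> = lsum (H.cop h) (\<lambda>a b. lsum (ro b) (\<lambda>q s. ps_scale (lam a) (?M q (L.ant s \<star> \<l>))))"
      by (intro lsum_cong refl ro_ant[where t = ps_scale]) (intro ml)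
    also have "\<dots> = lsum (H.cop h) (\<lambda>a b. ps_scale (lam a) (smash_ant x b))"
      by (simp add: smash_ant_def scale_lsum[OF vs])
    finally show ?thesis by simp
  qed
  ultimately show ?thesis
    unfolding invariant_def by (auto simp: smash_ant_def[abs_def] intro!: ml)
qed

definition antB where "antB t = LH.extend smash_ant t"

lemma antB_ps: "antB (ps x h) = smash_ant x h"
  unfolding antB_def by (rule extend_ps[OF smash_ant_invariant])

lemma lin_antB [multilinear]: "lin s ps_scale f \<Longrightarrow> lin s ps_scale (\<lambda>x. antB (f x))"
  unfolding antB_def using smash_ant_invariant
  by (intro lin_compose[OF LH.lin_extend]) (simp add: invariant_def)

lemma antB_in: "antB t \<in> carrier smash_space"
  unfolding antB_def smash_ant_def by (intro extend_in lsum_in VB.vspace_axioms mulB_in)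

lemma ps_unit_mul: "ps y \<one>\<^bsub>H\<^esub> \<diamondop> ps z k = ps (y \<star> z) k"
  unfolding ps_mulB by (subst H.cop_one[where t = ps_scale]) (intro multilinear | simp)+

lemma lsum_mulB: "lsum r f \<diamondop> t = lsum r (\<lambda>a b. f a b \<diamondop> t)" "t \<diamondop> lsum r f = lsum r (\<lambda>a b. t \<diamondop> f a b)"
  by (rule lin_lsum_push[OF lin_mulB(1)[OF lin_id[OF vector_space_pointwise_scale]]]
    lin_lsum_push[OF lin_mulB(2)[OF lin_id[OF vector_space_pointwise_scale]]])+

text \<open>
  The product is \<open>\<lambda>(S(h\<^sub>2)) (1 # S(h\<^sub>1) h\<^sub>3)\<close>. As \<open>\<lambda> \<circ> S = \<lambda>\<close> is central, \<open>\<lambda>\<close> moves out and \<open>S(h\<^sub>1) h\<^sub>2\<close>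
  collapses.
\<close>

lemma cop_ps_ant_left:
  "lsum (H.cop h) (\<lambda>a b. ps \<one>\<^bsub>L\<^esub> (H.ant a) \<diamondop> ps \<one>\<^bsub>L\<^esub> b) = ps_scale (lam h) (ps \<one>\<^bsub>L\<^esub> \<one>\<^bsub>H\<^esub>)"
proof -
  note vs = vector_space_pointwise_scale
  note ml = multilinear lin_id[OF vs]
  have "lsum (H.cop h) (\<lambda>a b. ps \<one>\<^bsub>L\<^esub> (H.ant a) \<diamondop> ps \<one>\<^bsub>L\<^esub> b) =
    lsum (H.cop h) (\<lambda>a b. lsum (H.cop (H.ant a)) (\<lambda>u v. ps_scale (lam u) (ps \<one>\<^bsub>L\<^esub> (v \<bullet> b))))"
    by (simp add: ps_mulB act_unit L.mul_scale scale_ps)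
  also have "\<dots> = lsum (H.cop h) (\<lambda>a b. lsum (H.cop a) (\<lambda>c d. ps_scale (lam d) (ps \<one>\<^bsub>L\<^esub> (H.ant c \<bullet> b))))"
    by (subst H.ant_cop[where t = ps_scale]) (intro ml | simp add: lam_ant)+
  also have "\<dots> = lsum (H.cop h) (\<lambda>c k. lsum (H.cop k) (\<lambda>d b. ps_scale (lam d) (ps \<one>\<^bsub>L\<^esub> (H.ant c \<bullet> b))))"
    by (rule H.cop_coassoc[where t = ps_scale]) (intro ml)
  also have "\<dots> = lsum (H.cop h) (\<lambda>c k. lsum (H.cop k) (\<lambda>d b. ps_scale (lam b) (ps \<one>\<^bsub>L\<^esub> (H.ant c \<bullet> d))))"
    by (intro lsum_cong refl lam_central[where t = ps_scale]) (intro ml)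
  also have "\<dots> = lsum (H.cop h) (\<lambda>k b. lsum (H.cop k) (\<lambda>c d. ps_scale (lam b) (ps \<one>\<^bsub>L\<^esub> (H.ant c \<bullet> d))))"
    by (rule H.cop_coassoc[where t = ps_scale, symmetric]) (intro ml)
  also have "\<dots> = lsum (H.cop h) (\<lambda>k b. ps_scale (H.eps k) (ps_scale (lam b) (ps \<one>\<^bsub>L\<^esub> \<one>\<^bsub>H\<^esub>)))"
    by (intro lsum_cong refl H.cop_ant(1)[where t = ps_scale and f = "\<lambda>z. ps_scale b (ps \<one>\<^bsub>L\<^esub> z)" for b])
      (intro ml)
  also have "\<dots> = ps_scale (lam h) (ps \<one>\<^bsub>L\<^esub> \<one>\<^bsub>H\<^esub>)"
    by (subst H.cop_counit(1)[where t = ps_scale]) (intro ml | simp)+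
  finally show ?thesis .
qed

lemma cop_ps_ant_right:
  "lsum (H.cop h) (\<lambda>a b. ps x a \<diamondop> ps \<one>\<^bsub>L\<^esub> (H.ant b)) = ps_scale (lam h) (ps x \<one>\<^bsub>H\<^esub>)"
proof -
  note vs = vector_space_pointwise_scale
  note ml = multilinear lin_id[OF vs]
  have "lsum (H.cop h) (\<lambda>a b. ps x a \<diamondop> ps \<one>\<^bsub>L\<^esub> (H.ant b)) =
    lsum (H.cop h) (\<lambda>a b. lsum (H.cop a) (\<lambda>c d. ps_scale (lam c) (ps x (d \<bullet> H.ant b))))"
    by (simp add: ps_mulB act_unit L.mul_scale scale_ps)
  also have "\<dots> = lsum (H.cop h) (\<lambda>c k. lsum (H.cop k) (\<lambda>d b. ps_scale (lam c) (ps x (d \<bullet> H.ant b))))"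
    by (rule H.cop_coassoc[where t = ps_scale]) (intro ml)
  also have "\<dots> = lsum (H.cop h) (\<lambda>c k. ps_scale (H.eps k) (ps_scale (lam c) (ps x \<one>\<^bsub>H\<^esub>)))"
    by (intro lsum_cong refl H.cop_ant(2)[where t = ps_scale and f = "\<lambda>z. ps_scale b (ps x z)" for b])
      (intro ml)
  also have "\<dots> = ps_scale (lam h) (ps x \<one>\<^bsub>H\<^esub>)"
    by (subst H.cop_counit(2)[where t = ps_scale]) (intro ml | simp)+
  finally show ?thesis .
qed

text \<open>
  The factors \<open>S(x\<^sub>1) x\<^sub>2\<close> collapse first. By \<open>ro_ro_\<l>\<close> the two applications of the coaction leave
  \<open>S((h\<^sub>1\<^sup>1)\<^sub>1) (h\<^sub>1\<^sup>1)\<^sub>2\<close>, which collapses as well; what remains is \<open>(1 # S(h\<^sub>1)) (1 # h\<^sub>2)\<close>.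
\<close>

lemma antipode_left_ps:
  "lsum (copB (ps x h)) (\<lambda>a b. antB a \<diamondop> b) = ps_scale (epsB (ps x h)) (ps \<one>\<^bsub>L\<^esub> \<one>\<^bsub>H\<^esub>)"
proof -
  note vs = vector_space_pointwise_scale
  note ml = multilinear lin_id[OF vs]
  let ?G = "\<lambda>z. lsum (H.cop h) (\<lambda>h1 h2. lsum (ro h1) (\<lambda>p r. lsum (ro p) (\<lambda>q s.
      ps \<one>\<^bsub>L\<^esub> (H.ant q) \<diamondop> ps (L.ant s \<star> (z \<star> r)) h2)))"
  have "lsum (copB (ps x h)) (\<lambda>a b. antB a \<diamondop> b) = lsum (L.cop x) (\<lambda>x1 x2. ?G (L.ant x1 \<star> x2))"
    by (subst lsum_copB[where t = ps_scale])
      (intro ml | simp add: antB_ps smash_ant_def lsum_mulB ps_mul_assoc ps_unit_mul L.mul_assoc)+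
  also have "\<dots> = ps_scale (L.eps x) (?G \<one>\<^bsub>L\<^esub>)"
    by (rule L.cop_ant(1)[where t = ps_scale and f = ?G]) (intro ml)
  also have "?G \<one>\<^bsub>L\<^esub> = lsum (H.cop h) (\<lambda>h1 h2. lsum (ro h1) (\<lambda>p r. lsum (ro p) (\<lambda>q s.
      ps \<one>\<^bsub>L\<^esub> (H.ant q) \<diamondop> ps (L.ant s \<star> r) h2)))"
    by simp
  also have "\<dots> = lsum (H.cop h) (\<lambda>h1 h2. lsum (ro h1) (\<lambda>p r. lsum (L.cop r) (\<lambda>u v.
      ps \<one>\<^bsub>L\<^esub> (H.ant p) \<diamondop> ps (L.ant u \<star> (v \<star> \<l>)) h2)))"
    by (intro lsum_cong refl ro_ro_\<l>[where t = ps_scale]) (intro ml)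
  also have "\<dots> = lsum (H.cop h) (\<lambda>h1 h2. lsum (ro h1) (\<lambda>p r. lsum (L.cop r) (\<lambda>u v.
      ps \<one>\<^bsub>L\<^esub> (H.ant p) \<diamondop> ps (L.ant u \<star> v) h2)))"
    by simp
  also have "\<dots> = lsum (H.cop h) (\<lambda>h1 h2. lsum (ro h1) (\<lambda>p r.
      ps_scale (L.eps r) (ps \<one>\<^bsub>L\<^esub> (H.ant p) \<diamondop> ps \<one>\<^bsub>L\<^esub> h2)))"
    by (intro lsum_cong refl L.cop_ant(1)[where t = ps_scale and f = "\<lambda>z. s \<diamondop> ps z k" for s k]) (intro ml)
  also have "\<dots> = lsum (H.cop h) (\<lambda>h1 h2. ps \<one>\<^bsub>L\<^esub> (H.ant h1) \<diamondop> ps \<one>\<^bsub>L\<^esub> h2)"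
    by (subst ro_counit[where t = ps_scale]) (intro ml | simp)+
  also have "\<dots> = ps_scale (lam h) (ps \<one>\<^bsub>L\<^esub> \<one>\<^bsub>H\<^esub>)" by (rule cop_ps_ant_left)
  finally show ?thesis by (simp add: vector_space.vector_space_assms[OF vs])
qed

text \<open>
  The comodule coalgebra axiom merges \<open>h\<^sub>1\<^sup>0 \<otimes> h\<^sub>2\<^sup>0 \<otimes> h\<^sub>1\<^sup>1 h\<^sub>2\<^sup>1\<close> into \<open>\<Delta>(h\<^sup>0) \<otimes> h\<^sup>1\<close>, so that
  \<open>cop_ps_ant_right\<close> produces the factor \<open>\<lambda>(h\<^sup>0)\<close>. Then \<open>\<lambda>(h\<^sup>0) S(h\<^sup>1) = \<lambda>(h) \<l>\<close>, and \<open>x\<^sub>1 S(x\<^sub>2)\<close> collapses.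
\<close>

lemma antipode_right_ps:
  "lsum (copB (ps x h)) (\<lambda>a b. a \<diamondop> antB b) = ps_scale (epsB (ps x h)) (ps \<one>\<^bsub>L\<^esub> \<one>\<^bsub>H\<^esub>)"
proof -
  note vs = vector_space_pointwise_scale
  note ml = multilinear lin_id[OF vs]
  have "lsum (copB (ps x h)) (\<lambda>a b. a \<diamondop> antB b) = lsum (L.cop x) (\<lambda>x1 x2. lsum (H.cop h) (\<lambda>h1 h2.
      lsum (ro h1) (\<lambda>p r. lsum (ro h2) (\<lambda>q s.
        ps x1 p \<diamondop> ps \<one>\<^bsub>L\<^esub> (H.ant q) \<diamondop> ps (L.ant (r \<star> s) \<star> L.ant x2) \<one>\<^bsub>H\<^esub>))))"
    by (subst lsum_copB[where t = ps_scale])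
      (intro ml | simp add: antB_ps smash_ant_def lsum_mulB ps_mul_assoc L.ant_mul L.mul_assoc)+
  also have "\<dots> = lsum (L.cop x) (\<lambda>x1 x2. lsum (ro h) (\<lambda>p r. lsum (H.cop p) (\<lambda>p1 p2.
      ps x1 p1 \<diamondop> ps \<one>\<^bsub>L\<^esub> (H.ant p2) \<diamondop> ps (L.ant r \<star> L.ant x2) \<one>\<^bsub>H\<^esub>)))"
    by (intro lsum_cong refl ro_cop[where t = ps_scale, symmetric]) (intro ml)
  also have "\<dots> = lsum (L.cop x) (\<lambda>x1 x2. lsum (ro h) (\<lambda>p r.
      ps_scale (lam p) (ps (x1 \<star> (L.ant r \<star> L.ant x2)) \<one>\<^bsub>H\<^esub>)))"
  proof -
    have sc: "ps_scale c s \<diamondop> t = ps_scale c (s \<diamondop> t)" for c s t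
      using lin_mulB(1)[OF lin_id[OF vs]] by (simp add: lin_iff)
    show ?thesis
      by (simp only: lsum_mulB(1)[symmetric] cop_ps_ant_right sc ps_unit_mul)
  qed
  also have "\<dots> = lsum (L.cop x) (\<lambda>x1 x2. ps_scale (lam h) (ps (x1 \<star> (\<l> \<star> L.ant x2)) \<one>\<^bsub>H\<^esub>))"
    by (intro lsum_cong refl ro_ant[where t = ps_scale]) (intro ml)
  also have "\<dots> = lsum (L.cop x) (\<lambda>x1 x2. ps_scale (lam h) (ps (x1 \<star> L.ant x2) \<one>\<^bsub>H\<^esub>))"
    by simp
  also have "\<dots> = ps_scale (L.eps x) (ps_scale (lam h) (ps \<one>\<^bsub>L\<^esub> \<one>\<^bsub>H\<^esub>))"
    by (rule L.cop_ant(2)[where t = ps_scale and f = "\<lambda>z. ps_scale (lam h) (ps z \<one>\<^bsub>H\<^esub>)"]) (intro ml)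
  finally show ?thesis by (simp add: vector_space.vector_space_assms[OF vs])
qed

lemma hopf_algebra_B: "hopf_algebra B antB"
proof -
  note vs = vector_space_pointwise_scale
  note ml = multilinear lin_id[OF vs]
  have "linear_on B B antB"
  proof -
    have "lin ps_scale ps_scale antB" using lin_antB[OF lin_id[OF vs]] .
    then show ?thesis by (simp add: linear_on_def lin_iff antB_in)
  qed
  moreover have "sweedler B t (\<lambda>a b. antB a \<diamondop> b) = ps_scale (epsB t) (ps \<one>\<^bsub>L\<^esub> \<one>\<^bsub>H\<^esub>)"
    "sweedler B t (\<lambda>a b. a \<diamondop> antB b) = ps_scale (epsB t) (ps \<one>\<^bsub>L\<^esub> \<one>\<^bsub>H\<^esub>)" if "t \<in> carrier smash_space" for t
    unfolding sweedler_B
    by (rule eq_on_smash_space[OF _ _ _ that, where t = ps_scale and F = "\<lambda>t. lsum (copB t) (\<lambda>a b. antB a \<diamondop> b)"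
        and G = "\<lambda>t. ps_scale (epsB t) (ps \<one>\<^bsub>L\<^esub> \<one>\<^bsub>H\<^esub>)"];
        intro ml antipode_left_ps)
      (rule eq_on_smash_space[OF _ _ _ that, where t = ps_scale and F = "\<lambda>t. lsum (copB t) (\<lambda>a b. a \<diamondop> antB b)"
        and G = "\<lambda>t. ps_scale (epsB t) (ps \<one>\<^bsub>L\<^esub> \<one>\<^bsub>H\<^esub>)"];
        intro ml antipode_right_ps)
  ultimately show ?thesis
    using bialgebra_B by (simp add: hopf_algebra_def hopf_algebra_axioms_def)
qed

lemma partial_smash_bialgebra_B: "partial_smash_bialgebra H L (\<rightharpoonup>) \<rho> B"
proof -
  have carrier: "{partial_smash H L (\<rightharpoonup>) \<rho> x h | x h. x \<in> carrier L \<and> h \<in> carrier H} =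
      {ps x h | x h. True}" (is "?A = ?B")
  proof
    show "?A \<subseteq> ?B" by (auto simp: partial_smash_ps) blast
    have "ps x h \<in> ?A" for x h
      using partial_smash_ps[of "proj L x" "proj H h"] by (auto intro!: exI[of _ "proj L x"] exI[of _ "proj H h"])
    then show "?B \<subseteq> ?A" by blast
  qed
  show ?thesis
    unfolding partial_smash_bialgebra_def carrier
    by (simp add: bialgebra_B partial_smash_ps to_total ps_mulB comB_ps smash_cop_def tensor_B tenB_eq
        tensor_space_def cong: lsum_cong)
      (simp add: smash_space_def lam_def)
qed

lemma antB_formula:
  assumes "x \<in> carrier L" "h \<in> carrier H"
  shows "antB (partial_smash H L (\<rightharpoonup>) \<rho> x h) =
    tensor_sum H L (\<rho> h) (\<lambda>h0 h1.
      partial_smash H L (\<rightharpoonup>) \<rho> \<one>\<^bsub>L\<^esub> (SH h0) \<cdot>\<^bsub>B\<^esub>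
      partial_smash H L (\<rightharpoonup>) \<rho> (SL h1 \<cdot>\<^bsub>L\<^esub> SL x) \<one>\<^bsub>H\<^esub>)"
  using assms
  by (simp add: partial_smash_ps to_total antB_ps smash_ant_def cong: lsum_cong)

end

theorem theorem3p15:
  fixes H :: "('k::field, 'h::ab_group_add) bialg" and SH :: "'h \<Rightarrow> 'h"
    and L :: "('k, 'l::ab_group_add) bialg" and SL :: "'l \<Rightarrow> 'l"
    and act :: "'h \<Rightarrow> 'l \<Rightarrow> 'l" (infixr "\<rightharpoonup>" 80)
    and \<rho> :: "'h \<Rightarrow> ('h \<Rightarrow> 'l \<Rightarrow> 'k) \<Rightarrow> 'k"
  assumes "quasi_abelian_partial_matched_pair H SH L SL (\<rightharpoonup>) \<rho>"
    and "\<And>h. h \<in> carrier H \<Longrightarrow>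
      tensor_sum H L (\<rho> h) (\<lambda>h0 h1. tensor L L (h0 \<rightharpoonup> \<one>\<^bsub>L\<^esub>) (SL h1)) =
      tensor_sum H L (\<rho> \<one>\<^bsub>H\<^esub>) (\<lambda>u l.
        (counit H u * counit L (h \<rightharpoonup> \<one>\<^bsub>L\<^esub>)) \<odot>\<^bsub>tensor_space L L\<^esub> tensor L L \<one>\<^bsub>L\<^esub> l)"
    and "\<And>h g. h \<in> carrier H \<Longrightarrow> g \<in> carrier H \<Longrightarrow>
      tensor_sum H L (\<rho> h) (\<lambda>h0 h1. counit H h0 \<odot>\<^bsub>L\<^esub> (SH g \<rightharpoonup> h1)) =
      tensor_sum H L (\<rho> \<one>\<^bsub>H\<^esub>) (\<lambda>u l.
        (counit L (g \<rightharpoonup> \<one>\<^bsub>L\<^esub>) * counit H h * counit H u) \<odot>\<^bsub>L\<^esub> l)"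
  shows "\<exists>B S. partial_smash_bialgebra H L (\<rightharpoonup>) \<rho> B \<and> hopf_algebra B S \<and>
    (\<forall>x \<in> carrier L. \<forall>h \<in> carrier H.
      S (partial_smash H L (\<rightharpoonup>) \<rho> x h) =
      tensor_sum H L (\<rho> h) (\<lambda>h0 h1.
        partial_smash H L (\<rightharpoonup>) \<rho> \<one>\<^bsub>L\<^esub> (SH h0) \<cdot>\<^bsub>B\<^esub>
        partial_smash H L (\<rightharpoonup>) \<rho> (SL h1 \<cdot>\<^bsub>L\<^esub> SL x) \<one>\<^bsub>H\<^esub>))"
proof -
  interpret antipode_matched_pair H SH L SL act \<rho>
    using assms by (simp add: antipode_matched_pair_def antipode_matched_pair_axioms_def)
  show ?thesis
    using partial_smash_bialgebra_B hopf_algebra_B antB_formula by blast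
qed

end
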